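(* Let $\Gamma$ be an icc countable discrete group and let $\Gamma\curvearrowright(P_0\subseteq P)$ be a compact extension of tracial von Neumann algebras. Let $P_0\rtimes\Gamma\subseteq P\rtimes\Gamma$ be the corresponding inclusion of crossed product von Neumann algebras. Then for any intermediate von Neumann subalgebra $P_0\rtimes\Gamma\subseteq N\subseteq P\rtimes\Gamma$ there exists an intermediate ($\Gamma$-invariant) von Neumann subalgebra $P_0\subseteq Q\subseteq P$ such that $N=Q\rtimes\Gamma$.
   Context: A group is icc if all its nontrivial conjugacy classes are infinite. An extension $\Gamma\curvearrowright(P_0\subseteq P)$ of tracial von Neumann algebras is an inclusion $P_0\subseteq P$ of von Neumann algebras with a faithful normal trace $\tau$ on $P$, together with a trace-preserving action $\Gamma\curvearrowright^{\sigma}P$ leaving $P_0$ invariant. The extension is compact if there exists $\mathcal F\subseteq P$ such that: (1) $\overline{\mathrm{span}\,\mathcal F}^{\|\cdot\|_2}=L^2(P)$; and (2) for every $f\in\mathcal F$ and $\varepsilon>0$ there exist $\xi_1,\dots,\xi_n\in L^2(P)$ such that for every $\gamma\in\Gamma$ one can find $\kappa_i(\gamma)\in P_0$, $1\le i\le n$, satisfying $\sup_{1\le i\le n,\ \gamma\in\Gamma}\|\kappa_i(\gamma)\|_\infty<\infty$ and $\big\|\sigma_\gamma(f)-\sum_{i=1}^n\kappa_i(\gamma)\xi_i\big\|_2\le\varepsilon$. *)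

theory Defs
  imports "HOL-Analysis.Analysis"
begin

section \<open>Complex Hilbert spaces\<close>

text \<open>
  A complex Hilbert space is a complete real inner product space with a compatible complex
  structure; \<open>cinner\<close> is linear in its first argument.  Positive definiteness of \<open>cinner\<close> and
  \<open>norm x = sqrt (Re (cinner x x))\<close> follow from \<open>inner_eq_Re_cinner\<close>.
\<close>

class complex_hilbert = real_inner + complete_space +
  fixes scaleC :: "complex \<Rightarrow> 'a \<Rightarrow> 'a"  (infixr "*\<^sub>C" 75)
    and cinner :: "'a \<Rightarrow> 'a \<Rightarrow> complex"
  assumes scaleC_add_right: "c *\<^sub>C (x + y) = c *\<^sub>C x + c *\<^sub>C y"
    and scaleC_add_left: "(c + d) *\<^sub>C x = c *\<^sub>C x + d *\<^sub>C x"
    and scaleC_scaleC: "c *\<^sub>C d *\<^sub>C x = (c * d) *\<^sub>C x"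
    and scaleR_eq_scaleC: "r *\<^sub>R x = complex_of_real r *\<^sub>C x"
    and cinner_commute: "cinner x y = cnj (cinner y x)"
    and cinner_add_left: "cinner (x + y) z = cinner x z + cinner y z"
    and cinner_scaleC_left: "cinner (c *\<^sub>C x) y = c * cinner x y"
    and inner_eq_Re_cinner: "inner x y = Re (cinner x y)"

lemma norm_scaleC: "norm (c *\<^sub>C x) = cmod c * norm (x::'a::complex_hilbert)"
proof -
  have "cinner (c *\<^sub>C x) (c *\<^sub>C x) = c * cnj (c * cnj (cinner x x))"
    by (metis cinner_commute cinner_scaleC_left)
  also have "\<dots> = complex_of_real ((cmod c)\<^sup>2) * cinner x x"
    by (simp add: complex_norm_square[symmetric] mult.assoc[symmetric])
  finally have "Re (cinner (c *\<^sub>C x) (c *\<^sub>C x)) = (cmod c)\<^sup>2 * Re (cinner x x)"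
    by simp
  then show ?thesis
    by (simp add: norm_eq_sqrt_inner inner_eq_Re_cinner real_sqrt_mult)
qed

lemma Im_cinner: "Im (cinner x y) = inner (- \<i> *\<^sub>C x) (y::'a::complex_hilbert)"
  by (simp add: inner_eq_Re_cinner cinner_scaleC_left)

lemma norm_cinner_le: "cmod (cinner x y) \<le> 2 * (norm x * norm (y::'a::complex_hilbert))"
proof -
  have "\<bar>Re (cinner x y)\<bar> \<le> norm x * norm y"
    using Cauchy_Schwarz_ineq2[of x y] by (simp add: inner_eq_Re_cinner)
  moreover have "\<bar>Im (cinner x y)\<bar> \<le> norm x * norm y"
    using Cauchy_Schwarz_ineq2[of "- \<i> *\<^sub>C x" y] by (simp add: Im_cinner norm_scaleC)
  ultimately show ?thesis
    using cmod_le[of "cinner x y"] by linarith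
qed

subsection \<open>The Hilbert space of square-summable families\<close>

typedef (overloaded) ('g, 'h::complex_hilbert) ell2 =
  "{f :: 'g \<Rightarrow> 'h. (\<lambda>g. (norm (f g))\<^sup>2) summable_on UNIV}"
  morphisms ell2_nth Abs_ell2
  by (rule exI[of _ "\<lambda>_. 0"]) simp

setup_lifting type_definition_ell2

lemma summable_ell2: "(\<lambda>g. (norm (ell2_nth x g))\<^sup>2) summable_on UNIV"
  using ell2_nth[of x] by simp

lemma ell2_comparison:
  fixes f :: "'g \<Rightarrow> 'h::complex_hilbert" and g :: "'g \<Rightarrow> real"
  assumes "g summable_on UNIV" and "\<And>i. (norm (f i))\<^sup>2 \<le> g i"
  shows "(\<lambda>i. (norm (f i))\<^sup>2) summable_on UNIV"
  by (rule summable_on_comparison_test[OF assms(1)]) (auto simp: assms(2))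

lemma norm_add_sq_le: "(norm (a + b))\<^sup>2 \<le> 2 * ((norm a)\<^sup>2 + (norm (b::'a::real_normed_vector))\<^sup>2)"
proof -
  have "(norm (a + b))\<^sup>2 \<le> (norm a + norm b)\<^sup>2"
    by (simp add: norm_triangle_ineq power_mono)
  also have "\<dots> \<le> 2 * ((norm a)\<^sup>2 + (norm b)\<^sup>2)"
    using sum_squares_bound[of "norm a" "norm b"] by (simp add: power2_sum)
  finally show ?thesis .
qed

lemma ell2_add_closed:
  fixes f g :: "'g \<Rightarrow> 'h::complex_hilbert"
  assumes "(\<lambda>i. (norm (f i))\<^sup>2) summable_on UNIV" and "(\<lambda>i. (norm (g i))\<^sup>2) summable_on UNIV"
  shows "(\<lambda>i. (norm (f i + g i))\<^sup>2) summable_on UNIV"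
  by (rule ell2_comparison[OF summable_on_cmult_right[OF summable_on_add[OF assms], of 2]])
     (rule norm_add_sq_le)

lemma ell2_scale_closed:
  fixes f :: "'g \<Rightarrow> 'h::complex_hilbert"
  assumes "(\<lambda>i. (norm (f i))\<^sup>2) summable_on UNIV"
  shows "(\<lambda>i. (norm (c *\<^sub>C f i))\<^sup>2) summable_on UNIV"
  by (rule ell2_comparison[OF summable_on_cmult_right[OF assms, of "(cmod c)\<^sup>2"]])
     (simp add: norm_scaleC power_mult_distrib)

lemma summable_cinner_ell2:
  "(\<lambda>i. cinner (ell2_nth x i) (ell2_nth y i)) summable_on UNIV"
proof -
  have "(\<lambda>i. norm (cinner (ell2_nth x i) (ell2_nth y i))) summable_on UNIV"
  proof (rule summable_on_comparison_test[OF summable_on_add[OF summable_ell2[of x] summable_ell2[of y]]])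
    fix i
    have "2 * (norm (ell2_nth x i) * norm (ell2_nth y i))
            \<le> (norm (ell2_nth x i))\<^sup>2 + (norm (ell2_nth y i))\<^sup>2"
      using sum_squares_bound[of "norm (ell2_nth x i)" "norm (ell2_nth y i)"] by (simp add: mult.assoc)
    then show "norm (cinner (ell2_nth x i) (ell2_nth y i))
            \<le> (norm (ell2_nth x i))\<^sup>2 + (norm (ell2_nth y i))\<^sup>2"
      using norm_cinner_le order_trans by blast
  qed simp
  then show ?thesis by (rule abs_summable_summable)
qed

instantiation ell2 :: (type, complex_hilbert) real_inner
begin

lift_definition zero_ell2 :: "('a, 'b) ell2" is "\<lambda>_. 0" by simp

lift_definition plus_ell2 :: "('a, 'b) ell2 \<Rightarrow> ('a, 'b) ell2 \<Rightarrow> ('a, 'b) ell2"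
  is "\<lambda>f g i. f i + g i" by (rule ell2_add_closed)

lift_definition uminus_ell2 :: "('a, 'b) ell2 \<Rightarrow> ('a, 'b) ell2"
  is "\<lambda>f i. - f i" by simp

lift_definition minus_ell2 :: "('a, 'b) ell2 \<Rightarrow> ('a, 'b) ell2 \<Rightarrow> ('a, 'b) ell2"
  is "\<lambda>f g i. f i - g i"
  subgoal for f g using ell2_add_closed[of f "\<lambda>i. - g i"] by simp
  done

lift_definition scaleR_ell2 :: "real \<Rightarrow> ('a, 'b) ell2 \<Rightarrow> ('a, 'b) ell2"
  is "\<lambda>r f i. r *\<^sub>R f i"
  unfolding scaleR_eq_scaleC by (rule ell2_scale_closed)

definition inner_ell2 :: "('a, 'b) ell2 \<Rightarrow> ('a, 'b) ell2 \<Rightarrow> real" where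
  "inner_ell2 x y = Re (\<Sum>\<^sub>\<infinity>i. cinner (ell2_nth x i) (ell2_nth y i))"

definition norm_ell2 :: "('a, 'b) ell2 \<Rightarrow> real" where
  "norm_ell2 x = sqrt (inner x x)"

definition sgn_ell2 :: "('a, 'b) ell2 \<Rightarrow> ('a, 'b) ell2" where
  "sgn_ell2 x = inverse (norm x) *\<^sub>R x"

definition dist_ell2 :: "('a, 'b) ell2 \<Rightarrow> ('a, 'b) ell2 \<Rightarrow> real" where
  "dist_ell2 x y = norm (x - y)"

definition uniformity_ell2 :: "(('a, 'b) ell2 \<times> ('a, 'b) ell2) filter" where
  "uniformity_ell2 = (INF e\<in>{0<..}. principal {(x, y). dist x y < e})"

definition open_ell2 :: "('a, 'b) ell2 set \<Rightarrow> bool" where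
  "open_ell2 U = (\<forall>x\<in>U. \<forall>\<^sub>F (x', y) in uniformity. x' = x \<longrightarrow> y \<in> U)"

lemma inner_ell2_Re:
  "inner x y = (\<Sum>\<^sub>\<infinity>i. inner (ell2_nth x i) (ell2_nth y i))" for x y :: "('a, 'b) ell2"
  unfolding inner_ell2_def inner_eq_Re_cinner
  by (rule infsum_Re[symmetric]) (rule summable_cinner_ell2)

lemma summable_inner_ell2:
  "(\<lambda>i. inner (ell2_nth x i) (ell2_nth y i)) summable_on UNIV" for x y :: "('a, 'b) ell2"
  unfolding inner_eq_Re_cinner by (rule summable_on_Re) (rule summable_cinner_ell2)

instance
proof
  fix x y z :: "('a, 'b) ell2" and r s :: real
  show "dist x y = norm (x - y)" by (rule dist_ell2_def)
  show "sgn x = inverse (norm x) *\<^sub>R x" by (rule sgn_ell2_def)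
  show "(uniformity :: (('a, 'b) ell2 \<times> ('a, 'b) ell2) filter)
        = (INF e\<in>{0<..}. principal {(x, y). dist x y < e})" by (rule uniformity_ell2_def)
  show "open U = (\<forall>x\<in>U. \<forall>\<^sub>F (x', y) in uniformity. x' = x \<longrightarrow> y \<in> U)"
    for U :: "('a, 'b) ell2 set" by (rule open_ell2_def)
  show "x + y + z = x + (y + z)" by transfer (simp add: add.assoc)
  show "x + y = y + x" by transfer (simp add: add.commute)
  show "0 + x = x" by transfer simp
  show "- x + x = 0" by transfer simp
  show "x - y = x + - y" by transfer simp
  show "r *\<^sub>R (x + y) = r *\<^sub>R x + r *\<^sub>R y" by transfer (simp add: scaleR_add_right)
  show "(r + s) *\<^sub>R x = r *\<^sub>R x + s *\<^sub>R x" by transfer (simp add: scaleR_add_left)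
  show "r *\<^sub>R s *\<^sub>R x = (r * s) *\<^sub>R x" by transfer simp
  show "1 *\<^sub>R x = x" by transfer simp
  show "inner x y = inner y x" unfolding inner_ell2_Re by (simp add: inner_commute)
  show "inner (x + y) z = inner x z + inner y z"
    unfolding inner_ell2_Re plus_ell2.rep_eq inner_add_left
    by (rule infsum_add) (rule summable_inner_ell2)+
  show "inner (r *\<^sub>R x) y = r * inner x y"
    unfolding inner_ell2_Re scaleR_ell2.rep_eq inner_scaleR_left
    by (rule infsum_cmult_right')
  show "0 \<le> inner x x" unfolding inner_ell2_Re by (rule infsum_nonneg) simp
  show "inner x x = 0 \<longleftrightarrow> x = 0"
  proof
    assume *: "inner x x = 0"
    have "inner (ell2_nth x i) (ell2_nth x i) = 0" for i
      by (rule nonneg_infsum_le_0D[OF _ summable_inner_ell2[of x x]])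
         (use * in \<open>auto simp: inner_ell2_Re\<close>)
    then show "x = 0" by (auto simp: ell2_nth_inject[symmetric] zero_ell2.rep_eq)
  next
    assume "x = 0" then show "inner x x = 0" by (simp add: inner_ell2_Re zero_ell2.rep_eq)
  qed
  show "norm x = sqrt (inner x x)" by (rule norm_ell2_def)
qed

end

lemma norm_ell2_sq: "(norm x)\<^sup>2 = (\<Sum>\<^sub>\<infinity>i. (norm (ell2_nth x i))\<^sup>2)"
  by (simp add: power2_norm_eq_inner inner_ell2_Re)

lemma sum_le_norm_ell2_sq:
  assumes "finite F" shows "(\<Sum>i\<in>F. (norm (ell2_nth x i))\<^sup>2) \<le> (norm x)\<^sup>2"
  unfolding norm_ell2_sq by (rule finite_sum_le_infsum) (auto simp: assms summable_ell2)

lemma norm_ell2_nth_le: "norm (ell2_nth x i) \<le> norm x"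
  using sum_le_norm_ell2_sq[of "{i}" x] by (simp add: power2_le_iff_abs_le)

instance ell2 :: (type, complex_hilbert) complete_space
proof
  fix X :: "nat \<Rightarrow> ('a, 'b) ell2"
  assume X: "Cauchy X"
  have nth: "Cauchy (\<lambda>n. ell2_nth (X n) i)" for i
  proof (rule CauchyI)
    fix e :: real assume "e > 0"
    then obtain N where N: "\<And>m n. m \<ge> N \<Longrightarrow> n \<ge> N \<Longrightarrow> norm (X m - X n) < e"
      using CauchyD[OF X] by metis
    show "\<exists>N. \<forall>m\<ge>N. \<forall>n\<ge>N. norm (ell2_nth (X m) i - ell2_nth (X n) i) < e"
      using N norm_ell2_nth_le[of "X _ - X _" i]
      by (metis minus_ell2.rep_eq order_le_less_trans)
  qed
  define f where "f i = lim (\<lambda>n. ell2_nth (X n) i)" for i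
  have f: "(\<lambda>n. ell2_nth (X n) i) \<longlonglongrightarrow> f i" for i
    using nth[of i] unfolding f_def Cauchy_convergent_iff convergent_LIMSEQ_iff .
  have bound: "(\<Sum>i\<in>F. (norm (ell2_nth (X m) i - f i))\<^sup>2) \<le> e\<^sup>2"
    if "finite F" "e > 0" "\<And>n. n \<ge> N \<Longrightarrow> norm (X m - X n) < e" for F e N m
  proof (rule tendsto_upperbound)
    show "(\<lambda>n. \<Sum>i\<in>F. (norm (ell2_nth (X m) i - ell2_nth (X n) i))\<^sup>2)
            \<longlonglongrightarrow> (\<Sum>i\<in>F. (norm (ell2_nth (X m) i - f i))\<^sup>2)"
      by (intro tendsto_intros f)
    have "(\<Sum>i\<in>F. (norm (ell2_nth (X m) i - ell2_nth (X n) i))\<^sup>2) \<le> e\<^sup>2" if "n \<ge> N" for n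
    proof -
      have "(\<Sum>i\<in>F. (norm (ell2_nth (X m - X n) i))\<^sup>2) \<le> (norm (X m - X n))\<^sup>2"
        by (rule sum_le_norm_ell2_sq) fact
      also have "\<dots> \<le> e\<^sup>2"
        using \<open>\<And>n. n \<ge> N \<Longrightarrow> norm (X m - X n) < e\<close>[OF that] by (intro power_mono) auto
      finally show ?thesis by (simp add: minus_ell2.rep_eq)
    qed
    then show "\<forall>\<^sub>F n in sequentially.
        (\<Sum>i\<in>F. (norm (ell2_nth (X m) i - ell2_nth (X n) i))\<^sup>2) \<le> e\<^sup>2"
      by (auto simp: eventually_sequentially)
  qed simp
  have diff: "(\<lambda>i. (norm (ell2_nth (X m) i - f i))\<^sup>2) summable_on UNIV"
    if "e > 0" "\<And>n. n \<ge> N \<Longrightarrow> norm (X m - X n) < e" for e N m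
    by (rule nonneg_bdd_above_summable_on)
       (auto intro!: bdd_aboveI2[where M = "e\<^sup>2"] bound[OF _ that])
  obtain N where N: "\<And>m n. m \<ge> N \<Longrightarrow> n \<ge> N \<Longrightarrow> norm (X m - X n) < 1"
    using CauchyD[OF X, of 1] by auto
  have "(\<lambda>i. (norm (ell2_nth (X N) i - f i))\<^sup>2) summable_on UNIV"
    by (rule diff[of 1 N]) (auto intro: N)
  from ell2_add_closed[OF summable_ell2[of "X N"] ell2_scale_closed[OF this, of "- 1"]]
  have "(\<lambda>i. (norm (f i))\<^sup>2) summable_on UNIV"
    by (simp add: norm_minus_commute scaleR_eq_scaleC[of "-1", simplified, symmetric])
  then have nth_f: "ell2_nth (Abs_ell2 f) = f"
    by (simp add: Abs_ell2_inverse)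
  have "X \<longlonglongrightarrow> Abs_ell2 f"
  proof (rule LIMSEQ_I)
    fix r :: real assume "r > 0"
    define e where "e = r / 2"
    have e: "e > 0" "e < r" using \<open>r > 0\<close> by (auto simp: e_def)
    obtain N where N: "\<And>m n. m \<ge> N \<Longrightarrow> n \<ge> N \<Longrightarrow> norm (X m - X n) < e"
      using CauchyD[OF X \<open>e > 0\<close>] by auto
    have "norm (X m - Abs_ell2 f) < r" if "m \<ge> N" for m
    proof -
      have "(norm (X m - Abs_ell2 f))\<^sup>2 \<le> e\<^sup>2"
        unfolding norm_ell2_sq minus_ell2.rep_eq nth_f
        by (rule infsum_le_finite_sums)
           (auto intro!: diff[of e N] bound[of _ e N] e N that)
      then have "norm (X m - Abs_ell2 f) \<le> e"
        using e by (simp add: power2_le_iff_abs_le)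
      then show ?thesis using e by simp
    qed
    then show "\<exists>no. \<forall>n\<ge>no. norm (X n - Abs_ell2 f) < r" by blast
  qed
  then show "convergent X" by (rule convergentI)
qed

instantiation ell2 :: (type, complex_hilbert) complex_hilbert
begin

lift_definition scaleC_ell2 :: "complex \<Rightarrow> ('a, 'b) ell2 \<Rightarrow> ('a, 'b) ell2"
  is "\<lambda>c f i. c *\<^sub>C f i" by (rule ell2_scale_closed)

definition cinner_ell2 :: "('a, 'b) ell2 \<Rightarrow> ('a, 'b) ell2 \<Rightarrow> complex" where
  "cinner_ell2 x y = (\<Sum>\<^sub>\<infinity>i. cinner (ell2_nth x i) (ell2_nth y i))"

instance
proof
  fix x y z :: "('a, 'b) ell2" and c d :: complex and r :: real
  show "c *\<^sub>C (x + y) = c *\<^sub>C x + c *\<^sub>C y" by transfer (simp add: scaleC_add_right)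
  show "(c + d) *\<^sub>C x = c *\<^sub>C x + d *\<^sub>C x" by transfer (simp add: scaleC_add_left)
  show "c *\<^sub>C d *\<^sub>C x = (c * d) *\<^sub>C x" by transfer (simp add: scaleC_scaleC)
  show "r *\<^sub>R x = complex_of_real r *\<^sub>C x" by transfer (simp add: scaleR_eq_scaleC)
  show "cinner x y = cnj (cinner y x)"
    unfolding cinner_ell2_def infsum_cnj[symmetric] cinner_commute[symmetric] ..
  show "cinner (x + y) z = cinner x z + cinner y z"
    unfolding cinner_ell2_def plus_ell2.rep_eq cinner_add_left
    by (rule infsum_add) (rule summable_cinner_ell2)+
  show "cinner (c *\<^sub>C x) y = c * cinner x y"
    unfolding cinner_ell2_def scaleC_ell2.rep_eq cinner_scaleC_left
    by (rule infsum_cmult_right')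
  show "inner x y = Re (cinner x y)" by (simp add: cinner_ell2_def inner_ell2_def)
qed

end


section \<open>Von Neumann algebras\<close>

text \<open>
  \<open>'h \<Rightarrow>\<^sub>L 'h\<close> consists of the bounded \<^emph>\<open>real\<close>-linear operators; \<open>BH\<close> is the algebra of bounded
  complex-linear operators on \<open>'h\<close>.
\<close>

type_synonym 'h operator = "'h \<Rightarrow>\<^sub>L 'h"

definition BH :: "'h::complex_hilbert operator set" where
  "BH = {T. \<forall>c x. blinfun_apply T (c *\<^sub>C x) = c *\<^sub>C blinfun_apply T x}"

definition op_scaleC :: "complex \<Rightarrow> 'h::complex_hilbert operator \<Rightarrow> 'h operator" where
  "op_scaleC c T = Blinfun (\<lambda>x. c *\<^sub>C T x)"

definition op_adjoint :: "'h::complex_hilbert operator \<Rightarrow> 'h operator" where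
  "op_adjoint T = (THE S. \<forall>x y. cinner (blinfun_apply S x) y = cinner x (blinfun_apply T y))"

definition commutant :: "'h::complex_hilbert operator set \<Rightarrow> 'h operator set" where
  "commutant S = {T \<in> BH. \<forall>A\<in>S. T o\<^sub>L A = A o\<^sub>L T}"

definition von_neumann_algebra :: "'h::complex_hilbert operator set \<Rightarrow> bool" where
  "von_neumann_algebra M \<longleftrightarrow>
     M \<subseteq> BH \<and> (\<forall>a\<in>M. op_adjoint a \<in> M) \<and> commutant (commutant M) = M"

definition vN_generated :: "'h::complex_hilbert operator set \<Rightarrow> 'h operator set" where
  "vN_generated S = \<Inter>{M. von_neumann_algebra M \<and> S \<subseteq> M}"

definition square_summable :: "(nat \<Rightarrow> 'h::complex_hilbert) \<Rightarrow> bool" where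
  "square_summable \<xi> \<longleftrightarrow> summable (\<lambda>n. (norm (\<xi> n))\<^sup>2)"

text \<open>The coarsest topology making all functionals
  \<open>T \<mapsto> (\<Sum>n. cinner (T (\<xi> n)) (\<eta> n))\<close> with square-summable \<open>\<xi>\<close>, \<open>\<eta>\<close> continuous.\<close>

definition ultraweak_topology :: "'h::complex_hilbert operator topology" where
  "ultraweak_topology = topology_generated_by
     {{T \<in> BH. (\<Sum>n. cinner (blinfun_apply T (\<xi> n)) (\<eta> n)) \<in> U} | \<xi> \<eta> U.
        square_summable \<xi> \<and> square_summable \<eta> \<and> open U}"

text \<open>Normality is ultraweak continuity.  The trace is not required to satisfy \<open>\<tau> 1 = 1\<close>.\<close>

definition faithful_normal_trace ::
  "'h::complex_hilbert operator set \<Rightarrow> ('h operator \<Rightarrow> complex) \<Rightarrow> bool" where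
  "faithful_normal_trace M \<tau> \<longleftrightarrow>
     (\<forall>a\<in>M. \<forall>b\<in>M. \<tau> (a + b) = \<tau> a + \<tau> b) \<and>
     (\<forall>c. \<forall>a\<in>M. \<tau> (op_scaleC c a) = c * \<tau> a) \<and>
     (\<forall>a\<in>M. \<tau> (op_adjoint a o\<^sub>L a) \<in> \<real>\<^sub>\<ge>\<^sub>0) \<and>
     (\<forall>a\<in>M. \<forall>b\<in>M. \<tau> (a o\<^sub>L b) = \<tau> (b o\<^sub>L a)) \<and>
     (\<forall>a\<in>M. \<tau> (op_adjoint a o\<^sub>L a) = 0 \<longrightarrow> a = 0) \<and>
     continuous_map (subtopology ultraweak_topology M) euclidean \<tau>"

definition star_automorphism ::
  "'h::complex_hilbert operator set \<Rightarrow> ('h operator \<Rightarrow> 'h operator) \<Rightarrow> bool" where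
  "star_automorphism M \<theta> \<longleftrightarrow>
     bij_betw \<theta> M M \<and>
     (\<forall>a\<in>M. \<forall>b\<in>M. \<theta> (a + b) = \<theta> a + \<theta> b) \<and>
     (\<forall>c. \<forall>a\<in>M. \<theta> (op_scaleC c a) = op_scaleC c (\<theta> a)) \<and>
     (\<forall>a\<in>M. \<forall>b\<in>M. \<theta> (a o\<^sub>L b) = \<theta> a o\<^sub>L \<theta> b) \<and>
     (\<forall>a\<in>M. \<theta> (op_adjoint a) = op_adjoint (\<theta> a))"


section \<open>Extensions of tracial von Neumann algebras\<close>

text \<open>
  The group is a type of class \<open>group_add\<close>, which does not assume commutativity: the product of
  \<open>g\<close> and \<open>h\<close> is written \<open>g + h\<close>, the inverse \<open>- g\<close>, the unit \<open>0\<close>.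
\<close>

definition conjugacy_class :: "'g::group_add \<Rightarrow> 'g set" where
  "conjugacy_class g = {h + g + - h | h. True}"

definition icc :: "'g::group_add itself \<Rightarrow> bool" where
  "icc _ \<longleftrightarrow> (\<forall>g::'g. g \<noteq> 0 \<longrightarrow> infinite (conjugacy_class g))"

definition trace_preserving_action ::
  "('g::group_add \<Rightarrow> 'h::complex_hilbert operator \<Rightarrow> 'h operator) \<Rightarrow> 'h operator set \<Rightarrow>
     ('h operator \<Rightarrow> complex) \<Rightarrow> bool" where
  "trace_preserving_action \<sigma> P \<tau> \<longleftrightarrow>
     (\<forall>g. star_automorphism P (\<sigma> g)) \<and>
     (\<forall>a\<in>P. \<sigma> 0 a = a) \<and>
     (\<forall>g h. \<forall>a\<in>P. \<sigma> (g + h) a = \<sigma> g (\<sigma> h a)) \<and>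
     (\<forall>g. \<forall>a\<in>P. \<tau> (\<sigma> g a) = \<tau> a)"

definition tracial_extension ::
  "('g::group_add \<Rightarrow> 'h::complex_hilbert operator \<Rightarrow> 'h operator) \<Rightarrow> 'h operator set \<Rightarrow>
     'h operator set \<Rightarrow> ('h operator \<Rightarrow> complex) \<Rightarrow> bool" where
  "tracial_extension \<sigma> P0 P \<tau> \<longleftrightarrow>
     von_neumann_algebra P0 \<and> von_neumann_algebra P \<and> P0 \<subseteq> P \<and>
     faithful_normal_trace P \<tau> \<and>
     trace_preserving_action \<sigma> P \<tau> \<and>
     (\<forall>g. \<sigma> g ` P0 = P0)"

definition norm2 :: "('h::complex_hilbert operator \<Rightarrow> complex) \<Rightarrow> 'h operator \<Rightarrow> real" where
  "norm2 \<tau> a = sqrt (Re (\<tau> (op_adjoint a o\<^sub>L a)))"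

text \<open>
  \<open>L\<^sup>2(P, \<tau>)\<close> is the completion of \<open>P\<close> with respect to \<open>norm2 \<tau>\<close>.  Its vectors are represented by
  Cauchy sequences in \<open>P\<close>, with \<open>a \<in> P\<close> embedded as the constant sequence and left multiplication
  by elements of \<open>P\<close> acting termwise.  Sequences at distance \<open>0\<close> represent the same vector; the
  quotient is not formed, since below vectors only enter through the norm of a difference.
\<close>

definition L2 ::
  "'h::complex_hilbert operator set \<Rightarrow> ('h operator \<Rightarrow> complex) \<Rightarrow> (nat \<Rightarrow> 'h operator) set" where
  "L2 P \<tau> = {\<xi>. range \<xi> \<subseteq> P \<and>
     (\<forall>e>0. \<exists>N. \<forall>m\<ge>N. \<forall>n\<ge>N. norm2 \<tau> (\<xi> m - \<xi> n) < e)}"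

definition L2_norm ::
  "('h::complex_hilbert operator \<Rightarrow> complex) \<Rightarrow> (nat \<Rightarrow> 'h operator) \<Rightarrow> real" where
  "L2_norm \<tau> \<xi> = lim (\<lambda>k. norm2 \<tau> (\<xi> k))"

definition op_cspan :: "'h::complex_hilbert operator set \<Rightarrow> 'h operator set" where
  "op_cspan F = {(\<Sum>a\<in>A. op_scaleC (c a) a) | A c. finite A \<and> A \<subseteq> F}"

definition compact_extension ::
  "('g::group_add \<Rightarrow> 'h::complex_hilbert operator \<Rightarrow> 'h operator) \<Rightarrow> 'h operator set \<Rightarrow>
     'h operator set \<Rightarrow> ('h operator \<Rightarrow> complex) \<Rightarrow> bool" where
  "compact_extension \<sigma> P0 P \<tau> \<longleftrightarrow>
     tracial_extension \<sigma> P0 P \<tau> \<and>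
     (\<exists>F\<subseteq>P.
        (\<forall>\<xi>\<in>L2 P \<tau>. \<forall>\<epsilon>>0. \<exists>a\<in>op_cspan F. L2_norm \<tau> (\<lambda>k. \<xi> k - a) < \<epsilon>) \<and>
        (\<forall>f\<in>F. \<forall>\<epsilon>>0. \<exists>(n::nat) \<xi>. (\<forall>i\<in>{1..n}. \<xi> i \<in> L2 P \<tau>) \<and>
           (\<exists>\<kappa>. (\<forall>i\<in>{1..n}. \<forall>g. \<kappa> i g \<in> P0) \<and>
                (\<exists>C. \<forall>i\<in>{1..n}. \<forall>g. norm (\<kappa> i g) \<le> C) \<and>
                (\<forall>g. L2_norm \<tau> (\<lambda>k. \<sigma> g f - (\<Sum>i\<in>{1..n}. \<kappa> i g o\<^sub>L \<xi> i k)) \<le> \<epsilon>))))"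


section \<open>Crossed products\<close>

text \<open>
  For \<open>P\<close> acting on \<open>'h\<close>, the crossed product by \<open>\<sigma>\<close> acts on \<open>\<ell>\<^sup>2(\<Gamma>, 'h)\<close>.  It is generated by
  \<open>(\<pi>(a) \<xi>)(h) = \<sigma>\<^bsub>h\<^sup>-\<^sup>1\<^esub>(a) \<xi>(h)\<close> for \<open>a \<in> P\<close> and \<open>(\<lambda>(g) \<xi>)(h) = \<xi>(g\<^sup>-\<^sup>1h)\<close> for \<open>g \<in> \<Gamma>\<close>, so that
  \<open>\<lambda>(g) \<pi>(a) \<lambda>(g)\<^sup>* = \<pi>(\<sigma>\<^bsub>g\<^esub>(a))\<close>.  The maps below are bounded because *-automorphisms of \<open>P\<close> are
  isometric for the operator norm.
\<close>

definition crossed_embed ::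
  "('g::group_add \<Rightarrow> 'h::complex_hilbert operator \<Rightarrow> 'h operator) \<Rightarrow> 'h operator \<Rightarrow>
     ('g, 'h) ell2 operator" where
  "crossed_embed \<sigma> a = Blinfun (\<lambda>\<xi>. Abs_ell2 (\<lambda>h. \<sigma> (- h) a (ell2_nth \<xi> h)))"

definition crossed_unitary :: "'g::group_add \<Rightarrow> ('g, 'h::complex_hilbert) ell2 operator" where
  "crossed_unitary g = Blinfun (\<lambda>\<xi>. Abs_ell2 (\<lambda>h. ell2_nth \<xi> (- g + h)))"

definition crossed_product ::
  "('g::group_add \<Rightarrow> 'h::complex_hilbert operator \<Rightarrow> 'h operator) \<Rightarrow> 'h operator set \<Rightarrow>
     ('g, 'h) ell2 operator set" where
  "crossed_product \<sigma> Q = vN_generated (crossed_embed \<sigma> ` Q \<union> range crossed_unitary)"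

end

theory Submission
  imports Defs
begin

text \<open>
  A normal faithful trace on \<open>P\<close> is a vector state of an amplification, which replaces \<open>L\<^sup>2(P)\<close> by
  a subspace of a concrete Hilbert space; placing the vector at the unit of \<open>\<Gamma>\<close> gives a trace vector
  \<open>\<Omega>'\<close> for the crossed product.  Let \<open>e\<close> be the projection onto the closure of \<open>N \<Omega>'\<close>.  For a
  vector \<open>f \<in> P\<close> with almost periodic orbit, the projections \<open>u\<^sub>g e(f) u\<^sub>g\<^sup>*\<close> of \<open>\<sigma>\<^sub>g(f)\<close> are, uniformly
  in \<open>g\<close>, almost supported in one finite subset of \<open>\<Gamma>\<close>.  Conjugation by \<open>g\<close> moves the coefficient at
  \<open>h\<close> to \<open>g h g\<^sup>-\<^sup>1\<close>, and nontrivial conjugacy classes are infinite, so \<open>e(f)\<close> is supported at the unit.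
  Thus \<open>e\<close> commutes with the projection onto the closure of \<open>P \<Omega>'\<close>, all Fourier coefficients of
  elements of \<open>N\<close> lie in \<open>Q = N \<inter> P\<close>, and \<open>N = Q \<rtimes> \<Gamma>\<close> follows because membership in a von Neumann
  subalgebra can be tested on the trace vector.
\<close>

text \<open>\<open>P\<close> is given on an arbitrary Hilbert space that need not contain a trace
  vector, hence the amplifications; L2 of an algebra is then the closure of an orbit in a concrete
  space, with no quotient to form. The recurring obstacle is that approximating an element of a
  bicommutant on finitely many vectors gives no control of operator norms. Traciality compensates:
  \<open>x\<close> and its adjoint have the same 2-norm, so an approximation on the trace vector is
  also one for the adjoint. The uniformity in \<open>g\<close> of the support estimate comes from
  the coefficients \<kappa> lying in \<open>P0\<close>. They vary with \<open>g\<close>, but their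
  embeddings belong to \<open>N\<close>, hence commute with \<open>e_N\<close>, and act
  coordinatewise over the group, hence do not enlarge supports. As they are uniformly bounded,
  everything reduces to the tails of finitely many fixed vectors, the projections of the \<xi>,
  which are small outside one finite set.\<close>

notation blinfun_apply (infixl "\<cdot>" 90)

section \<open>Complex Hilbert spaces\<close>

lemma cinner_add_right: "cinner x (y + z) = cinner x y + cinner x (z::'a::complex_hilbert)"
  by (metis cinner_add_left cinner_commute complex_cnj_add)

lemma cinner_scaleC_right: "cinner x (c *\<^sub>C y) = cnj c * cinner x (y::'a::complex_hilbert)"
  by (metis cinner_scaleC_left cinner_commute complex_cnj_mult)

lemma scaleC_zero_left [simp]: "0 *\<^sub>C x = (0::'a::complex_hilbert)"
  by (metis of_real_0 scaleR_eq_scaleC scale_zero_left)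

lemma scaleC_zero_right [simp]: "c *\<^sub>C 0 = (0::'a::complex_hilbert)"
  by (metis scaleC_add_right add_cancel_left_right)

lemma scaleC_one [simp]: "1 *\<^sub>C x = (x::'a::complex_hilbert)"
  by (metis of_real_1 scaleR_eq_scaleC scaleR_one)

lemma scaleC_minus1 [simp]: "(-1) *\<^sub>C x = - (x::'a::complex_hilbert)"
  by (metis add.right_inverse add_eq_0_iff scaleC_add_left scaleC_one scaleC_zero_left)

lemma scaleC_minus_right: "c *\<^sub>C (- x) = - (c *\<^sub>C (x::'a::complex_hilbert))"
  by (metis scaleC_add_right add.right_inverse add_eq_0_iff scaleC_zero_right)

lemma scaleC_diff_right: "c *\<^sub>C (x - y) = c *\<^sub>C x - c *\<^sub>C (y::'a::complex_hilbert)"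
  by (metis scaleC_add_right scaleC_minus_right diff_conv_add_uminus)

lemma cinner_zero_left [simp]: "cinner 0 (x::'a::complex_hilbert) = 0"
  by (metis cinner_add_left add_cancel_left_right)

lemma cinner_zero_right [simp]: "cinner (x::'a::complex_hilbert) 0 = 0"
  by (metis cinner_add_right add_cancel_left_right)

lemma cinner_minus_left [simp]: "cinner (- x) y = - cinner x (y::'a::complex_hilbert)"
  by (metis cinner_scaleC_left mult_minus1 scaleC_minus1)

lemma cinner_minus_right [simp]: "cinner x (- y) = - cinner x (y::'a::complex_hilbert)"
  by (metis cinner_commute cinner_minus_left complex_cnj_minus)

lemma cinner_diff_left: "cinner (x - y) z = cinner x z - cinner y (z::'a::complex_hilbert)"
  by (metis cinner_add_left cinner_minus_left diff_conv_add_uminus)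

lemma cinner_diff_right: "cinner x (y - z) = cinner x y - cinner x (z::'a::complex_hilbert)"
  by (metis cinner_add_right cinner_minus_right diff_conv_add_uminus)

lemma cinner_same: "cinner x x = complex_of_real ((norm (x::'a::complex_hilbert))\<^sup>2)"
proof (rule complex_eqI)
  show "Re (cinner x x) = Re (complex_of_real ((norm x)\<^sup>2))"
    by (simp add: power2_norm_eq_inner inner_eq_Re_cinner)
  have "Im (cinner x x) = Im (cnj (cinner x x))"
    by (subst cinner_commute) (rule refl)
  then show "Im (cinner x x) = Im (complex_of_real ((norm x)\<^sup>2))" by simp
qed

lemma norm_sq_cinner: "(norm (x::'a::complex_hilbert))\<^sup>2 = Re (cinner x x)"
  by (simp add: cinner_same)

text \<open>Rotating \<open>x\<close> by a unimodular scalar makes the inner product real and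
  nonnegative, so the real Cauchy-Schwarz inequality applies and the factor 2 of
  \<open>norm_cinner_le\<close> disappears.\<close>

lemma cmod_cinner_le: "cmod (cinner x y) \<le> norm x * norm (y::'a::complex_hilbert)"
proof (cases "cinner x y = 0")
  case False
  define c where "c = cnj (cinner x y) / cmod (cinner x y)"
  have c: "cmod c = 1" using False by (simp add: c_def norm_divide)
  have "c * cinner x y = cmod (cinner x y)"
    using False by (simp add: c_def mult.commute[of "cnj _"] complex_norm_square[symmetric] power2_eq_square)
  then have "cmod (cinner x y) = Re (cinner (c *\<^sub>C x) y)"
    by (simp add: cinner_scaleC_left)
  also have "\<dots> = inner (c *\<^sub>C x) y" by (simp add: inner_eq_Re_cinner)
  also have "\<dots> \<le> norm (c *\<^sub>C x) * norm y" by (rule norm_cauchy_schwarz)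
  finally show ?thesis by (simp add: norm_scaleC c)
qed simp

lemma bounded_linear_cinner_left: "bounded_linear (\<lambda>x. cinner x (y::'a::complex_hilbert))"
  by (rule bounded_linear_intro[where K = "norm y"])
     (auto simp: cinner_add_left cmod_cinner_le scaleR_eq_scaleC cinner_scaleC_left scaleR_conv_of_real)

lemma bounded_linear_cinner_right: "bounded_linear (\<lambda>y. cinner (x::'a::complex_hilbert) y)"
  by (rule bounded_linear_intro[where K = "norm x"])
     (auto simp: cinner_add_right cmod_cinner_le scaleR_eq_scaleC cinner_scaleC_right
        scaleR_conv_of_real mult.commute[of "norm _" "norm x"])

lemma bounded_linear_scaleC: "bounded_linear (\<lambda>x::'a::complex_hilbert. c *\<^sub>C x)"
  by (rule bounded_linear_intro[where K = "cmod c"])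
     (auto simp: scaleC_add_right norm_scaleC scaleR_eq_scaleC scaleC_scaleC mult.commute)

lemmas continuous_cinner_right = linear_continuous_on[OF bounded_linear_cinner_right]

lemma cinner_sum_left: "cinner (\<Sum>i\<in>A. f i) y = (\<Sum>i\<in>A. cinner (f i) (y::'a::complex_hilbert))"
  by (rule linear_sum) (simp add: bounded_linear.linear bounded_linear_cinner_left)

lemma cinner_ext: "(\<And>z. cinner x z = cinner y z) \<Longrightarrow> x = (y::'a::complex_hilbert)"
proof -
  assume "\<And>z. cinner x z = cinner y z"
  then have "cinner (x - y) (x - y) = 0" by (simp add: cinner_diff_left)
  then show ?thesis by (simp add: cinner_same)
qed

lemma norm_Pythagoras:
  "cinner x y = 0 \<Longrightarrow> (norm (x + y))\<^sup>2 = (norm x)\<^sup>2 + (norm (y::'a::complex_hilbert))\<^sup>2"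
  by (simp add: norm_sq_cinner cinner_add_left cinner_add_right cinner_commute[of y x])

subsection \<open>Orthogonal projections\<close>

definition csubspace :: "'a::complex_hilbert set \<Rightarrow> bool" where
  "csubspace W \<longleftrightarrow> 0 \<in> W \<and> (\<forall>x\<in>W. \<forall>y\<in>W. x + y \<in> W) \<and> (\<forall>c. \<forall>x\<in>W. c *\<^sub>C x \<in> W)"

lemma csubspaceD:
  assumes "csubspace W"
  shows "0 \<in> W" "x \<in> W \<Longrightarrow> y \<in> W \<Longrightarrow> x + y \<in> W" "x \<in> W \<Longrightarrow> c *\<^sub>C x \<in> W"
    "x \<in> W \<Longrightarrow> y \<in> W \<Longrightarrow> x - y \<in> W" "x \<in> W \<Longrightarrow> r *\<^sub>R x \<in> W" "x \<in> W \<Longrightarrow> - x \<in> W"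
proof -
  show "x \<in> W \<Longrightarrow> - x \<in> W" for x
    using assms unfolding csubspace_def by (metis scaleC_minus1)
  then show "x \<in> W \<Longrightarrow> y \<in> W \<Longrightarrow> x - y \<in> W"
    using assms unfolding csubspace_def by (metis diff_conv_add_uminus)
qed (use assms in \<open>auto simp: csubspace_def scaleR_eq_scaleC\<close>)

lemma closure_sequentialI: "(\<And>n::nat. f n \<in> W) \<Longrightarrow> f \<longlonglongrightarrow> x \<Longrightarrow> x \<in> closure W"
  for x :: "'a::metric_space"
  unfolding closure_sequential by blast

lemma csubspace_closure:
  assumes "csubspace W" shows "csubspace (closure W)"
  unfolding csubspace_def
proof (intro conjI ballI allI)
  show "0 \<in> closure W" using assms closure_subset csubspaceD(1) by blast
  fix x assume x: "x \<in> closure W"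
  obtain f where f: "\<And>n. f n \<in> W" "f \<longlonglongrightarrow> x" using x closure_sequential by metis
  { fix y assume y: "y \<in> closure W"
    obtain g where g: "\<And>n. g n \<in> W" "g \<longlonglongrightarrow> y" using y closure_sequential by metis
    have "(\<lambda>n. f n + g n) \<longlonglongrightarrow> x + y" by (intro tendsto_intros f g)
    then show "x + y \<in> closure W"
      by (rule closure_sequentialI[rotated]) (intro csubspaceD(2)[OF assms] f(1) g(1)) }
  fix c
  have "(\<lambda>n. c *\<^sub>C f n) \<longlonglongrightarrow> c *\<^sub>C x"
    by (rule bounded_linear.tendsto[OF bounded_linear_scaleC f(2)])
  then show "c *\<^sub>C x \<in> closure W"
    by (rule closure_sequentialI[rotated]) (intro csubspaceD(3)[OF assms] f(1))
qed

text \<open>A minimising sequence is Cauchy by the parallelogram law, since midpoints stay in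
  \<open>W\<close> and have distance at least \<open>d\<close> from \<open>x\<close>.\<close>

lemma closest_vector_exists:
  fixes W :: "'a::complex_hilbert set"
  assumes W: "csubspace W" "closed W"
  obtains p where "p \<in> W" "\<And>w. w \<in> W \<Longrightarrow> norm (x - p) \<le> norm (x - w)"
proof -
  define d where "d = infdist x W"
  have ne: "W \<noteq> {}" using csubspaceD(1)[OF W(1)] by auto
  have dle: "d \<le> norm (x - w)" if "w \<in> W" for w
    unfolding d_def by (metis infdist_le that dist_norm)
  have d0: "d \<ge> 0" by (simp add: d_def infdist_nonneg)
  have "\<exists>w\<in>W. norm (x - w) < d + inverse (Suc n)" for n
    using cInf_lessD[of "dist x ` W" "d + inverse (Suc n)"] ne
    unfolding d_def infdist_notempty[OF ne] dist_norm by auto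
  then obtain w where w: "\<And>n. w n \<in> W" "\<And>n. norm (x - w n) < d + inverse (Suc n)" by metis
  have par: "(norm (w m - w n))\<^sup>2 \<le> 2 * (norm (x - w m))\<^sup>2 + 2 * (norm (x - w n))\<^sup>2 - 4 * d\<^sup>2" for m n
  proof -
    have mid: "(1/2) *\<^sub>R (w m + w n) \<in> W" by (intro csubspaceD[OF W(1)] w)
    have "(norm (w m - w n))\<^sup>2 + (norm ((x - w m) + (x - w n)))\<^sup>2 =
        2 * (norm (x - w m))\<^sup>2 + 2 * (norm (x - w n))\<^sup>2"
      unfolding power2_norm_eq_inner
      by (simp add: inner_diff_left inner_diff_right inner_add_left inner_add_right inner_commute)
    moreover have "(x - w m) + (x - w n) = 2 *\<^sub>R (x - (1/2) *\<^sub>R (w m + w n))"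
      by (simp add: scaleR_diff_right scaleR_2[of x])
    then have "(norm ((x - w m) + (x - w n)))\<^sup>2 = 4 * (norm (x - (1/2) *\<^sub>R (w m + w n)))\<^sup>2"
      by (simp add: power_mult_distrib)
    moreover have "d\<^sup>2 \<le> (norm (x - (1/2) *\<^sub>R (w m + w n)))\<^sup>2"
      using dle[OF mid] d0 by (rule power_mono)
    ultimately show ?thesis by linarith
  qed
  have dd: "(\<lambda>n. d + inverse (real (Suc n))) \<longlonglongrightarrow> d + 0"
    by (intro tendsto_intros LIMSEQ_inverse_real_of_nat)
  have wd: "(\<lambda>n. norm (x - w n)) \<longlonglongrightarrow> d"
  proof (rule tendsto_sandwich[where f = "\<lambda>_. d" and h = "\<lambda>n. d + inverse (real (Suc n))"])
    show "\<forall>\<^sub>F n in sequentially. d \<le> norm (x - w n)"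
      by (simp add: dle w(1))
    show "\<forall>\<^sub>F n in sequentially. norm (x - w n) \<le> d + inverse (real (Suc n))"
      using w(2) by (simp add: less_imp_le)
  qed (use dd in simp_all)
  have "Cauchy w"
  proof (rule CauchyI)
    fix e :: real assume e: "e > 0"
    have "(\<lambda>n. (norm (x - w n))\<^sup>2) \<longlonglongrightarrow> d\<^sup>2" by (intro tendsto_intros wd)
    then have "\<forall>\<^sub>F n in sequentially. (norm (x - w n))\<^sup>2 < d\<^sup>2 + e\<^sup>2 / 4"
      using e by (intro order_tendstoD(2)) auto
    then obtain N where N: "\<And>n. n \<ge> N \<Longrightarrow> (norm (x - w n))\<^sup>2 < d\<^sup>2 + e\<^sup>2 / 4"
      by (auto simp: eventually_sequentially)
    have "norm (w m - w n) < e" if "m \<ge> N" "n \<ge> N" for m n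
    proof -
      have "(norm (w m - w n))\<^sup>2 < e\<^sup>2" using par[of m n] N[OF that(1)] N[OF that(2)] by linarith
      then show ?thesis using e by (simp add: power_less_imp_less_base)
    qed
    then show "\<exists>M. \<forall>m\<ge>M. \<forall>n\<ge>M. norm (w m - w n) < e" by blast
  qed
  then obtain p where p: "w \<longlonglongrightarrow> p" using Cauchy_convergent_iff convergent_def by metis
  have "p \<in> W" using W(2) p w(1) closed_sequentially by blast
  moreover have "(\<lambda>n. norm (x - w n)) \<longlonglongrightarrow> norm (x - p)" by (intro tendsto_intros p)
  then have "norm (x - p) = d" using wd LIMSEQ_unique by blast
  ultimately show ?thesis using that dle by simp
qed

lemma orthogonal_decomposition:
  fixes W :: "'a::complex_hilbert set"
  assumes W: "csubspace W" "closed W"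
  obtains p where "p \<in> W" "\<And>w. w \<in> W \<Longrightarrow> cinner w (x - p) = 0"
proof -
  obtain p where p: "p \<in> W" "\<And>w. w \<in> W \<Longrightarrow> norm (x - p) \<le> norm (x - w)"
    using closest_vector_exists[OF W] by blast
  have re0: "inner w (x - p) \<le> 0" if "w \<in> W" for w
  proof (rule ccontr)
    assume *: "\<not> inner w (x - p) \<le> 0"
    \<comment> \<open>This \<open>t\<close> minimises the distance from \<open>x - p\<close> to the
      real line through \<open>w\<close>; a positive inner product would contradict the minimality
      of \<open>p\<close>.\<close>
    define t where "t = inner w (x - p) / (norm w)\<^sup>2"
    have nw: "norm w \<noteq> 0" using * by auto
    have "p + t *\<^sub>R w \<in> W" by (intro csubspaceD[OF W(1)] p that)
    then have "(norm (x - p))\<^sup>2 \<le> (norm ((x - p) - t *\<^sub>R w))\<^sup>2"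
      using p(2) by (metis diff_diff_eq norm_ge_zero power_mono)
    also have "\<dots> = (norm (x - p))\<^sup>2 - 2 * t * inner w (x - p) + t\<^sup>2 * (norm w)\<^sup>2"
      unfolding power2_norm_eq_inner
      by (simp add: inner_diff_left inner_diff_right inner_commute power2_eq_square algebra_simps)
    also have "t\<^sup>2 * (norm w)\<^sup>2 = t * inner w (x - p)"
      using nw by (simp add: t_def power2_eq_square field_simps)
    finally have "t * inner w (x - p) \<le> 0" by simp
    moreover have "t > 0" using * nw by (simp add: t_def)
    ultimately show False using * by (simp add: mult_le_0_iff)
  qed
  have "cinner w (x - p) = 0" if "w \<in> W" for w
  proof (rule complex_eqI)
    have *: "inner v (x - p) = 0" if "v \<in> W" for v
      using re0[OF that] re0[OF csubspaceD(6)[OF W(1) that]] by simp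
    show "Re (cinner w (x - p)) = Re 0" using *[OF that] by (simp add: inner_eq_Re_cinner)
    show "Im (cinner w (x - p)) = Im 0"
      using *[OF csubspaceD(3)[OF W(1) that, of "-\<i>"]] by (simp add: Im_cinner)
  qed
  then show ?thesis using p(1) that by blast
qed

text \<open>Characterised by orthogonality of the residual rather than by minimal distance: that
  condition is linear, so uniqueness yields additivity and homogeneity at once.\<close>

definition oproj :: "'a::complex_hilbert set \<Rightarrow> 'a operator" where
  "oproj W = Blinfun (\<lambda>x. SOME p. p \<in> W \<and> (\<forall>w\<in>W. cinner w (x - p) = 0))"

lemma orthogonal_decomposition_unique:
  assumes W: "csubspace W"
    and "p \<in> W" "\<And>w. w \<in> W \<Longrightarrow> cinner w (x - p) = 0" "q \<in> W" "\<And>w. w \<in> W \<Longrightarrow> cinner w (x - q) = 0"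
  shows "p = q"
proof -
  have "p - q \<in> W" using csubspaceD(4)[OF W] assms by blast
  then have "cinner (p - q) ((x - q) - (x - p)) = 0"
    using assms by (simp add: cinner_diff_right)
  then show ?thesis by (simp add: cinner_same)
qed

context
  fixes W :: "'a::complex_hilbert set"
  assumes W: "csubspace W" "closed W"
begin

lemma oproj_works:
  "oproj W \<cdot> x \<in> W" "w \<in> W \<Longrightarrow> cinner w (x - oproj W \<cdot> x) = 0"
proof -
  define p where "p x = (SOME p. p \<in> W \<and> (\<forall>w\<in>W. cinner w (x - p) = 0))" for x
  have p: "p x \<in> W \<and> (\<forall>w\<in>W. cinner w (x - p x) = 0)" for x
    unfolding p_def by (rule someI_ex) (metis orthogonal_decomposition[OF W])
  have eq: "p x = q" if "q \<in> W" "\<And>w. w \<in> W \<Longrightarrow> cinner w (x - q) = 0" for x q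
    by (rule orthogonal_decomposition_unique[OF W(1), of _ x]) (use p that in auto)
  have "bounded_linear p"
  proof (rule bounded_linear_intro[where K = 1])
    fix x y
    show "p (x + y) = p x + p y"
    proof (rule eq)
      show "p x + p y \<in> W" by (intro csubspaceD[OF W(1)]) (use p in auto)
      fix w assume "w \<in> W"
      then have "cinner w (x - p x) + cinner w (y - p y) = 0" using p by simp
      then show "cinner w (x + y - (p x + p y)) = 0"
        by (simp add: cinner_diff_right cinner_add_right algebra_simps)
    qed
  next
    fix r :: real and x
    show "p (r *\<^sub>R x) = r *\<^sub>R p x"
    proof (rule eq)
      show "r *\<^sub>R p x \<in> W" by (intro csubspaceD[OF W(1)]) (use p in auto)
      fix w assume "w \<in> W"
      then show "cinner w (r *\<^sub>R x - r *\<^sub>R p x) = 0"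
        using p by (simp add: scaleR_eq_scaleC cinner_scaleC_right flip: scaleC_diff_right)
    qed
  next
    fix x
    have "cinner (p x) (x - p x) = 0" using p by blast
    from norm_Pythagoras[OF this] have "(norm (p x))\<^sup>2 \<le> (norm x)\<^sup>2" by simp
    then show "norm (p x) \<le> norm x * 1" by (simp add: power2_le_iff_abs_le)
  qed
  then have "oproj W \<cdot> x = p x" for x
    unfolding oproj_def p_def by (simp add: bounded_linear_Blinfun_apply)
  then show "oproj W \<cdot> x \<in> W" "w \<in> W \<Longrightarrow> cinner w (x - oproj W \<cdot> x) = 0"
    using p by auto
qed

lemma oproj_eqI: "q \<in> W \<Longrightarrow> (\<And>w. w \<in> W \<Longrightarrow> cinner w (x - q) = 0) \<Longrightarrow> oproj W \<cdot> x = q"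
  by (rule orthogonal_decomposition_unique[OF W(1), of _ x]) (use oproj_works in auto)

lemma oproj_ident: "x \<in> W \<Longrightarrow> oproj W \<cdot> x = x"
  by (rule oproj_eqI) auto

lemma oproj_BH: "oproj W \<in> BH"
  unfolding BH_def
  by (auto intro!: oproj_eqI csubspaceD[OF W(1)] oproj_works
      simp flip: scaleC_diff_right simp: cinner_scaleC_right)

lemma oproj_norm_le: "norm (oproj W \<cdot> x) \<le> norm x"
proof -
  have "cinner (oproj W \<cdot> x) (x - oproj W \<cdot> x) = 0" using oproj_works by blast
  from norm_Pythagoras[OF this] have "(norm (oproj W \<cdot> x))\<^sup>2 \<le> (norm x)\<^sup>2" by simp
  then show ?thesis by (simp add: power2_le_iff_abs_le)
qed

end

lemma closure_UNIV_if_orthogonal_trivial: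
  assumes "csubspace D" "\<And>z. (\<And>v. v \<in> D \<Longrightarrow> cinner v z = 0) \<Longrightarrow> z = 0"
  shows "closure D = UNIV"
proof -
  note W = csubspace_closure[OF assms(1)] closed_closure
  have "x \<in> closure D" for x
  proof -
    have "x - oproj (closure D) \<cdot> x = 0"
      using assms(2) oproj_works(2)[OF W] closure_subset by blast
    then show ?thesis using oproj_works(1)[OF W, of x] by simp
  qed
  then show ?thesis by auto
qed

text \<open>The functional is given by its composition \<open>f\<close> with a parametrisation \<open>i\<close> of a subspace that
  need not be closed.\<close>

lemma Riesz_representation:
  fixes i :: "'b::plus \<Rightarrow> 'a::complex_hilbert" and sc :: "complex \<Rightarrow> 'b \<Rightarrow> 'b"
  assumes closed: "\<And>a b c. a \<in> S \<Longrightarrow> b \<in> S \<Longrightarrow> a + sc c b \<in> S"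
    and i: "\<And>a b c. a \<in> S \<Longrightarrow> b \<in> S \<Longrightarrow> i (a + sc c b) = i a + c *\<^sub>C i b"
    and f: "\<And>a b c. a \<in> S \<Longrightarrow> b \<in> S \<Longrightarrow> f (a + sc c b) = f a + c * f b"
    and bound: "\<And>a. a \<in> S \<Longrightarrow> cmod (f a) \<le> C * norm (i a)"
    and ne: "S \<noteq> {}"
  shows "\<exists>r\<in>closure (i ` S). \<forall>a\<in>S. f a = cinner (i a) r"
proof -
  \<comment> \<open>Applied with \<open>P\<close> constantly true for the whole range and with
    \<open>P\<close> the vanishing of \<open>f\<close> for the kernel. Zero and scalar multiples are
    both produced from \<open>a + sc c b\<close>, starting from \<open>z = a0 - a0\<close>.\<close>
  have sub: "csubspace (i ` {a \<in> S. P (f a)})"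
    if P: "P 0" "\<And>x y c. P x \<Longrightarrow> P y \<Longrightarrow> P (x + c * y)" for P
  proof -
    obtain a0 where a0: "a0 \<in> S" using ne by auto
    define z where "z = a0 + sc (-1) a0"
    have z: "z \<in> S" "i z = 0" "f z = 0"
      using closed[OF a0 a0, of "-1"] i[OF a0 a0, of "-1"] f[OF a0 a0, of "-1"] by (auto simp: z_def)
    show ?thesis unfolding csubspace_def
    proof (intro conjI ballI allI)
      show "0 \<in> i ` {a \<in> S. P (f a)}" using z P(1) by (intro image_eqI[where x = z]) auto
      fix x assume "x \<in> i ` {a \<in> S. P (f a)}"
      then obtain a where a: "a \<in> S" "P (f a)" "x = i a" by auto
      { fix y assume "y \<in> i ` {a \<in> S. P (f a)}"
        then obtain b where b: "b \<in> S" "P (f b)" "y = i b" by auto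
        show "x + y \<in> i ` {a \<in> S. P (f a)}"
          using closed[OF a(1) b(1), of 1] i[OF a(1) b(1), of 1] f[OF a(1) b(1), of 1] a b P(2)[OF a(2) b(2), of 1]
          by (intro image_eqI[where x = "a + sc 1 b"]) auto }
      fix c
      show "c *\<^sub>C x \<in> i ` {a \<in> S. P (f a)}"
        using closed[OF z(1) a(1), of c] i[OF z(1) a(1), of c] f[OF z(1) a(1), of c] a z P(2)[OF P(1) a(2), of c]
        by (intro image_eqI[where x = "z + sc c a"]) auto
    qed
  qed
  show ?thesis
  proof (cases "\<forall>a\<in>S. f a = 0")
    case True
    have "0 \<in> closure (i ` S)"
      using csubspaceD(1)[OF sub[of "\<lambda>_. True"]] closure_subset[of "i ` S"] by auto
    then show ?thesis using True by (intro bexI[of _ 0]) auto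
  next
    case False
    then obtain d0 where d0: "d0 \<in> S" "f d0 \<noteq> 0" by auto
    define K where "K = closure (i ` {a \<in> S. f a = 0})"
    have K: "csubspace K" "closed K"
      unfolding K_def by (auto intro!: csubspace_closure sub)
    define r where "r = i d0 - oproj K \<cdot> i d0"
    have orth: "w \<in> K \<Longrightarrow> cinner w r = 0" for w unfolding r_def by (rule oproj_works[OF K])
    \<comment> \<open>Subtracting the multiple of \<open>d0\<close> with the same value of
      \<open>f\<close> puts any \<open>a\<close> into the kernel, so its inner product with
      \<open>r\<close> is determined by \<open>f a\<close>.\<close>
    have key: "f d0 * cinner (i a) r = f a * cinner (i d0) r" if a: "a \<in> S" for a
    proof -
      define c where "c = - (f a / f d0)"
      have "f (a + sc c d0) = 0" using d0 f[OF a d0(1), of c] by (simp add: c_def)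
      then have "i (a + sc c d0) \<in> K"
        unfolding K_def using closed[OF a d0(1)] by (intro subsetD[OF closure_subset] imageI) simp
      then have "cinner (i a + c *\<^sub>C i d0) r = 0" using orth i[OF a d0(1)] by simp
      then have "cinner (i a) r = f a / f d0 * cinner (i d0) r"
        by (simp add: cinner_add_left cinner_scaleC_left c_def)
      then show ?thesis using d0 by simp
    qed
    have "cinner (oproj K \<cdot> i d0) r = 0" by (rule orth) (rule oproj_works[OF K])
    then have ir: "cinner (i d0) r = of_real ((norm r)\<^sup>2)"
      using cinner_same[of r] unfolding r_def by (simp add: cinner_diff_left)
    \<comment> \<open>If \<open>i d0\<close> were a limit of kernel vectors \<open>i a\<close>, the
      bound for \<open>f\<close> at \<open>a - d0\<close> would make the modulus of
      \<open>f d0\<close> smaller than itself. The 1 added to \<open>\<bar>C\<bar>\<close> keeps the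
      denominator positive.\<close>
    have "norm r \<noteq> 0"
    proof
      assume "norm r = 0"
      then have "i d0 \<in> K" using oproj_works(1)[OF K, of "i d0"] by (simp add: r_def)
      then have "\<forall>e>0. \<exists>y\<in>i ` {a \<in> S. f a = 0}. dist y (i d0) < e"
        unfolding K_def closure_approachable .
      moreover have "cmod (f d0) / (\<bar>C\<bar> + 1) > 0" using d0 by auto
      ultimately obtain a where a: "a \<in> S" "f a = 0" "dist (i a) (i d0) < cmod (f d0) / (\<bar>C\<bar> + 1)"
        by (metis (mono_tags, lifting) imageE mem_Collect_eq)
      have "cmod (f d0) = cmod (f (a + sc (-1) d0))" using f[OF a(1) d0(1), of "-1"] a by simp
      also have "\<dots> \<le> C * norm (i (a + sc (-1) d0))" by (rule bound) (rule closed[OF a(1) d0(1)])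
      also have "norm (i (a + sc (-1) d0)) = dist (i a) (i d0)"
        using i[OF a(1) d0(1), of "-1"] by (simp add: dist_norm)
      also have "C * dist (i a) (i d0) \<le> (\<bar>C\<bar> + 1) * dist (i a) (i d0)"
        by (intro mult_right_mono) auto
      also have "\<dots> < (\<bar>C\<bar> + 1) * (cmod (f d0) / (\<bar>C\<bar> + 1))"
        by (intro mult_strict_left_mono a) auto
      also have "\<dots> = cmod (f d0)" by simp
      finally show False by simp
    qed
    define r' where "r' = cnj (f d0 / of_real ((norm r)\<^sup>2)) *\<^sub>C r"
    have "f a = cinner (i a) r'" if "a \<in> S" for a
      using key[OF that] \<open>norm r \<noteq> 0\<close> unfolding r'_def cinner_scaleC_right ir by (simp add: field_simps)
    moreover have "r' \<in> closure (i ` S)"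
    proof -
      have cl: "csubspace (closure (i ` S))" using sub[of "\<lambda>_. True"] by (intro csubspace_closure) simp
      have "K \<subseteq> closure (i ` S)" unfolding K_def by (intro closure_mono) auto
      then have "r \<in> closure (i ` S)"
        unfolding r_def using d0 closure_subset[of "i ` S"] oproj_works(1)[OF K, of "i d0"]
        by (intro csubspaceD[OF cl]) auto
      then show ?thesis unfolding r'_def by (rule csubspaceD[OF cl])
    qed
    ultimately show ?thesis by blast
  qed
qed

section \<open>Bounded operators\<close>

lemma BH_apply_scaleC: "T \<in> BH \<Longrightarrow> T \<cdot> (c *\<^sub>C x) = c *\<^sub>C (T \<cdot> x)"
  by (simp add: BH_def)

lemma op_scaleC_apply [simp]: "op_scaleC c T \<cdot> x = c *\<^sub>C (T \<cdot> x)"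
  unfolding op_scaleC_def
  by (subst bounded_linear_Blinfun_apply)
     (auto intro!: bounded_linear_compose[OF bounded_linear_scaleC] blinfun.bounded_linear_right)

lemma BH_add: "a \<in> BH \<Longrightarrow> b \<in> BH \<Longrightarrow> a + b \<in> BH"
  by (simp add: BH_def blinfun.add_left scaleC_add_right)

lemma BH_diff: "a \<in> BH \<Longrightarrow> b \<in> BH \<Longrightarrow> a - b \<in> BH"
  by (simp add: BH_def blinfun.diff_left scaleC_diff_right)

lemma BH_compose: "a \<in> BH \<Longrightarrow> b \<in> BH \<Longrightarrow> a o\<^sub>L b \<in> BH"
  by (simp add: BH_def)

lemma BH_scaleC: "a \<in> BH \<Longrightarrow> op_scaleC c a \<in> BH"
  by (simp add: BH_def scaleC_scaleC mult.commute)

lemma BH_id: "id_blinfun \<in> BH"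
  by (simp add: BH_def)

lemma op_scaleC_minus1 [simp]: "op_scaleC (-1) a = - a"
  by (rule blinfun_eqI) (simp add: blinfun.minus_left)

lemma op_scaleC_zero [simp]: "op_scaleC 0 a = 0"
  by (rule blinfun_eqI) simp

lemma norm_le_if_sq_le: "0 \<le> y \<Longrightarrow> norm x * norm x \<le> y * norm x \<Longrightarrow> norm x \<le> y"
  by (metis mult_right_le_imp_le norm_ge_zero order_le_less)

lemma op_adjoint_eqI:
  assumes "\<And>x y. cinner (S \<cdot> x) y = cinner x (T \<cdot> y)"
  shows "op_adjoint T = S"
  unfolding op_adjoint_def
proof (rule the_equality)
  fix R assume R: "\<forall>x y. cinner (R \<cdot> x) y = cinner x (T \<cdot> y)"
  show "R = S"
    by (rule blinfun_eqI, rule cinner_ext) (simp add: R assms)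
qed (use assms in blast)

text \<open>For each \<open>x\<close>, Riesz represents the functional sending \<open>y\<close> to
  the inner product of \<open>T \<cdot> y\<close> with \<open>x\<close>. Uniqueness makes the
  representing vector \<open>s x\<close> linear in \<open>x\<close>, and testing \<open>s x\<close>
  against itself bounds its norm.\<close>

lemma op_adjoint_exists:
  assumes "T \<in> BH"
  obtains S where "S \<in> BH" "\<And>x y. cinner (S \<cdot> x) y = cinner x (T \<cdot> y)" "norm S \<le> norm T"
proof -
  have "\<exists>r. \<forall>y. cinner (T \<cdot> y) x = cinner y r" for x
  proof -
    have "\<exists>r\<in>closure (id ` UNIV). \<forall>y\<in>UNIV. cinner (T \<cdot> y) x = cinner (id y) r"
    proof (rule Riesz_representation[where sc = scaleC and C = "norm T * norm x"])
      fix y show "cmod (cinner (T \<cdot> y) x) \<le> norm T * norm x * norm (id y)"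
        using order_trans[OF cmod_cinner_le[of "T \<cdot> y" x] mult_right_mono[OF norm_blinfun[of T y], of "norm x"]]
        by (simp add: ac_simps)
    qed (auto simp: blinfun.add_right BH_apply_scaleC[OF assms] cinner_add_left cinner_scaleC_left)
    then show ?thesis by auto
  qed
  then obtain s where s: "\<And>x y. cinner (T \<cdot> y) x = cinner y (s x)" by metis
  have s': "cinner (s x) y = cinner x (T \<cdot> y)" for x y
    by (metis s cinner_commute)
  have scale: "s (c *\<^sub>C x) = c *\<^sub>C s x" for c x
    by (rule cinner_ext) (simp add: s' cinner_scaleC_left)
  have "norm (s x) \<le> norm T * norm x" for x
  proof (rule norm_le_if_sq_le)
    have "norm (s x) * norm (s x) = cmod (cinner (s x) (s x))"
      by (simp add: cinner_same power2_eq_square norm_mult)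
    also have "\<dots> = cmod (cinner x (T \<cdot> s x))" by (simp add: s')
    also have "\<dots> \<le> norm x * (norm T * norm (s x))"
      by (rule order_trans[OF cmod_cinner_le]) (intro mult_left_mono norm_blinfun norm_ge_zero)
    finally show "norm (s x) * norm (s x) \<le> norm T * norm x * norm (s x)" by (simp add: ac_simps)
  qed simp
  note bound = this
  have bl: "bounded_linear s"
  proof (rule bounded_linear_intro[where K = "norm T"])
    show "s (x + y) = s x + s y" for x y
      by (rule cinner_ext) (simp add: s' cinner_add_left)
    show "s (r *\<^sub>R x) = r *\<^sub>R s x" for r x by (simp add: scaleR_eq_scaleC scale)
    show "norm (s x) \<le> norm x * norm T" for x using bound[of x] by (simp add: mult.commute)
  qed
  show ?thesis
  proof (rule that[of "Blinfun s"])
    show "Blinfun s \<in> BH" by (simp add: BH_def bounded_linear_Blinfun_apply[OF bl] scale)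
    show "cinner (Blinfun s \<cdot> x) y = cinner x (T \<cdot> y)" for x y
      by (simp add: bounded_linear_Blinfun_apply[OF bl] s')
    show "norm (Blinfun s) \<le> norm T"
      by (rule norm_blinfun_bound) (auto simp: bounded_linear_Blinfun_apply[OF bl] bound)
  qed
qed

lemma op_adjoint_works:
  assumes "T \<in> BH"
  shows op_adjoint_BH: "op_adjoint T \<in> BH"
    and cinner_op_adjoint_left: "cinner (op_adjoint T \<cdot> x) y = cinner x (T \<cdot> y)"
    and norm_op_adjoint_le: "norm (op_adjoint T) \<le> norm T"
  using op_adjoint_exists[OF assms] op_adjoint_eqI by metis+

lemma cinner_op_adjoint_right:
  "T \<in> BH \<Longrightarrow> cinner x (op_adjoint T \<cdot> y) = cinner (T \<cdot> x) y"
  by (metis cinner_op_adjoint_left cinner_commute)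

lemma op_adjoint_adjoint [simp]: "T \<in> BH \<Longrightarrow> op_adjoint (op_adjoint T) = T"
  by (rule op_adjoint_eqI) (simp add: cinner_op_adjoint_right)

lemma op_adjoint_compose:
  "a \<in> BH \<Longrightarrow> b \<in> BH \<Longrightarrow> op_adjoint (a o\<^sub>L b) = op_adjoint b o\<^sub>L op_adjoint a"
  by (rule op_adjoint_eqI) (simp add: cinner_op_adjoint_left)

lemma op_adjoint_add: "a \<in> BH \<Longrightarrow> b \<in> BH \<Longrightarrow> op_adjoint (a + b) = op_adjoint a + op_adjoint b"
  by (rule op_adjoint_eqI) (simp add: cinner_op_adjoint_left blinfun.add_left cinner_add_left cinner_add_right)

lemma op_adjoint_scaleC: "a \<in> BH \<Longrightarrow> op_adjoint (op_scaleC c a) = op_scaleC (cnj c) (op_adjoint a)"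
  by (rule op_adjoint_eqI) (simp add: cinner_op_adjoint_left cinner_scaleC_left cinner_scaleC_right)

lemma op_adjoint_id [simp]: "op_adjoint id_blinfun = id_blinfun"
  by (rule op_adjoint_eqI) simp

lemma op_adjoint_zero [simp]: "op_adjoint 0 = 0"
  by (rule op_adjoint_eqI) simp

section \<open>Von Neumann algebras\<close>

definition star_algebra :: "'h::complex_hilbert operator set \<Rightarrow> bool" where
  "star_algebra A \<longleftrightarrow> A \<subseteq> BH \<and> id_blinfun \<in> A \<and> (\<forall>a\<in>A. \<forall>b\<in>A. a + b \<in> A) \<and>
     (\<forall>a\<in>A. \<forall>b\<in>A. a o\<^sub>L b \<in> A) \<and> (\<forall>c. \<forall>a\<in>A. op_scaleC c a \<in> A) \<and> (\<forall>a\<in>A. op_adjoint a \<in> A)"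

lemma star_algebraD:
  assumes "star_algebra A"
  shows "a \<in> A \<Longrightarrow> a \<in> BH" "id_blinfun \<in> A" "a \<in> A \<Longrightarrow> b \<in> A \<Longrightarrow> a + b \<in> A"
    "a \<in> A \<Longrightarrow> b \<in> A \<Longrightarrow> a o\<^sub>L b \<in> A" "a \<in> A \<Longrightarrow> op_scaleC c a \<in> A" "a \<in> A \<Longrightarrow> op_adjoint a \<in> A"
    "a \<in> A \<Longrightarrow> - a \<in> A" "a \<in> A \<Longrightarrow> b \<in> A \<Longrightarrow> a - b \<in> A" "0 \<in> A"
proof -
  show m: "- a \<in> A" if "a \<in> A" for a
    using that assms unfolding star_algebra_def by (metis op_scaleC_minus1)
  show "a - b \<in> A" if "a \<in> A" "b \<in> A"
    using that m assms unfolding star_algebra_def by (metis diff_conv_add_uminus)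
  show "0 \<in> A" using assms unfolding star_algebra_def by (metis op_scaleC_zero)
qed (use assms in \<open>auto simp: star_algebra_def\<close>)

lemma star_algebra_sum:
  "star_algebra A \<Longrightarrow> (\<And>i. i \<in> I \<Longrightarrow> f i \<in> A) \<Longrightarrow> (\<Sum>i\<in>I. f i) \<in> A"
  by (induction I rule: infinite_finite_induct) (auto simp: star_algebraD)

lemma commutantD: "T \<in> commutant S \<Longrightarrow> T \<in> BH" "T \<in> commutant S \<Longrightarrow> a \<in> S \<Longrightarrow> T \<cdot> (a \<cdot> x) = a \<cdot> (T \<cdot> x)"
  by (auto simp: commutant_def) (metis blinfun_apply_blinfun_compose)

lemma commutantI: "T \<in> BH \<Longrightarrow> (\<And>a x. a \<in> S \<Longrightarrow> T \<cdot> (a \<cdot> x) = a \<cdot> (T \<cdot> x)) \<Longrightarrow> T \<in> commutant S"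
  by (auto simp: commutant_def intro!: blinfun_eqI)

lemma commutant_antimono: "S \<subseteq> R \<Longrightarrow> commutant R \<subseteq> commutant S"
  by (auto simp: commutant_def)

lemma commutant_commutant_supset: "S \<subseteq> BH \<Longrightarrow> S \<subseteq> commutant (commutant S)"
  by (auto simp: commutant_def)

lemma commutant_triple: "S \<subseteq> BH \<Longrightarrow> commutant (commutant (commutant S)) = commutant S"
  by (metis commutant_antimono commutant_commutant_supset commutantD(1) subsetI subset_antisym)

lemma op_adjoint_commutant:
  assumes "S \<subseteq> BH" "\<And>a. a \<in> S \<Longrightarrow> op_adjoint a \<in> S" "T \<in> commutant S"
  shows "op_adjoint T \<in> commutant S"
  unfolding commutant_def
proof (intro CollectI conjI ballI)
  have T: "T \<in> BH" using assms(3) by (rule commutantD)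
  show "op_adjoint T \<in> BH" by (rule op_adjoint_BH[OF T])
  fix a assume a: "a \<in> S"
  then have aB: "a \<in> BH" using assms(1) by auto
  have "T o\<^sub>L op_adjoint a = op_adjoint a o\<^sub>L T" using assms a by (auto simp: commutant_def)
  then have "op_adjoint (T o\<^sub>L op_adjoint a) = op_adjoint (op_adjoint a o\<^sub>L T)" by simp
  then show "op_adjoint T o\<^sub>L a = a o\<^sub>L op_adjoint T"
    by (simp add: op_adjoint_compose T aB op_adjoint_BH)
qed

lemma star_algebra_commutant:
  assumes "S \<subseteq> BH" "\<And>a. a \<in> S \<Longrightarrow> op_adjoint a \<in> S"
  shows "star_algebra (commutant S)"
  unfolding star_algebra_def
proof (intro conjI ballI allI)
  show "commutant S \<subseteq> BH" by (auto simp: commutant_def)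
  show "id_blinfun \<in> commutant S" by (rule commutantI) (auto simp: BH_id)
  fix a assume a: "a \<in> commutant S"
  have aB: "a \<in> BH" by (rule commutantD[OF a])
  show "op_adjoint a \<in> commutant S" using a assms by (intro op_adjoint_commutant) auto
  show "op_scaleC c a \<in> commutant S" for c
    using assms(1) by (intro commutantI) (auto simp: BH_scaleC aB commutantD(2)[OF a] BH_apply_scaleC)
  fix b assume b: "b \<in> commutant S"
  have bB: "b \<in> BH" by (rule commutantD[OF b])
  show "a + b \<in> commutant S"
    by (intro commutantI) (auto simp: BH_add aB bB commutantD(2)[OF a] commutantD(2)[OF b] blinfun.add_left blinfun.add_right)
  show "a o\<^sub>L b \<in> commutant S"
    by (intro commutantI) (auto simp: BH_compose aB bB commutantD(2)[OF a] commutantD(2)[OF b])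
qed

lemma von_neumann_algebra_bicommutant:
  assumes "S \<subseteq> BH" "\<And>a. a \<in> S \<Longrightarrow> op_adjoint a \<in> S"
  shows "von_neumann_algebra (commutant (commutant S))"
proof -
  have "star_algebra (commutant (commutant S))"
    using star_algebra_commutant[OF assms] by (intro star_algebra_commutant) (auto simp: star_algebra_def)
  then show ?thesis
    unfolding von_neumann_algebra_def star_algebra_def
    by (simp add: commutant_triple[OF assms(1)])
qed

lemma von_neumann_algebra_star_algebra:
  assumes "von_neumann_algebra M"
  shows "star_algebra M" "star_algebra (commutant M)" "commutant (commutant M) = M"
proof -
  show M: "commutant (commutant M) = M" using assms by (simp add: von_neumann_algebra_def)
  show M': "star_algebra (commutant M)"
    using assms by (intro star_algebra_commutant) (auto simp: von_neumann_algebra_def)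
  have "star_algebra (commutant (commutant M))"
    using M' by (intro star_algebra_commutant) (auto simp: star_algebra_def)
  then show "star_algebra M" using M by simp
qed

lemma vN_generated_least: "von_neumann_algebra M \<Longrightarrow> S \<subseteq> M \<Longrightarrow> vN_generated S \<subseteq> M"
  by (auto simp: vN_generated_def)

lemma vN_generated_supset: "S \<subseteq> vN_generated S"
  by (auto simp: vN_generated_def)

lemma von_neumann_algebra_vN_generated:
  assumes "von_neumann_algebra M" "S \<subseteq> M"
  shows "von_neumann_algebra (vN_generated S)"
  unfolding von_neumann_algebra_def
proof (intro conjI ballI equalityI)
  have sub: "vN_generated S \<subseteq> M" by (rule vN_generated_least[OF assms])
  then show BH: "vN_generated S \<subseteq> BH" using assms by (auto simp: von_neumann_algebra_def)
  show "op_adjoint a \<in> vN_generated S" if "a \<in> vN_generated S" for a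
    using that by (auto simp: vN_generated_def von_neumann_algebra_def)
  show "vN_generated S \<subseteq> commutant (commutant (vN_generated S))"
    using BH by (rule commutant_commutant_supset)
  show "commutant (commutant (vN_generated S)) \<subseteq> vN_generated S"
  proof
    fix x assume x: "x \<in> commutant (commutant (vN_generated S))"
    have "x \<in> R" if R: "von_neumann_algebra R" "S \<subseteq> R" for R
    proof -
      have "commutant (commutant (vN_generated S)) \<subseteq> commutant (commutant R)"
        by (intro commutant_antimono vN_generated_least R)
      then show ?thesis using x R by (auto simp: von_neumann_algebra_def)
    qed
    then show "x \<in> vN_generated S" by (auto simp: vN_generated_def)
  qed
qed

text \<open>A self-adjoint family leaving \<open>W\<close> invariant also leaves its orthogonal
  complement invariant, so applying \<open>a\<close> to the decomposition of \<open>x\<close> gives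
  the decomposition of \<open>a \<cdot> x\<close>.\<close>

lemma oproj_commutant:
  assumes W: "csubspace W" "closed W"
    and S: "S \<subseteq> BH" "\<And>a. a \<in> S \<Longrightarrow> op_adjoint a \<in> S"
    and inv: "\<And>a w. a \<in> S \<Longrightarrow> w \<in> W \<Longrightarrow> a \<cdot> w \<in> W"
  shows "oproj W \<in> commutant S"
proof (rule commutantI)
  fix a x assume a: "a \<in> S"
  show "oproj W \<cdot> (a \<cdot> x) = a \<cdot> (oproj W \<cdot> x)"
  proof (rule oproj_eqI[OF W])
    show "a \<cdot> (oproj W \<cdot> x) \<in> W" by (intro inv a oproj_works[OF W])
    fix w assume w: "w \<in> W"
    have "cinner w (a \<cdot> x - a \<cdot> (oproj W \<cdot> x)) = cinner (op_adjoint a \<cdot> w) (x - oproj W \<cdot> x)"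
      using S(1) a by (simp add: cinner_op_adjoint_left blinfun.diff_right subset_iff)
    also have "\<dots> = 0" by (intro oproj_works[OF W] inv S a w)
    finally show "cinner w (a \<cdot> x - a \<cdot> (oproj W \<cdot> x)) = 0" .
  qed
qed (rule oproj_BH[OF W])

lemma csubspace_orbit:
  assumes "star_algebra A" shows "csubspace ((\<lambda>a. a \<cdot> v) ` A)"
  unfolding csubspace_def
proof (intro conjI ballI allI)
  show "0 \<in> (\<lambda>a. a \<cdot> v) ` A"
    using star_algebraD(9)[OF assms] by (intro image_eqI[where x = 0]) auto
  fix x assume "x \<in> (\<lambda>a. a \<cdot> v) ` A"
  then obtain a where a: "a \<in> A" "x = a \<cdot> v" by auto
  { fix y assume "y \<in> (\<lambda>a. a \<cdot> v) ` A"
    then obtain b where b: "b \<in> A" "y = b \<cdot> v" by auto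
    show "x + y \<in> (\<lambda>a. a \<cdot> v) ` A"
      using a b star_algebraD(3)[OF assms] by (intro image_eqI[where x = "a + b"]) (auto simp: blinfun.add_left) }
  show "c *\<^sub>C x \<in> (\<lambda>a. a \<cdot> v) ` A" for c
    using a star_algebraD(5)[OF assms] by (intro image_eqI[where x = "op_scaleC c a"]) auto
qed

lemma blinfun_closure_image:
  assumes "\<And>w. w \<in> W \<Longrightarrow> T \<cdot> w \<in> V" "w \<in> closure W"
  shows "T \<cdot> w \<in> closure V"
proof -
  obtain f where f: "\<And>n. f n \<in> W" "f \<longlonglongrightarrow> w" using assms(2) closure_sequential by metis
  have "(\<lambda>n. T \<cdot> f n) \<longlonglongrightarrow> T \<cdot> w"
    by (rule bounded_linear.tendsto[OF blinfun.bounded_linear_right f(2)])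
  then show ?thesis by (rule closure_sequentialI[rotated]) (intro assms(1) f(1))
qed

lemma closure_orbit_invariant:
  assumes "star_algebra A" "a \<in> A" "w \<in> closure ((\<lambda>a. a \<cdot> v) ` A)"
  shows "a \<cdot> w \<in> closure ((\<lambda>a. a \<cdot> v) ` A)"
  by (rule blinfun_closure_image[OF _ assms(3)])
     (use star_algebraD(4)[OF assms(1)] assms(2) in \<open>auto intro!: image_eqI[where x = "a o\<^sub>L _"]\<close>)

text \<open>The projection onto the closed orbit lies in the commutant, hence commutes with
  \<open>x\<close>; it fixes \<open>v\<close>, so it fixes \<open>x \<cdot> v\<close> too.\<close>

lemma bicommutant_orbit:
  assumes A: "star_algebra A" and x: "x \<in> commutant (commutant A)"
  shows "x \<cdot> v \<in> closure ((\<lambda>a. a \<cdot> v) ` A)"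
proof -
  let ?W = "closure ((\<lambda>a. a \<cdot> v) ` A)"
  have W: "csubspace ?W" "closed ?W" by (auto intro!: csubspace_closure csubspace_orbit A)
  have "oproj ?W \<in> commutant A"
    by (rule oproj_commutant[OF W]) (use A in \<open>auto simp: star_algebraD closure_orbit_invariant\<close>)
  then have "x \<cdot> (oproj ?W \<cdot> v) = oproj ?W \<cdot> (x \<cdot> v)" using x by (rule commutantD(2)[rotated])
  moreover have "v \<in> ?W"
    by (rule subsetD[OF closure_subset], rule image_eqI[where x = id_blinfun]) (auto simp: star_algebraD(2)[OF A])
  ultimately show ?thesis using oproj_ident[OF W] oproj_works(1)[OF W] by metis
qed

section \<open>Operators on square-summable families\<close>

lemma ell2_eqI: "(\<And>g. ell2_nth x g = ell2_nth y g) \<Longrightarrow> x = y"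
  by (simp add: ell2_nth_inject[symmetric] fun_eq_iff)

lemmas ell2_nth_simps [simp] =
  zero_ell2.rep_eq plus_ell2.rep_eq minus_ell2.rep_eq uminus_ell2.rep_eq scaleR_ell2.rep_eq scaleC_ell2.rep_eq

lemma ell2_nth_sum: "ell2_nth (\<Sum>i\<in>A. f i) g = (\<Sum>i\<in>A. ell2_nth (f i) g)"
  by (induction A rule: infinite_finite_induct) auto

lemma norm_ell2_mono:
  assumes "\<And>g. norm (ell2_nth x g) \<le> C * norm (ell2_nth y g)" "C \<ge> 0"
  shows "norm x \<le> C * norm y"
proof -
  have "(norm x)\<^sup>2 \<le> (\<Sum>\<^sub>\<infinity>g. C\<^sup>2 * (norm (ell2_nth y g))\<^sup>2)"
    unfolding norm_ell2_sq
  proof (rule infsum_mono)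
    fix g
    have "(norm (ell2_nth x g))\<^sup>2 \<le> (C * norm (ell2_nth y g))\<^sup>2"
      by (intro power_mono assms) auto
    then show "(norm (ell2_nth x g))\<^sup>2 \<le> C\<^sup>2 * (norm (ell2_nth y g))\<^sup>2"
      by (simp add: power_mult_distrib)
  qed (auto intro!: summable_ell2 summable_on_cmult_right)
  also have "\<dots> = (C * norm y)\<^sup>2"
    by (simp add: infsum_cmult_right' norm_ell2_sq power_mult_distrib)
  finally show ?thesis by (rule power2_le_imp_le) (use assms(2) in auto)
qed

lemma bounded_linear_ell2_nth: "bounded_linear (\<lambda>x. ell2_nth x g)"
  by (rule bounded_linear_intro[where K = 1]) (auto simp: norm_ell2_nth_le)

definition ell2_single :: "'g \<Rightarrow> 'h::complex_hilbert \<Rightarrow> ('g, 'h) ell2" where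
  "ell2_single g v = Abs_ell2 (\<lambda>h. if h = g then v else 0)"

lemma ell2_nth_single: "ell2_nth (ell2_single g v) h = (if h = g then v else 0)"
  unfolding ell2_single_def
  by (subst Abs_ell2_inverse)
     (auto intro!: finite_nonzero_values_imp_summable_on finite_subset[of _ "{g}"] split: if_splits)

lemma cinner_single_left: "cinner (ell2_single g v) x = cinner v (ell2_nth x g)"
  unfolding cinner_ell2_def
  by (rule infsumI, rule has_sum_finite_neutralI[where B = "{g}"]) (auto simp: ell2_nth_single)

lemma norm_ell2_single [simp]: "norm (ell2_single g v) = norm v"
proof -
  have "(norm (ell2_single g v))\<^sup>2 = (norm v)\<^sup>2"
    by (simp add: norm_sq_cinner cinner_single_left ell2_nth_single)
  then show ?thesis by (simp add: power2_eq_iff_nonneg)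
qed

lemma ell2_single_scaleC: "ell2_single g (c *\<^sub>C v) = c *\<^sub>C ell2_single g v"
  by (rule ell2_eqI) (simp add: ell2_nth_single)

lemma ell2_single_add: "ell2_single g (v + w) = ell2_single g v + ell2_single g w"
  by (rule ell2_eqI) (simp add: ell2_nth_single)

lemma bounded_linear_ell2_single: "bounded_linear (ell2_single g)"
  by (rule bounded_linear_intro[where K = 1])
     (auto simp: ell2_single_add scaleR_eq_scaleC ell2_single_scaleC)

subsection \<open>Diagonal operators and amplifications\<close>

definition diag_op :: "('g \<Rightarrow> 'h::complex_hilbert operator) \<Rightarrow> ('g, 'h) ell2 operator" where
  "diag_op A = Blinfun (\<lambda>\<xi>. Abs_ell2 (\<lambda>h. A h \<cdot> ell2_nth \<xi> h))"

context
  fixes A :: "'g \<Rightarrow> 'h::complex_hilbert operator" and C :: real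
  assumes bound: "\<And>h. norm (A h) \<le> C"
begin

lemma diag_op_nth: "ell2_nth (diag_op A \<cdot> \<xi>) h = A h \<cdot> ell2_nth \<xi> h"
  and norm_diag_op: "norm (diag_op A \<cdot> \<xi>) \<le> C * norm \<xi>"
proof -
  have C: "C \<ge> 0" using bound norm_ge_zero order_trans by blast
  have le: "norm (A h \<cdot> v) \<le> C * norm v" for h v
    by (rule order_trans[OF norm_blinfun]) (intro mult_right_mono bound norm_ge_zero)
  define f where "f \<xi> = Abs_ell2 (\<lambda>h. A h \<cdot> ell2_nth \<xi> h)" for \<xi>
  have nth: "ell2_nth (f \<xi>) h = A h \<cdot> ell2_nth \<xi> h" for \<xi> h
  proof -
    have "(\<lambda>h. (norm (A h \<cdot> ell2_nth \<xi> h))\<^sup>2) summable_on UNIV"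
    proof (rule ell2_comparison[OF summable_on_cmult_right[OF summable_ell2[of \<xi>], of "C\<^sup>2"]])
      show "(norm (A i \<cdot> ell2_nth \<xi> i))\<^sup>2 \<le> C\<^sup>2 * (norm (ell2_nth \<xi> i))\<^sup>2" for i
        using power_mono[OF le[of i "ell2_nth \<xi> i"], of 2] by (simp add: power_mult_distrib)
    qed
    then show ?thesis unfolding f_def by (subst Abs_ell2_inverse) auto
  qed
  have norm_f: "norm (f \<xi>) \<le> C * norm \<xi>" for \<xi>
    by (rule norm_ell2_mono) (auto simp: nth le C)
  have "bounded_linear f"
    by (rule bounded_linear_intro[where K = C])
       (auto intro!: ell2_eqI simp: nth blinfun.add_right blinfun.scaleR_right norm_f mult.commute[of _ C])
  then have "diag_op A \<cdot> \<xi> = f \<xi>" for \<xi>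
    unfolding diag_op_def f_def by (simp add: bounded_linear_Blinfun_apply)
  then show "ell2_nth (diag_op A \<cdot> \<xi>) h = A h \<cdot> ell2_nth \<xi> h" "norm (diag_op A \<cdot> \<xi>) \<le> C * norm \<xi>"
    by (simp_all add: nth norm_f)
qed

lemma diag_op_BH: "(\<And>h. A h \<in> BH) \<Longrightarrow> diag_op A \<in> BH"
  by (subst BH_def) (auto simp: BH_apply_scaleC diag_op_nth intro!: ell2_eqI)

end

lemma op_adjoint_diag_op:
  assumes bound: "\<And>h. norm (A h) \<le> C" and BH: "\<And>h. A h \<in> BH"
  shows "op_adjoint (diag_op A) = diag_op (\<lambda>h. op_adjoint (A h))"
proof (rule op_adjoint_eqI)
  have bound': "norm (op_adjoint (A h)) \<le> C" for h
    using norm_op_adjoint_le[OF BH] bound order_trans by blast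
  show "cinner (diag_op (\<lambda>h. op_adjoint (A h)) \<cdot> x) y = cinner x (diag_op A \<cdot> y)" for x y
    unfolding cinner_ell2_def
    by (simp add: diag_op_nth[of "\<lambda>h. op_adjoint (A h)", OF bound'] diag_op_nth[of A, OF bound]
        cinner_op_adjoint_left BH)
qed

section \<open>Cut-offs to subsets of the index set\<close>

definition ell2_restrict :: "'g set \<Rightarrow> ('g, 'h::complex_hilbert) ell2 operator" where
  "ell2_restrict S = diag_op (\<lambda>h. if h \<in> S then id_blinfun else 0)"

lemma ell2_restrict_bound: "norm (if h \<in> S then id_blinfun else (0 :: 'h::complex_hilbert operator)) \<le> 1"
  by (simp add: norm_blinfun_id_le)

lemma ell2_restrict_nth: "ell2_nth (ell2_restrict S \<cdot> x) h = (if h \<in> S then ell2_nth x h else 0)"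
  unfolding ell2_restrict_def by (subst diag_op_nth[OF ell2_restrict_bound]) simp

lemma ell2_restrict_BH: "ell2_restrict S \<in> BH"
  unfolding ell2_restrict_def by (rule diag_op_BH[where C = 1]) (auto simp: ell2_restrict_bound BH_id BH_def)

lemma op_adjoint_ell2_restrict: "op_adjoint (ell2_restrict S) = ell2_restrict S"
  unfolding ell2_restrict_def
  by (subst op_adjoint_diag_op[where C = 1])
     (auto simp: ell2_restrict_bound BH_id BH_def if_distrib[of op_adjoint] cong: if_cong)

lemma norm_ell2_restrict_le: "norm (ell2_restrict S \<cdot> x) \<le> norm x"
  unfolding ell2_restrict_def using norm_diag_op[OF ell2_restrict_bound] by simp

lemma ell2_restrict_finite:
  "finite S \<Longrightarrow> ell2_restrict S \<cdot> x = (\<Sum>h\<in>S. ell2_single h (ell2_nth x h))"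
  by (rule ell2_eqI) (simp add: ell2_restrict_nth ell2_nth_sum ell2_nth_single)

lemma norm_ell2_restrict_antimono:
  "S \<subseteq> R \<Longrightarrow> norm (x - ell2_restrict R \<cdot> x) \<le> norm (x - ell2_restrict S \<cdot> x)"
  by (rule norm_ell2_mono[where C = 1, simplified]) (auto simp: ell2_restrict_nth)

lemma ell2_restrict_approx:
  assumes "\<epsilon> > 0"
  obtains S where "finite S" "norm (x - ell2_restrict S \<cdot> x) < \<epsilon>"
proof -
  have "((\<lambda>g. (norm (ell2_nth x g))\<^sup>2) has_sum (norm x)\<^sup>2) UNIV"
    unfolding norm_ell2_sq by (rule has_sum_infsum[OF summable_ell2])
  then have "\<forall>\<^sub>F F in finite_subsets_at_top UNIV. (\<Sum>g\<in>F. (norm (ell2_nth x g))\<^sup>2) > (norm x)\<^sup>2 - \<epsilon>\<^sup>2"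
    unfolding has_sum_def by (rule order_tendstoD) (use assms in auto)
  then obtain S where S: "finite S" "(\<Sum>g\<in>S. (norm (ell2_nth x g))\<^sup>2) > (norm x)\<^sup>2 - \<epsilon>\<^sup>2"
    unfolding eventually_finite_subsets_at_top by auto
  let ?r = "ell2_restrict S \<cdot> x"
  have "cinner ?r (x - ?r) = (\<Sum>h\<in>S. cinner (ell2_nth x h) (ell2_nth (x - ?r) h))"
    by (subst ell2_restrict_finite[OF S(1)]) (simp only: cinner_sum_left cinner_single_left)
  also have "\<dots> = 0" by (simp add: ell2_restrict_nth)
  finally have "(norm x)\<^sup>2 = (norm ?r)\<^sup>2 + (norm (x - ?r))\<^sup>2" using norm_Pythagoras[of ?r "x - ?r"] by simp
  moreover have "(\<Sum>g\<in>S. (norm (ell2_nth x g))\<^sup>2) \<le> (norm ?r)\<^sup>2"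
    using sum_le_norm_ell2_sq[OF S(1), of ?r] by (simp add: ell2_restrict_nth)
  ultimately have "(norm (x - ?r))\<^sup>2 < \<epsilon>\<^sup>2" using S(2) by linarith
  then have "norm (x - ?r) < \<epsilon>" by (rule power_less_imp_less_base) (use assms in auto)
  then show ?thesis using that S(1) by blast
qed

text \<open>The difference is continuous and vanishes on the finitely supported vectors, which are
  dense.\<close>

lemma blinfun_ell2_eqI:
  fixes T1 T2 :: "('g, 'h::complex_hilbert) ell2 \<Rightarrow>\<^sub>L 'k::real_normed_vector"
  assumes "\<And>g v. T1 \<cdot> ell2_single g v = T2 \<cdot> ell2_single g v"
  shows "T1 = T2"
proof (rule blinfun_eqI)
  fix x
  let ?T = "T1 - T2"
  have "norm (?T \<cdot> x) \<le> e" if "e > 0" for e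
  proof -
    have "e / (norm ?T + 1) > 0" using that by (simp add: add_nonneg_pos)
    then obtain S where S: "finite S" "norm (x - ell2_restrict S \<cdot> x) < e / (norm ?T + 1)"
      using ell2_restrict_approx by metis
    have "?T \<cdot> (ell2_restrict S \<cdot> x) = 0"
      by (simp add: ell2_restrict_finite[OF S(1)] blinfun.sum_right blinfun.diff_left assms)
    then have "norm (?T \<cdot> x) = norm (?T \<cdot> (x - ell2_restrict S \<cdot> x))" by (simp add: blinfun.diff_right)
    also have "\<dots> \<le> norm ?T * norm (x - ell2_restrict S \<cdot> x)" by (rule norm_blinfun)
    also have "\<dots> \<le> (norm ?T + 1) * (e / (norm ?T + 1))"
      by (rule mult_mono) (use S(2) in auto)
    also have "\<dots> = e" using norm_ge_zero[of ?T] by (simp add: add_nonneg_eq_0_iff)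
    finally show ?thesis .
  qed
  then have "norm (?T \<cdot> x) \<le> 0" by (rule field_le_epsilon[of _ 0, simplified])
  then show "T1 \<cdot> x = T2 \<cdot> x" by (simp add: blinfun.diff_left)
qed

text \<open>\<open>a\<close> tensor the identity. One vector of the direct sum encodes a
  square-summable family, so a normal functional becomes a single matrix coefficient.\<close>

definition amp :: "'h::complex_hilbert operator \<Rightarrow> ('j, 'h) ell2 operator" where
  "amp a = diag_op (\<lambda>_. a)"

lemma amp_nth [simp]: "ell2_nth (amp a \<cdot> x) j = a \<cdot> ell2_nth x j"
  unfolding amp_def by (rule diag_op_nth[OF order_refl])

lemma norm_amp_apply_le: "norm (amp a \<cdot> x) \<le> norm a * norm x"
  unfolding amp_def by (rule norm_diag_op[OF order_refl])

lemma amp_single: "amp a \<cdot> ell2_single j v = ell2_single j (a \<cdot> v)"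
  by (rule ell2_eqI) (simp add: ell2_nth_single)

lemma amp_add: "amp (a + b) = amp a + amp b"
  by (rule blinfun_eqI, rule ell2_eqI) (simp add: blinfun.add_left)

lemma amp_diff: "amp (a - b) = amp a - amp b"
  by (rule blinfun_eqI, rule ell2_eqI) (simp add: blinfun.diff_left)

lemma amp_zero [simp]: "amp 0 = 0"
  by (rule blinfun_eqI, rule ell2_eqI) simp

lemma amp_id [simp]: "amp id_blinfun = id_blinfun"
  by (rule blinfun_eqI, rule ell2_eqI) simp

lemma amp_compose: "amp (a o\<^sub>L b) = amp a o\<^sub>L amp b"
  by (rule blinfun_eqI, rule ell2_eqI) simp

lemma amp_scaleC: "amp (op_scaleC c a) = op_scaleC c (amp a)"
  by (rule blinfun_eqI, rule ell2_eqI) simp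

lemma amp_sum: "amp (\<Sum>i\<in>I. f i) = (\<Sum>i\<in>I. amp (f i))"
  by (induction I rule: infinite_finite_induct) (auto simp: amp_add)

lemma amp_BH: "a \<in> BH \<Longrightarrow> amp a \<in> BH"
  unfolding amp_def by (rule diag_op_BH[OF order_refl])

lemma op_adjoint_amp: "a \<in> BH \<Longrightarrow> op_adjoint (amp a) = amp (op_adjoint a)"
  unfolding amp_def by (rule op_adjoint_diag_op[OF order_refl])

lemma star_algebra_amp:
  assumes "star_algebra A" shows "star_algebra (amp ` A)"
  unfolding star_algebra_def
  using star_algebraD[OF assms]
  by (auto intro!: amp_BH simp: op_adjoint_amp simp flip: amp_add amp_compose amp_scaleC)
     (metis amp_id image_eqI)

text \<open>Every matrix entry \<open>t\<close> of an operator commuting with the amplified algebra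
  commutes with \<open>A\<close>, hence with \<open>x\<close>; comparing on vectors with one nonzero
  coordinate suffices.\<close>

lemma amp_bicommutant:
  fixes x :: "'h::complex_hilbert operator"
  assumes A: "A \<subseteq> BH" and x: "x \<in> commutant (commutant A)"
  shows "(amp x :: ('j, 'h) ell2 operator) \<in> commutant (commutant (amp ` A))"
  unfolding commutant_def[of "commutant (amp ` A)"]
proof (intro CollectI conjI ballI)
  have xB: "x \<in> BH" using x by (rule commutantD)
  show "amp x \<in> BH" using xB by (rule amp_BH)
  fix T :: "('j, 'h) ell2 operator" assume T: "T \<in> commutant (amp ` A)"
  have TB: "T \<in> BH" using T by (rule commutantD)
  show "amp x o\<^sub>L T = T o\<^sub>L amp x"
  proof (rule blinfun_ell2_eqI, rule ell2_eqI)
    fix j v i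
    define t where "t = Blinfun (\<lambda>v. ell2_nth (T \<cdot> ell2_single j v) i)"
    have "bounded_linear (\<lambda>v. ell2_nth (T \<cdot> ell2_single j v) i)"
      by (rule bounded_linear_compose[OF bounded_linear_ell2_nth
            bounded_linear_compose[OF blinfun.bounded_linear_right bounded_linear_ell2_single]])
    then have t: "t \<cdot> v = ell2_nth (T \<cdot> ell2_single j v) i" for v
      unfolding t_def by (simp add: bounded_linear_Blinfun_apply)
    have "t \<in> commutant A"
    proof (rule commutantI)
      show "t \<in> BH" unfolding BH_def by (simp add: t ell2_single_scaleC BH_apply_scaleC[OF TB])
      fix a w assume "a \<in> A"
      then have "T \<cdot> (amp a \<cdot> ell2_single j w) = amp a \<cdot> (T \<cdot> ell2_single j w)"
        by (intro commutantD(2)[OF T]) auto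
      then show "t \<cdot> (a \<cdot> w) = a \<cdot> (t \<cdot> w)" by (simp add: t amp_single)
    qed
    then have "x \<cdot> (t \<cdot> v) = t \<cdot> (x \<cdot> v)" by (rule commutantD(2)[OF x])
    then show "ell2_nth ((amp x o\<^sub>L T) \<cdot> ell2_single j v) i = ell2_nth ((T o\<^sub>L amp x) \<cdot> ell2_single j v) i"
      by (simp add: t amp_single)
  qed
qed

text \<open>Von Neumann density for a whole square-summable family: the orbit argument, run in the
  amplified algebra.\<close>

lemma bicommutant_amp_orbit:
  assumes A: "star_algebra A" and x: "x \<in> commutant (commutant A)"
  shows "amp x \<cdot> w \<in> closure ((\<lambda>a. amp a \<cdot> w) ` A)"
proof -
  have "A \<subseteq> BH" using A by (auto simp: star_algebraD)
  then show ?thesis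
    using bicommutant_orbit[OF star_algebra_amp[OF A] amp_bicommutant[OF _ x]] by (simp add: image_image)
qed

lemma bicommutant_approx2:
  fixes u v :: "('j, 'h::complex_hilbert) ell2"
  assumes A: "star_algebra A" and x: "x \<in> commutant (commutant A)" and "\<epsilon> > 0"
  obtains a where "a \<in> A" "norm (amp (a - x) \<cdot> u) < \<epsilon>" "norm (amp (a - x) \<cdot> v) < \<epsilon>"
proof -
  have AB: "A \<subseteq> BH" using A by (auto simp: star_algebraD)
  \<comment> \<open>A second amplification, indexed by the booleans, turns approximation on two
    vectors into approximation on one.\<close>
  let ?w = "ell2_single True u + ell2_single False v"
  have "amp (amp x) \<cdot> ?w \<in> closure ((\<lambda>a. amp a \<cdot> ?w) ` amp ` A)"
    by (rule bicommutant_amp_orbit[OF star_algebra_amp[OF A] amp_bicommutant[OF AB x]])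
  then obtain a where a: "a \<in> A" "dist (amp (amp a) \<cdot> ?w) (amp (amp x) \<cdot> ?w) < \<epsilon>"
    unfolding closure_approachable using \<open>\<epsilon> > 0\<close> by auto
  have *: "norm (ell2_nth (amp (amp (a - x)) \<cdot> ?w) i) < \<epsilon>" for i
    using a(2) norm_ell2_nth_le[of "amp (amp (a - x)) \<cdot> ?w" i]
    by (simp add: dist_norm amp_diff blinfun.diff_left)
  show ?thesis using that[OF a(1)] *[of True] *[of False] by (simp add: ell2_nth_single)
qed

section \<open>Trace vectors\<close>

text \<open>The vector state of \<open>\<Omega>\<close> is a faithful trace on \<open>M\<close>, and
  \<open>trace\<close> is its trace property in polarised form. \<open>\<Omega>\<close> need not be
  cyclic: the closure of its orbit plays the part of L2(M).\<close>

locale trace_vector =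
  fixes M :: "'h::complex_hilbert operator set" and \<Omega> :: "('j, 'h) ell2"
  assumes vN: "von_neumann_algebra M"
    and separating: "x \<in> M \<Longrightarrow> amp x \<cdot> \<Omega> = 0 \<Longrightarrow> x = 0"
    and trace: "x \<in> M \<Longrightarrow> y \<in> M \<Longrightarrow>
      cinner (amp x \<cdot> \<Omega>) (amp y \<cdot> \<Omega>) = cinner (amp (op_adjoint y) \<cdot> \<Omega>) (amp (op_adjoint x) \<cdot> \<Omega>)"
begin

lemmas alg = von_neumann_algebra_star_algebra(1)[OF vN]
lemmas commutant_alg = von_neumann_algebra_star_algebra(2)[OF vN]
lemmas bicommutant = von_neumann_algebra_star_algebra(3)[OF vN]

lemma norm_adjoint: "x \<in> M \<Longrightarrow> norm (amp (op_adjoint x) \<cdot> \<Omega>) = norm (amp x \<cdot> \<Omega>)"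
  using trace[of x x] by (simp add: cinner_same power2_eq_iff_nonneg flip: of_real_power)

text \<open>Separating for \<open>M\<close> means generating for the commutant: the projection onto
  the complement of all \<open>m \<cdot> ell2_nth \<Omega> j\<close> lies in the bicommutant, that
  is in \<open>M\<close>, and annihilates \<open>\<Omega>\<close>.\<close>

lemma commutant_total:
  assumes "\<And>m j. m \<in> commutant M \<Longrightarrow> cinner (m \<cdot> ell2_nth \<Omega> j) z = 0"
  shows "z = 0"
proof -
  let ?W = "{z. \<forall>m\<in>commutant M. \<forall>j. cinner (m \<cdot> ell2_nth \<Omega> j) z = 0}"
  have W: "csubspace ?W" "closed ?W"
  proof -
    show "csubspace ?W" by (auto simp: csubspace_def cinner_add_right cinner_scaleC_right)
    have "?W = (\<Inter>m\<in>commutant M. \<Inter>j. (\<lambda>z. cinner (m \<cdot> ell2_nth \<Omega> j) z) -` {0})" by auto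
    also have "closed \<dots>"
      by (intro closed_INT ballI closed_vimage closed_singleton continuous_cinner_right)
    finally show "closed ?W" .
  qed
  have BH: "commutant M \<subseteq> BH" by (auto simp: commutantD)
  have "oproj ?W \<in> commutant (commutant M)"
  proof (rule oproj_commutant[OF W BH])
    show "op_adjoint a \<in> commutant M" if "a \<in> commutant M" for a
      using that by (rule star_algebraD(6)[OF commutant_alg])
    fix a w assume a: "a \<in> commutant M" and w: "w \<in> ?W"
    have "cinner (m \<cdot> ell2_nth \<Omega> j) (a \<cdot> w) = 0" if m: "m \<in> commutant M" for m j
    proof -
      have "op_adjoint a o\<^sub>L m \<in> commutant M"
        by (intro star_algebraD[OF commutant_alg] a m)
      then have "cinner ((op_adjoint a o\<^sub>L m) \<cdot> ell2_nth \<Omega> j) w = 0" using w by blast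
      then show ?thesis using a BH by (auto simp: cinner_op_adjoint_left)
    qed
    then show "a \<cdot> w \<in> ?W" by blast
  qed
  then have pM: "oproj ?W \<in> M" by (simp add: bicommutant)
  have "amp (oproj ?W) \<cdot> \<Omega> = 0"
  proof (rule ell2_eqI)
    fix j
    have "cinner w (ell2_nth \<Omega> j) = 0" if "w \<in> ?W" for w
    proof -
      have "cinner (id_blinfun \<cdot> ell2_nth \<Omega> j) w = 0"
        using that star_algebraD(2)[OF commutant_alg] by blast
      then show ?thesis by (metis blinfun_apply_id_blinfun cinner_commute complex_cnj_zero)
    qed
    then have "oproj ?W \<cdot> ell2_nth \<Omega> j = 0"
      by (intro oproj_eqI[OF W] csubspaceD(1)[OF W(1)]) (simp add: Ball_def)
    then show "ell2_nth (amp (oproj ?W) \<cdot> \<Omega>) j = ell2_nth 0 j"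
      by simp
  qed
  then have "oproj ?W = 0" by (rule separating[OF pM])
  moreover have "z \<in> ?W" using assms by blast
  ultimately show ?thesis using oproj_ident[OF W, of z] by simp
qed

text \<open>Convergence \<open>n\<^sub>k \<rightarrow> x\<close> in the 2-norm need not be bounded, so it does not give strong
  convergence.  But \<open>n\<^sub>k\<^sup>* \<rightarrow> x\<^sup>*\<close> as well, which is enough to pass to the limit in the matrix
  coefficients \<open>\<langle>n\<^sub>k v, m \<Omega>\<rangle>\<close> with \<open>m\<close> in the commutant, and these vectors \<open>m \<Omega>\<close> are total.\<close>

lemma mem_subalgebra:
  assumes N: "von_neumann_algebra N" "N \<subseteq> M" and x: "x \<in> M"
    and cl: "amp x \<cdot> \<Omega> \<in> closure ((\<lambda>n. amp n \<cdot> \<Omega>) ` N)"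
  shows "x \<in> N"
proof -
  have xB: "x \<in> BH" by (rule star_algebraD(1)[OF alg x])
  have "x \<in> commutant (commutant N)"
  proof (rule commutantI[OF xB])
    fix y u assume y: "y \<in> commutant N"
    have yB: "y \<in> BH" by (rule commutantD[OF y])
    define D where "D = (y o\<^sub>L x) - (x o\<^sub>L y)"
    have DB: "D \<in> BH"
      unfolding D_def by (intro BH_diff BH_compose xB yB)
    have coeff: "cinner (D \<cdot> (m \<cdot> ell2_nth \<Omega> j)) (m' \<cdot> ell2_nth \<Omega> i) = 0"
      if m: "m \<in> commutant M" and m': "m' \<in> commutant M" for m m' i j
    proof -
      note mB = commutantD(1)[OF m] and m'B = commutantD(1)[OF m']
      define v where "v = m \<cdot> ell2_nth \<Omega> j"
      define w where "w = m' \<cdot> ell2_nth \<Omega> i"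
      define K where "K = norm y * norm m * norm w + norm (y \<cdot> v) * norm m'"
      have "cmod (cinner (D \<cdot> v) w) \<le> K * e" if "e > 0" for e
      proof -
        obtain n where n: "n \<in> N" "dist (amp n \<cdot> \<Omega>) (amp x \<cdot> \<Omega>) < e"
          using cl \<open>e > 0\<close> unfolding closure_approachable by auto
        define d where "d = x - n"
        have d: "d \<in> M" using n N by (auto simp: d_def intro!: star_algebraD[OF alg] x)
        have dB: "d \<in> BH" by (rule star_algebraD(1)[OF alg d])
        have de: "norm (amp d \<cdot> \<Omega>) < e"
          using n(2) by (simp add: d_def amp_diff blinfun.diff_left dist_norm norm_minus_commute)
        have "y \<cdot> (n \<cdot> v) = n \<cdot> (y \<cdot> v)" by (rule commutantD(2)[OF y n(1)])
        moreover have "D \<cdot> v = y \<cdot> (x \<cdot> v) - x \<cdot> (y \<cdot> v)"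
          by (simp add: D_def blinfun.diff_left)
        moreover have "d \<cdot> u = x \<cdot> u - n \<cdot> u" for u by (simp add: d_def blinfun.diff_left)
        \<comment> \<open>As \<open>y\<close> commutes with \<open>n\<close>, the commutator of
          \<open>y\<close> with \<open>x\<close> equals its commutator with the error
          \<open>d = x - n\<close>.\<close>
        ultimately have "D \<cdot> v = y \<cdot> (d \<cdot> v) - d \<cdot> (y \<cdot> v)"
          by (simp add: blinfun.diff_right)
        \<comment> \<open>Moving \<open>d\<close> past \<open>m\<close> lets it act on a coordinate
          of \<open>\<Omega>\<close>, where it is small.\<close>
        also have "d \<cdot> v = m \<cdot> (d \<cdot> ell2_nth \<Omega> j)"
          unfolding v_def by (rule commutantD(2)[OF m d, symmetric])
        finally have "cinner (D \<cdot> v) w =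
            cinner (y \<cdot> (m \<cdot> (d \<cdot> ell2_nth \<Omega> j))) w - cinner (d \<cdot> (y \<cdot> v)) w"
          by (simp add: cinner_diff_left)
        moreover have "cmod (cinner (y \<cdot> (m \<cdot> (d \<cdot> ell2_nth \<Omega> j))) w) \<le> norm y * norm m * norm w * e"
        proof -
          have "norm (d \<cdot> ell2_nth \<Omega> j) \<le> e"
            using norm_ell2_nth_le[of "amp d \<cdot> \<Omega>" j] de by simp
          then have "norm (y \<cdot> (m \<cdot> (d \<cdot> ell2_nth \<Omega> j))) \<le> norm y * (norm m * e)"
            by (meson norm_blinfun mult_left_mono norm_ge_zero order_trans)
          then have "norm (y \<cdot> (m \<cdot> (d \<cdot> ell2_nth \<Omega> j))) * norm w \<le> norm y * (norm m * e) * norm w"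
            by (rule mult_right_mono) simp
          then show ?thesis
            using cmod_cinner_le[of "y \<cdot> (m \<cdot> (d \<cdot> ell2_nth \<Omega> j))" w] by (simp add: ac_simps)
        qed
        \<comment> \<open>Here \<open>d\<close> acts on a vector outside the orbit, so its adjoint
          is moved to \<open>w\<close>; by traciality the adjoint is equally small on
          \<open>\<Omega>\<close>.\<close>
        moreover have "cmod (cinner (d \<cdot> (y \<cdot> v)) w) \<le> norm (y \<cdot> v) * norm m' * e"
        proof -
          have d': "op_adjoint d \<in> M" by (rule star_algebraD(6)[OF alg d])
          have "cinner (d \<cdot> (y \<cdot> v)) w = cinner (y \<cdot> v) (op_adjoint d \<cdot> (m' \<cdot> ell2_nth \<Omega> i))"
            by (simp add: cinner_op_adjoint_right[OF dB] w_def)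
          also have "\<dots> = cinner (y \<cdot> v) (m' \<cdot> (op_adjoint d \<cdot> ell2_nth \<Omega> i))"
            by (simp add: commutantD(2)[OF m' d'])
          finally have "cmod (cinner (d \<cdot> (y \<cdot> v)) w) \<le> norm (y \<cdot> v) * norm (m' \<cdot> (op_adjoint d \<cdot> ell2_nth \<Omega> i))"
            by (simp add: cmod_cinner_le)
          moreover have "norm (op_adjoint d \<cdot> ell2_nth \<Omega> i) \<le> e"
            using norm_ell2_nth_le[of "amp (op_adjoint d) \<cdot> \<Omega>" i] de norm_adjoint[OF d] by simp
          then have "norm (m' \<cdot> (op_adjoint d \<cdot> ell2_nth \<Omega> i)) \<le> norm m' * e"
            by (meson norm_blinfun mult_left_mono norm_ge_zero order_trans)
          then have "norm (y \<cdot> v) * norm (m' \<cdot> (op_adjoint d \<cdot> ell2_nth \<Omega> i)) \<le> norm (y \<cdot> v) * (norm m' * e)"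
            by (rule mult_left_mono) simp
          ultimately show ?thesis by (simp add: ac_simps)
        qed
        ultimately have "cmod (cinner (D \<cdot> v) w) \<le> norm y * norm m * norm w * e + norm (y \<cdot> v) * norm m' * e"
          by (simp only: order_trans[OF norm_triangle_ineq4 add_mono])
        then show ?thesis by (simp add: K_def distrib_right)
      qed
      note le = this
      have "K \<ge> 0" by (simp add: K_def)
      have "cmod (cinner (D \<cdot> v) w) \<le> 0 + e" if "e > 0" for e
      proof -
        have "K * (e / (K + 1)) \<le> e"
          using \<open>K \<ge> 0\<close> \<open>e > 0\<close> by (simp add: field_simps)
        moreover have "e / (K + 1) > 0" using \<open>K \<ge> 0\<close> \<open>e > 0\<close> by simp
        ultimately show ?thesis using le[of "e / (K + 1)"] by linarith
      qed
      then have "cmod (cinner (D \<cdot> v) w) \<le> 0" by (rule field_le_epsilon)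
      then show ?thesis by (simp add: v_def w_def)
    qed
    \<comment> \<open>\<open>D\<close> need not lie in \<open>M\<close>, so totality is used twice:
      for the images of the vectors \<open>m \<cdot> ell2_nth \<Omega> j\<close> under
      \<open>D\<close>, then for the range of its adjoint.\<close>
    have D0: "D \<cdot> (m \<cdot> ell2_nth \<Omega> j) = 0" if "m \<in> commutant M" for m j
      by (rule commutant_total) (metis coeff that cinner_commute complex_cnj_zero)
    have "op_adjoint D \<cdot> z = 0" for z
      by (rule commutant_total) (simp add: cinner_op_adjoint_right[OF DB] D0)
    then have "cinner (D \<cdot> u) z = 0" for z
      by (simp flip: cinner_op_adjoint_right[OF DB])
    then have "D \<cdot> u = 0" by (intro cinner_ext) simp
    then show "x \<cdot> (y \<cdot> u) = y \<cdot> (x \<cdot> u)" by (simp add: D_def blinfun.diff_left)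
  qed
  then show ?thesis using N(1) by (simp add: von_neumann_algebra_def)
qed

end

section \<open>Normal traces are given by vectors\<close>

text \<open>Stacks a square-summable family of vectors into one vector of a larger amplification, so
  that a sum of vector states is again a vector state.\<close>

definition ell2_flatten :: "('i \<Rightarrow> ('j, 'h::complex_hilbert) ell2) \<Rightarrow> ('i \<times> 'j, 'h) ell2" where
  "ell2_flatten w = Abs_ell2 (\<lambda>(k, j). ell2_nth (w k) j)"

lemma
  assumes "(\<lambda>k. (norm (w k))\<^sup>2) summable_on UNIV"
  shows ell2_nth_flatten: "ell2_nth (ell2_flatten w) (k, j) = ell2_nth (w k) j"
    and norm_ell2_flatten: "(norm (ell2_flatten w))\<^sup>2 = (\<Sum>\<^sub>\<infinity>k. (norm (w k))\<^sup>2)"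
proof -
  have inner: "((\<lambda>j. (norm (ell2_nth (w k) j))\<^sup>2) has_sum (norm (w k))\<^sup>2) UNIV" for k
    unfolding norm_ell2_sq by (rule has_sum_infsum[OF summable_ell2])
  have summable: "(\<lambda>p. (norm (case p of (k, j) \<Rightarrow> ell2_nth (w k) j))\<^sup>2) summable_on (UNIV \<times> UNIV)"
    by (rule summable_on_SigmaI[where g = "\<lambda>k. (norm (w k))\<^sup>2"]) (auto simp: inner assms)
  then have nth: "ell2_nth (ell2_flatten w) = (\<lambda>(k, j). ell2_nth (w k) j)"
    unfolding ell2_flatten_def by (subst Abs_ell2_inverse) auto
  then show "ell2_nth (ell2_flatten w) (k, j) = ell2_nth (w k) j" by simp
  have "(norm (ell2_flatten w))\<^sup>2 = (\<Sum>\<^sub>\<infinity>p\<in>UNIV \<times> UNIV. (norm (case p of (k, j) \<Rightarrow> ell2_nth (w k) j))\<^sup>2)"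
    unfolding norm_ell2_sq nth by simp
  also have "\<dots> = (\<Sum>\<^sub>\<infinity>k. \<Sum>\<^sub>\<infinity>j. (norm (ell2_nth (w k) j))\<^sup>2)"
    using infsum_Sigma'_banach[of "\<lambda>k j. (norm (ell2_nth (w k) j))\<^sup>2" UNIV "\<lambda>_. UNIV"] summable
    by (simp add: case_prod_unfold)
  finally show "(norm (ell2_flatten w))\<^sup>2 = (\<Sum>\<^sub>\<infinity>k. (norm (w k))\<^sup>2)"
    by (simp add: norm_ell2_sq)
qed

lemma norm_amp_flatten:
  assumes "(\<lambda>k. (norm (w k))\<^sup>2) summable_on UNIV"
  shows "(norm (amp a \<cdot> ell2_flatten w))\<^sup>2 = (\<Sum>\<^sub>\<infinity>k. (norm (amp a \<cdot> w k))\<^sup>2)"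
proof -
  have *: "(\<lambda>k. (norm (amp a \<cdot> w k))\<^sup>2) summable_on UNIV"
  proof (rule summable_on_comparison_test[OF summable_on_cmult_right[OF assms, of "(norm a)\<^sup>2"]])
    show "(norm (amp a \<cdot> w k))\<^sup>2 \<le> (norm a)\<^sup>2 * (norm (w k))\<^sup>2" for k
      using power_mono[OF norm_amp_apply_le[of a "w k"], of 2] by (simp add: power_mult_distrib)
  qed simp
  have "amp a \<cdot> ell2_flatten w = ell2_flatten (\<lambda>k. amp a \<cdot> w k)"
  proof (rule ell2_eqI)
    show "ell2_nth (amp a \<cdot> ell2_flatten w) p = ell2_nth (ell2_flatten (\<lambda>k. amp a \<cdot> w k)) p" for p
      by (cases p) (simp add: ell2_nth_flatten[OF assms] ell2_nth_flatten[OF *])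
  qed
  then show "(norm (amp a \<cdot> ell2_flatten w))\<^sup>2 = (\<Sum>\<^sub>\<infinity>k. (norm (amp a \<cdot> w k))\<^sup>2)"
    by (simp add: norm_ell2_flatten[OF *])
qed

lemma square_summable_vector:
  assumes "square_summable \<xi>"
  obtains x :: "(nat, 'h::complex_hilbert) ell2" where "ell2_nth x = \<xi>"
proof (rule that[of "Abs_ell2 \<xi>"])
  have "(\<lambda>n. (norm (\<xi> n))\<^sup>2) summable_on UNIV"
    by (rule summable_nonneg_imp_summable_on) (use assms in \<open>auto simp: square_summable_def\<close>)
  then show "ell2_nth (Abs_ell2 \<xi>) = \<xi>" by (simp add: Abs_ell2_inverse)
qed

abbreviation vfunctional :: "(nat \<Rightarrow> 'h::complex_hilbert) \<Rightarrow> (nat \<Rightarrow> 'h) \<Rightarrow> 'h operator \<Rightarrow> complex" where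
  "vfunctional \<xi> \<eta> T \<equiv> (\<Sum>n. cinner (T \<cdot> \<xi> n) (\<eta> n))"

lemma vfunctional_eq:
  assumes x: "ell2_nth x = \<xi>" and y: "ell2_nth y = \<eta>"
  shows "vfunctional \<xi> \<eta> T = cinner (amp T \<cdot> x) y"
proof -
  have "((\<lambda>n. cinner (ell2_nth (amp T \<cdot> x) n) (ell2_nth y n)) has_sum cinner (amp T \<cdot> x) y) UNIV"
    unfolding cinner_ell2_def by (rule has_sum_infsum[OF summable_cinner_ell2])
  from has_sum_imp_sums[OF this] show ?thesis using x y by (simp add: sums_iff)
qed

text \<open>Induction over the generation of the topology, with each subbasic functional rewritten
  as a matrix coefficient of the amplification. The subbasic sets consist of elements of
  \<open>BH\<close>, hence the restriction on \<open>b\<close>.\<close>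

lemma ultraweak_neighbourhood:
  fixes U :: "'h::complex_hilbert operator set"
  assumes "openin ultraweak_topology U" "a \<in> U"
  shows "\<exists>C :: ((nat, 'h) ell2 \<times> (nat, 'h) ell2) set. \<exists>\<delta>>0. finite C \<and>
           (\<forall>b\<in>BH. (\<forall>(x, y)\<in>C. cmod (cinner (amp (b - a) \<cdot> x) y) < \<delta>) \<longrightarrow> b \<in> U)"
proof -
  let ?S = "{{T \<in> BH. vfunctional \<xi> \<eta> T \<in> U} | \<xi> (\<eta> :: nat \<Rightarrow> 'h) U.
     square_summable \<xi> \<and> square_summable \<eta> \<and> open U}"
  have "generate_topology_on ?S U"
    using assms(1) unfolding ultraweak_topology_def openin_topology_generated_by_iff .
  then show ?thesis using assms(2)
  proof (induction arbitrary: a rule: generate_topology_on.induct)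
    case (Int U V)
    obtain C :: "((nat, 'h) ell2 \<times> (nat, 'h) ell2) set" and \<delta> where C: "\<delta> > 0" "finite C"
      "\<forall>b\<in>BH. (\<forall>(x, y)\<in>C. cmod (cinner (amp (b - a) \<cdot> x) y) < \<delta>) \<longrightarrow> b \<in> U"
      using Int.IH(1)[of a] Int.prems by blast
    obtain D :: "((nat, 'h) ell2 \<times> (nat, 'h) ell2) set" and \<epsilon> where D: "\<epsilon> > 0" "finite D"
      "\<forall>b\<in>BH. (\<forall>(x, y)\<in>D. cmod (cinner (amp (b - a) \<cdot> x) y) < \<epsilon>) \<longrightarrow> b \<in> V"
      using Int.IH(2)[of a] Int.prems by blast
    show ?case
    proof (intro exI[of _ "C \<union> D"] exI[of _ "min \<delta> \<epsilon>"] conjI ballI impI)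
      fix b :: "'h operator"
      assume b: "b \<in> BH" "\<forall>(x, y)\<in>C \<union> D. cmod (cinner (amp (b - a) \<cdot> x) y) < min \<delta> \<epsilon>"
      have "\<forall>(x, y)\<in>C. cmod (cinner (amp (b - a) \<cdot> x) y) < \<delta>" using b(2) by auto
      moreover have "\<forall>(x, y)\<in>D. cmod (cinner (amp (b - a) \<cdot> x) y) < \<epsilon>" using b(2) by auto
      ultimately show "b \<in> U \<inter> V" using C(3) D(3) b(1) by blast
    qed (use C D in auto)
  next
    case (UN K)
    then obtain k where k: "k \<in> K" "a \<in> k" by auto
    show ?case using UN.IH[OF k] k(1) by blast
  next
    case (Basis s)
    then obtain \<xi> \<eta> U where s: "s = {T \<in> BH. vfunctional \<xi> \<eta> T \<in> U}"
      "square_summable \<xi>" "square_summable \<eta>" "open U" by auto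
    obtain x where x: "ell2_nth x = \<xi>" using square_summable_vector[OF s(2)] by auto
    obtain y where y: "ell2_nth y = \<eta>" using square_summable_vector[OF s(3)] by auto
    have s': "s = {T \<in> BH. cinner (amp T \<cdot> x) y \<in> U}" unfolding s(1) vfunctional_eq[OF x y] ..
    obtain e where e: "e > 0" "\<And>z. dist z (cinner (amp a \<cdot> x) y) < e \<Longrightarrow> z \<in> U"
      using s(4) Basis.prems unfolding s' open_dist by auto
    show ?case
    proof (intro exI[of _ "{(x, y)}"] exI[of _ e] conjI ballI impI)
      fix b :: "'h operator"
      assume "b \<in> BH" "\<forall>(x, y)\<in>{(x, y)}. cmod (cinner (amp (b - a) \<cdot> x) y) < e"
      then show "b \<in> s" unfolding s'
        by (auto intro!: e(2) simp: dist_norm amp_diff blinfun.diff_left cinner_diff_left)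
    qed (use e in auto)
  qed simp
qed

text \<open>Continuity at 0 bounds \<tau> by finitely many matrix coefficients. At
  \<open>op_adjoint a o\<^sub>L a\<close> such a coefficient is the inner product of
  \<open>amp a \<cdot> x\<close> and \<open>amp a \<cdot> y\<close>, at most the sum of their
  squared norms; stacking all these \<open>x\<close> and \<open>y\<close> gives \<zeta>.\<close>

lemma normal_functional_dominated:
  fixes \<tau> :: "'h::complex_hilbert operator \<Rightarrow> complex"
  assumes alg: "star_algebra M"
    and scale: "\<And>c a. a \<in> M \<Longrightarrow> \<tau> (op_scaleC c a) = c * \<tau> a"
    and cont: "continuous_map (subtopology ultraweak_topology M) euclidean \<tau>"
  obtains \<zeta> :: "(nat \<times> nat, 'h) ell2"
    where "\<And>a. a \<in> M \<Longrightarrow> cmod (\<tau> (op_adjoint a o\<^sub>L a)) \<le> (norm (amp a \<cdot> \<zeta>))\<^sup>2"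
proof -
  note MB = star_algebraD(1)[OF alg]
  have top: "topspace (ultraweak_topology :: 'h operator topology) = BH"
  proof -
    have "BH \<subseteq> topspace (ultraweak_topology :: 'h operator topology)"
    proof -
      have "openin (ultraweak_topology :: 'h operator topology) {T \<in> BH. vfunctional (\<lambda>_. 0) (\<lambda>_. 0) T \<in> UNIV}"
        unfolding ultraweak_topology_def
        by (rule topology_generated_by_Basis) (auto simp: square_summable_def intro!: exI[of _ "\<lambda>_. 0"] exI[of _ UNIV])
      then show ?thesis using openin_subset by fastforce
    qed
    then show ?thesis unfolding ultraweak_topology_def topology_generated_by_topspace by auto
  qed
  have zero: "\<tau> 0 = 0" using scale[OF star_algebraD(9)[OF alg], of 0] by simp
  have "openin (subtopology ultraweak_topology M) {a \<in> topspace (subtopology ultraweak_topology M). \<tau> a \<in> ball 0 1}"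
    using cont by (rule openin_continuous_map_preimage) auto
  then obtain U where U: "openin ultraweak_topology U" "{a \<in> M \<inter> BH. \<tau> a \<in> ball 0 1} = U \<inter> M"
    unfolding openin_subtopology topspace_subtopology top by (auto simp: Int_commute)
  have "0 \<in> U" using U(2) star_algebraD(9)[OF alg] MB zero by auto
  then obtain C \<delta> where C: "\<delta> > 0" "finite C"
    "\<And>b. b \<in> BH \<Longrightarrow> (\<And>x y. (x, y) \<in> C \<Longrightarrow> cmod (cinner (amp b \<cdot> x) (y :: (nat, 'h) ell2)) < \<delta>) \<Longrightarrow> b \<in> U"
    using ultraweak_neighbourhood[OF U(1), of 0] by (auto simp: Ball_def)
  define s where "s b = (\<Sum>(x, y)\<in>C. cmod (cinner (amp b \<cdot> x) y))" for b
  have s0: "s b \<ge> 0" for b unfolding s_def by (intro sum_nonneg) auto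
  have bound: "cmod (\<tau> b) \<le> s b / \<delta>" if b: "b \<in> M" for b
  proof (rule field_le_epsilon)
    fix e :: real assume "e > 0"
    \<comment> \<open>The extra \<open>e * \<delta>\<close> keeps \<open>t\<close> positive and the
      inequality strict even when \<open>s b = 0\<close>.\<close>
    define t where "t = s b + e * \<delta>"
    have t: "t > 0" "s b < t" using \<open>e > 0\<close> C(1) s0[of b] by (auto simp: t_def add_nonneg_pos)
    let ?b = "op_scaleC (of_real (\<delta> / t)) b"
    have "?b \<in> U"
    proof (rule C(3))
      show "?b \<in> BH" by (intro BH_scaleC MB b)
      fix x y assume xy: "(x, y) \<in> C"
      have "cmod (cinner (amp b \<cdot> x) y) \<le> s b"
        unfolding s_def using member_le_sum[of "(x, y)" C "\<lambda>(x, y). cmod (cinner (amp b \<cdot> x) y)"] C(2) xy by auto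
      then have "\<delta> / t * cmod (cinner (amp b \<cdot> x) y) < \<delta> / t * t"
        using t C(1) by (intro mult_strict_left_mono) auto
      then show "cmod (cinner (amp ?b \<cdot> x) y) < \<delta>"
        using t C(1) by (simp add: amp_scaleC cinner_scaleC_left norm_mult norm_divide)
    qed
    then have "?b \<in> U \<inter> M" using star_algebraD(5)[OF alg b] by blast
    then have "\<tau> ?b \<in> ball 0 1" unfolding U(2)[symmetric] by blast
    then have "\<delta> / t * cmod (\<tau> b) < 1" using t C(1) by (simp add: scale b norm_mult norm_divide)
    then have "cmod (\<tau> b) < t / \<delta>" using t C(1) by (simp add: field_simps)
    then show "cmod (\<tau> b) \<le> s b / \<delta> + e" using C(1) by (simp add: t_def field_simps)
  qed
  obtain cs where cs: "set cs = C" "distinct cs" using finite_distinct_list[OF C(2)] by auto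
  \<comment> \<open>Both components of every pair are listed. The factor \<open>r\<close> below
    becomes the division by \<delta> after squaring, and padding by zero extends the list to a
    family over all naturals.\<close>
  define L where "L = map fst cs @ map snd cs"
  define r where "r = 1 / sqrt \<delta>"
  define w where "w k = (if k < length L then r *\<^sub>R (L ! k) else 0)" for k
  have w: "(\<lambda>k. (norm (w k))\<^sup>2) summable_on UNIV"
    by (rule finite_nonzero_values_imp_summable_on)
       (auto simp: w_def intro: finite_subset[of _ "{..<length L}"])
  have sq: "s (op_adjoint a o\<^sub>L a) / \<delta> \<le> (norm (amp a \<cdot> ell2_flatten w))\<^sup>2" if a: "a \<in> M" for a
  proof -
    have "cmod (cinner (amp (op_adjoint a o\<^sub>L a) \<cdot> x) y) \<le> (norm (amp a \<cdot> x))\<^sup>2 + (norm (amp a \<cdot> y))\<^sup>2"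
      for x y :: "(nat, 'h) ell2"
    proof -
      have "cinner (amp (op_adjoint a o\<^sub>L a) \<cdot> x) y = cinner (amp a \<cdot> x) (amp a \<cdot> y)"
        by (simp add: amp_compose MB a amp_BH cinner_op_adjoint_left flip: op_adjoint_amp)
      moreover have "norm (amp a \<cdot> x) * norm (amp a \<cdot> y) \<le> (norm (amp a \<cdot> x))\<^sup>2 + (norm (amp a \<cdot> y))\<^sup>2"
        using sum_squares_bound[of "norm (amp a \<cdot> x)" "norm (amp a \<cdot> y)"]
          mult_nonneg_nonneg[OF norm_ge_zero[of "amp a \<cdot> x"] norm_ge_zero[of "amp a \<cdot> y"]] by linarith
      ultimately show ?thesis using cmod_cinner_le order_trans by metis
    qed
    then have "s (op_adjoint a o\<^sub>L a) \<le> (\<Sum>(x, y)\<in>C. (norm (amp a \<cdot> x))\<^sup>2 + (norm (amp a \<cdot> y))\<^sup>2)"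
      unfolding s_def by (intro sum_mono) auto
    also have "\<dots> = (\<Sum>p\<leftarrow>cs. (norm (amp a \<cdot> fst p))\<^sup>2 + (norm (amp a \<cdot> snd p))\<^sup>2)"
      using cs by (simp add: sum.distinct_set_conv_list[symmetric] case_prod_unfold)
    also have "\<dots> = (\<Sum>v\<leftarrow>L. (norm (amp a \<cdot> v))\<^sup>2)"
      by (simp add: L_def sum_list_addf o_def)
    also have "\<dots> = (\<Sum>k<length L. (norm (amp a \<cdot> (L ! k)))\<^sup>2)"
      by (simp add: sum_list_sum_nth atLeast0LessThan)
    finally have "s (op_adjoint a o\<^sub>L a) / \<delta> \<le> (\<Sum>k<length L. (norm (amp a \<cdot> (L ! k)))\<^sup>2) / \<delta>"
      using C(1) by (intro divide_right_mono) auto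
    also have "\<dots> = (\<Sum>k<length L. (norm (amp a \<cdot> w k))\<^sup>2)"
      using C(1) by (simp add: w_def r_def blinfun.scaleR_right power_mult_distrib power_divide sum_divide_distrib)
    also have "\<dots> = (\<Sum>\<^sub>\<infinity>k. (norm (amp a \<cdot> w k))\<^sup>2)"
      by (rule infsumI[symmetric], rule has_sum_finite_neutralI[where B = "{..<length L}"]) (auto simp: w_def)
    finally show ?thesis by (simp add: norm_amp_flatten[OF w])
  qed
  show ?thesis
  proof (rule that)
    fix a assume a: "a \<in> M"
    have "op_adjoint a o\<^sub>L a \<in> M" by (intro star_algebraD[OF alg] a)
    then show "cmod (\<tau> (op_adjoint a o\<^sub>L a)) \<le> (norm (amp a \<cdot> ell2_flatten w))\<^sup>2"
      using bound sq[OF a] order_trans by blast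
  qed
qed

subsection \<open>Positive functionals\<close>

locale positive_functional =
  fixes M :: "'h::complex_hilbert operator set" and \<phi> :: "'h operator \<Rightarrow> complex"
  assumes alg: "star_algebra M"
    and linear: "a \<in> M \<Longrightarrow> b \<in> M \<Longrightarrow> \<phi> (a + op_scaleC c b) = \<phi> a + c * \<phi> b"
    and positive: "a \<in> M \<Longrightarrow> \<phi> (op_adjoint a o\<^sub>L a) \<in> \<real>\<^sub>\<ge>\<^sub>0"
begin

text \<open>The sesquilinear form of the GNS construction.\<close>

definition form where "form a b = \<phi> (op_adjoint b o\<^sub>L a)"

lemma form_add_left:
  assumes "a \<in> M" "b \<in> M" "d \<in> M" shows "form (a + op_scaleC c b) d = form a d + c * form b d"
proof -
  have "op_adjoint d o\<^sub>L (a + op_scaleC c b) = (op_adjoint d o\<^sub>L a) + op_scaleC c (op_adjoint d o\<^sub>L b)"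
    by (rule blinfun_eqI)
       (simp add: blinfun.add_left blinfun.add_right BH_apply_scaleC op_adjoint_BH star_algebraD(1)[OF alg] assms)
  then show ?thesis unfolding form_def using assms by (simp add: linear star_algebraD[OF alg])
qed

lemma form_add_right:
  assumes "a \<in> M" "b \<in> M" "d \<in> M" shows "form d (a + op_scaleC c b) = form d a + cnj c * form d b"
proof -
  have "op_adjoint (a + op_scaleC c b) o\<^sub>L d = (op_adjoint a o\<^sub>L d) + op_scaleC (cnj c) (op_adjoint b o\<^sub>L d)"
    by (rule blinfun_eqI)
       (simp add: blinfun.add_left op_adjoint_add op_adjoint_scaleC BH_scaleC star_algebraD(1)[OF alg] assms)
  then show ?thesis unfolding form_def using assms by (simp add: linear star_algebraD[OF alg])
qed

lemma form_same:
  assumes "a \<in> M" shows "Im (form a a) = 0" "Re (form a a) \<ge> 0"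
  using positive[OF assms] by (auto simp: form_def complex_nonneg_Reals_iff)

lemma form_expand:
  assumes "a \<in> M" "b \<in> M"
  shows "form (a + op_scaleC c b) (a + op_scaleC c b) =
     form a a + cnj c * form a b + c * form b a + c * cnj c * form b b"
  using assms by (simp add: form_add_left form_add_right star_algebraD[OF alg] algebra_simps)

text \<open>Reality of the form on the diagonal, at \<open>a + b\<close> and at
  \<open>a + \<i> b\<close>, forces Hermitian symmetry.\<close>

lemma form_commute:
  assumes "a \<in> M" "b \<in> M" shows "form a b = cnj (form b a)"
proof -
  have *: "Im (cnj c * form a b + c * form b a + c * cnj c * form b b) = 0" for c
    using form_same(1)[of "a + op_scaleC c b"] form_same(1)[of a] form_expand[OF assms, of c] assms
    by (simp add: star_algebraD[OF alg])
  show ?thesis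
    using *[of 1] *[of \<i>] form_same(1)[OF assms(2)] by (simp add: complex_eq_iff)
qed

lemma form_Cauchy_Schwarz:
  assumes "a \<in> M" "b \<in> M" shows "(cmod (form a b))\<^sup>2 \<le> Re (form a a) * Re (form b b)"
proof -
  let ?A = "Re (form a a)" and ?B = "Re (form b b)" and ?z = "form a b"
  have *: "0 \<le> ?A - 2 * t * (cmod ?z)\<^sup>2 + t\<^sup>2 * (cmod ?z)\<^sup>2 * ?B" for t :: real
  proof -
    \<comment> \<open>Both cross terms become \<open>- t * (cmod ?z)\<^sup>2\<close>, which leaves a
      real quadratic polynomial in \<open>t\<close>.\<close>
    define c where "c = - (of_real t * ?z)"
    have "0 \<le> Re (form (a + op_scaleC c b) (a + op_scaleC c b))"
      using assms by (intro form_same(2)) (simp add: star_algebraD[OF alg])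
    also have "\<dots> = ?A + Re (cnj c * ?z) + Re (c * cnj ?z) + Re (c * cnj c * form b b)"
      unfolding form_expand[OF assms] by (simp add: form_commute[OF assms(2,1)])
    also have "cnj c * ?z = - of_real (t * (cmod ?z)\<^sup>2)"
      using complex_norm_square[of ?z] by (simp add: c_def ac_simps)
    also have "c * cnj ?z = - of_real (t * (cmod ?z)\<^sup>2)"
      using complex_norm_square[of ?z] by (simp add: c_def ac_simps)
    also have "c * cnj c = of_real (t\<^sup>2 * (cmod ?z)\<^sup>2)"
      using complex_norm_square[of ?z] by (simp add: c_def power2_eq_square ac_simps)
    finally show ?thesis by (simp add: algebra_simps)
  qed
  have B: "?B \<ge> 0" by (rule form_same(2)[OF assms(2)])
  show ?thesis
  proof (cases "?B = 0")
    case True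
    have "(cmod ?z)\<^sup>2 = 0"
    proof (rule ccontr)
      assume "(cmod ?z)\<^sup>2 \<noteq> 0"
      \<comment> \<open>Without its quadratic term the polynomial is affine in \<open>t\<close>; at
        this \<open>t\<close> it takes the value -1.\<close>
      then have "2 * ((?A + 1) / (2 * (cmod ?z)\<^sup>2)) * (cmod ?z)\<^sup>2 = ?A + 1" by (simp add: field_simps)
      then show False using *[of "(?A + 1) / (2 * (cmod ?z)\<^sup>2)"] True by simp
    qed
    then show ?thesis using True by simp
  next
    case False
    then have "?A - 2 * (1 / ?B) * (cmod ?z)\<^sup>2 + (1 / ?B)\<^sup>2 * (cmod ?z)\<^sup>2 * ?B = ?A - (cmod ?z)\<^sup>2 / ?B"
      by (simp add: power2_eq_square field_simps)
    then have "(cmod ?z)\<^sup>2 / ?B \<le> ?A" using *[of "1 / ?B"] by simp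
    then show ?thesis using False B by (simp add: field_simps)
  qed
qed

lemma form_id: "a \<in> M \<Longrightarrow> form a id_blinfun = \<phi> a"
proof -
  have "id_blinfun o\<^sub>L a = a" by (rule blinfun_eqI) simp
  then show ?thesis by (simp add: form_def)
qed

end

locale dominated_functional = positive_functional M \<phi>
  for M :: "'h::complex_hilbert operator set" and \<phi> +
  fixes \<zeta> :: "('j, 'h) ell2"
  assumes dominated: "a \<in> M \<Longrightarrow> Re (\<phi> (op_adjoint a o\<^sub>L a)) \<le> (norm (amp a \<cdot> \<zeta>))\<^sup>2"
begin

text \<open>If \<open>\<phi>\<close> is given by \<open>T\<zeta>\<close> with \<open>0 \<le> T \<le> 1\<close> in the commutant, the functional obtained by
  subtracting the vector state of \<open>T\<zeta>\<close> belongs to \<open>T - T\<^sup>2\<close>.  Iterating this writes \<open>T\<close> as a sum of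
  squares, which makes square roots of operators unnecessary.\<close>

lemma subtract_vector_state:
  "\<exists>t. (\<forall>b\<in>M. \<phi> b = cinner (amp b \<cdot> \<zeta>) t) \<and>
     dominated_functional M (\<lambda>b. \<phi> b - cinner (amp b \<cdot> t) t) \<zeta>"
proof -
  note MB = star_algebraD(1)[OF alg]
  have dom: "Re (form a a) \<le> (norm (amp a \<cdot> \<zeta>))\<^sup>2" if "a \<in> M" for a
    using dominated[OF that] by (simp add: form_def)
  have form_bound: "cmod (form a b) \<le> sqrt (Re (form a a)) * norm (amp b \<cdot> \<zeta>)" if "a \<in> M" "b \<in> M" for a b
  proof (rule power2_le_imp_le)
    have "(cmod (form a b))\<^sup>2 \<le> Re (form a a) * Re (form b b)" by (rule form_Cauchy_Schwarz[OF that])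
    also have "\<dots> \<le> Re (form a a) * (norm (amp b \<cdot> \<zeta>))\<^sup>2"
      by (intro mult_left_mono dom form_same that)
    finally show "(cmod (form a b))\<^sup>2 \<le> (sqrt (Re (form a a)) * norm (amp b \<cdot> \<zeta>))\<^sup>2"
      using form_same(2)[OF that(1)] by (simp add: power_mult_distrib)
  qed (auto simp: form_same that)
  let ?W = "closure ((\<lambda>b. amp b \<cdot> \<zeta>) ` M)"
  \<comment> \<open>Taking \<open>t\<close> in the closed orbit matters: the bound below tests
    \<open>amp a \<cdot> t\<close> against orbit vectors.\<close>
  have "\<exists>t\<in>?W. \<forall>b\<in>M. \<phi> b = cinner (amp b \<cdot> \<zeta>) t"
  proof (rule Riesz_representation[where sc = op_scaleC and C = "sqrt (Re (form id_blinfun id_blinfun))"])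
    fix a assume a: "a \<in> M"
    have "cmod (form id_blinfun a) \<le> sqrt (Re (form id_blinfun id_blinfun)) * norm (amp a \<cdot> \<zeta>)"
      by (intro form_bound a star_algebraD(2)[OF alg])
    also have "form id_blinfun a = cnj (\<phi> a)"
      using form_commute[OF star_algebraD(2)[OF alg] a] form_id[OF a] by simp
    finally show "cmod (\<phi> a) \<le> sqrt (Re (form id_blinfun id_blinfun)) * norm (amp a \<cdot> \<zeta>)" by simp
  next
    show "M \<noteq> {}" using star_algebraD(2)[OF alg] by auto
  qed (auto simp: star_algebraD[OF alg] linear amp_add amp_scaleC blinfun.add_left)
  then obtain t where t: "t \<in> ?W" "\<And>b. b \<in> M \<Longrightarrow> \<phi> b = cinner (amp b \<cdot> \<zeta>) t" by blast
  have adj: "cinner (amp (op_adjoint a o\<^sub>L b) \<cdot> x) y = cinner (amp b \<cdot> x) (amp a \<cdot> y)"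
    if "a \<in> M" for a b and x y :: "('j, 'h) ell2"
    by (simp add: amp_compose MB that amp_BH cinner_op_adjoint_left flip: op_adjoint_amp)
  \<comment> \<open>This expresses that the square of T is at most T. The vector \<open>u\<close>
    lies in the closed orbit, so its norm can be found by testing against orbit vectors; there the
    inner product is a value of the form, bounded by \<open>form_bound\<close>.\<close>
  have at: "(norm (amp a \<cdot> t))\<^sup>2 \<le> Re (form a a)" if a: "a \<in> M" for a
  proof -
    define u where "u = amp a \<cdot> t"
    define K where "K = sqrt (Re (form a a))"
    have uW: "u \<in> ?W"
      using closure_orbit_invariant[OF star_algebra_amp[OF alg], of "amp a" t \<zeta>] t(1) a
      by (simp add: u_def image_image)
    have le: "cmod (cinner v u) \<le> K * norm v" if "v \<in> ?W" for v
    proof -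
      obtain f where f: "\<And>n. f n \<in> (\<lambda>b. amp b \<cdot> \<zeta>) ` M" "f \<longlonglongrightarrow> v"
        using \<open>v \<in> ?W\<close> closure_sequential by metis
      have "cmod (cinner (f n) u) \<le> K * norm (f n)" for n
      proof -
        obtain b where b: "b \<in> M" "f n = amp b \<cdot> \<zeta>" using f(1)[of n] by auto
        have "cinner (f n) u = \<phi> (op_adjoint a o\<^sub>L b)"
          unfolding u_def b(2) adj[OF a, symmetric] by (intro t(2)[symmetric] star_algebraD[OF alg] a b)
        also have "\<dots> = cnj (form a b)" using form_commute[OF b(1) a] by (simp add: form_def)
        finally show ?thesis using form_bound[OF a b(1)] by (simp add: K_def b)
      qed
      moreover have "(\<lambda>n. cmod (cinner (f n) u)) \<longlonglongrightarrow> cmod (cinner v u)"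
        by (intro tendsto_norm bounded_linear.tendsto[OF bounded_linear_cinner_left] f)
      moreover have "(\<lambda>n. K * norm (f n)) \<longlonglongrightarrow> K * norm v" by (intro tendsto_intros f)
      ultimately show ?thesis by (intro LIMSEQ_le) auto
    qed
    have "norm u * norm u \<le> K * norm u"
      using le[OF uW] by (simp add: cinner_same power2_eq_square norm_mult)
    then have "norm u \<le> K" by (rule norm_le_if_sq_le[rotated]) (simp add: K_def form_same[OF a])
    then have "(norm u)\<^sup>2 \<le> K\<^sup>2" by (intro power_mono) auto
    then show ?thesis using form_same(2)[OF a] by (simp add: u_def K_def)
  qed
  have "dominated_functional M (\<lambda>b. \<phi> b - cinner (amp b \<cdot> t) t) \<zeta>"
  proof
    show "star_algebra M" by (rule alg)
    fix a assume a: "a \<in> M"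
    have eq: "cinner (amp (op_adjoint a o\<^sub>L a) \<cdot> t) t = of_real ((norm (amp a \<cdot> t))\<^sup>2)"
      unfolding adj[OF a] by (rule cinner_same)
    show "\<phi> (op_adjoint a o\<^sub>L a) - cinner (amp (op_adjoint a o\<^sub>L a) \<cdot> t) t \<in> \<real>\<^sub>\<ge>\<^sub>0"
      using at[OF a] form_same(1)[OF a] unfolding eq form_def by (simp add: complex_nonneg_Reals_iff)
    show "Re (\<phi> (op_adjoint a o\<^sub>L a) - cinner (amp (op_adjoint a o\<^sub>L a) \<cdot> t) t) \<le> (norm (amp a \<cdot> \<zeta>))\<^sup>2"
      using dominated[OF a] unfolding eq by simp (meson order_trans zero_le_power2 diff_le_eq le_add_same_cancel1)
    fix b c assume b: "b \<in> M"
    show "\<phi> (a + op_scaleC c b) - cinner (amp (a + op_scaleC c b) \<cdot> t) t =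
        \<phi> a - cinner (amp a \<cdot> t) t + c * (\<phi> b - cinner (amp b \<cdot> t) t)"
      by (simp add: linear a b amp_add amp_scaleC blinfun.add_left cinner_add_left cinner_scaleC_left algebra_simps)
  qed
  then show ?thesis using t(2) by blast
qed

text \<open>Iterated subtraction writes \<phi> as the vector states of \<open>t 0\<close>, ...,
  \<open>t (n - 1)\<close> plus a remainder \<open>\<psi> n\<close>. At
  \<open>op_adjoint a o\<^sub>L a\<close> the remainder is the inner product of
  \<open>amp a \<cdot> \<zeta>\<close> with \<open>amp a \<cdot> t n\<close>; it tends to 0, because
  the squared norms of \<open>amp a \<cdot> t n\<close> have bounded partial sums.\<close>

lemma vector_representation:
  obtains \<Omega> :: "(nat \<times> 'j, 'h) ell2"
    where "\<And>a. a \<in> M \<Longrightarrow> \<phi> (op_adjoint a o\<^sub>L a) = of_real ((norm (amp a \<cdot> \<Omega>))\<^sup>2)"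
proof -
  \<comment> \<open>A stage consists of the current remainder and its representing vector. The
    clause for \<open>n = 0\<close> records the starting point, which dependent choice would
    otherwise leave open.\<close>
  let ?P = "\<lambda>(n::nat) (\<psi>, t). dominated_functional M \<psi> \<zeta> \<and> (\<forall>b\<in>M. \<psi> b = cinner (amp b \<cdot> \<zeta>) t) \<and>
       dominated_functional M (\<lambda>b. \<psi> b - cinner (amp b \<cdot> t) t) \<zeta> \<and> (n = 0 \<longrightarrow> \<psi> = \<phi>)"
  let ?Q = "\<lambda>(n::nat) (\<psi>, t) (\<psi>', t'). \<psi>' = (\<lambda>b. \<psi> b - cinner (amp b \<cdot> t) t)"
  have "\<exists>f. \<forall>n. ?P n (f n) \<and> ?Q n (f n) (f (Suc n))"
  proof (rule dependent_nat_choice)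
    show "\<exists>x. ?P 0 x" using subtract_vector_state dominated_functional_axioms by auto
    fix x n assume x: "?P n x"
    obtain \<psi> t where xt: "x = (\<psi>, t)" by (cases x)
    interpret d: dominated_functional M "\<lambda>b. \<psi> b - cinner (amp b \<cdot> t) t" \<zeta> using x by (simp add: xt)
    show "\<exists>y. ?P (Suc n) y \<and> ?Q n x y"
      using d.subtract_vector_state d.dominated_functional_axioms by (auto simp: xt)
  qed
  then obtain f where f: "\<forall>n. ?P n (f n) \<and> ?Q n (f n) (f (Suc n))" ..
  define \<psi> where "\<psi> n = fst (f n)" for n
  define t where "t n = snd (f n)" for n
  have dom: "dominated_functional M (\<psi> n) \<zeta>" and rep: "\<And>b. b \<in> M \<Longrightarrow> \<psi> n b = cinner (amp b \<cdot> \<zeta>) (t n)"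
    and Suc: "\<psi> (Suc n) = (\<lambda>b. \<psi> n b - cinner (amp b \<cdot> t n) (t n))" for n
    using spec[OF f, of n] by (auto simp: \<psi>_def t_def case_prod_unfold)
  have zero: "\<psi> 0 = \<phi>" using spec[OF f, of 0] by (auto simp: \<psi>_def case_prod_unfold)
  note MB = star_algebraD(1)[OF alg]
  have adj: "cinner (amp (op_adjoint a o\<^sub>L a) \<cdot> x) y = cinner (amp a \<cdot> x) (amp a \<cdot> y)"
    if "a \<in> M" for a and x y :: "('j, 'h) ell2"
    by (simp add: amp_compose MB that amp_BH cinner_op_adjoint_left flip: op_adjoint_amp)
  have partial: "\<phi> (op_adjoint a o\<^sub>L a) = (\<Sum>k<n. of_real ((norm (amp a \<cdot> t k))\<^sup>2)) + \<psi> n (op_adjoint a o\<^sub>L a)"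
    if a: "a \<in> M" for a n
    by (induction n) (simp_all add: zero Suc adj[OF a] cinner_same)
  have sums: "(\<lambda>k. (norm (amp a \<cdot> t k))\<^sup>2) sums Re (\<phi> (op_adjoint a o\<^sub>L a))" if a: "a \<in> M" for a
  proof -
    have Re_partial: "(\<Sum>k<n. (norm (amp a \<cdot> t k))\<^sup>2) = Re (\<phi> (op_adjoint a o\<^sub>L a)) - Re (\<psi> n (op_adjoint a o\<^sub>L a))" for n
      using partial[OF a, of n] by simp
    have nonneg: "Re (\<psi> n (op_adjoint a o\<^sub>L a)) \<ge> 0" for n
    proof -
      interpret d: dominated_functional M "\<psi> n" \<zeta> by (rule dom)
      show ?thesis using d.positive[OF a] by (auto simp: complex_nonneg_Reals_iff)
    qed
    have "summable (\<lambda>k. (norm (amp a \<cdot> t k))\<^sup>2)"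
      by (rule summableI_nonneg_bounded[where x = "Re (\<phi> (op_adjoint a o\<^sub>L a))"])
         (use Re_partial nonneg in auto)
    then have "(\<lambda>k. (norm (amp a \<cdot> t k))\<^sup>2) \<longlonglongrightarrow> 0" by (rule summable_LIMSEQ_zero)
    then have "(\<lambda>k. sqrt ((norm (amp a \<cdot> t k))\<^sup>2)) \<longlonglongrightarrow> sqrt 0" by (rule tendsto_real_sqrt)
    then have "(\<lambda>k. amp a \<cdot> t k) \<longlonglongrightarrow> 0" by (simp add: tendsto_norm_zero_iff)
    then have "(\<lambda>k. cinner (amp a \<cdot> \<zeta>) (amp a \<cdot> t k)) \<longlonglongrightarrow> cinner (amp a \<cdot> \<zeta>) 0"
      by (rule bounded_linear.tendsto[OF bounded_linear_cinner_right])
    then have "(\<lambda>n. \<psi> n (op_adjoint a o\<^sub>L a)) \<longlonglongrightarrow> 0"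
      using a by (simp add: rep adj star_algebraD[OF alg])
    then have "(\<lambda>n. Re (\<phi> (op_adjoint a o\<^sub>L a)) - Re (\<psi> n (op_adjoint a o\<^sub>L a)))
        \<longlonglongrightarrow> Re (\<phi> (op_adjoint a o\<^sub>L a)) - Re 0"
      by (intro tendsto_intros)
    then show ?thesis unfolding sums_def Re_partial by simp
  qed
  have has_sum: "((\<lambda>k. (norm (amp a \<cdot> t k))\<^sup>2) has_sum Re (\<phi> (op_adjoint a o\<^sub>L a))) UNIV" if "a \<in> M" for a
    by (rule sums_nonneg_imp_has_sum[OF sums[OF that]]) simp
  have summable: "(\<lambda>k. (norm (t k))\<^sup>2) summable_on UNIV"
    using has_sum[OF star_algebraD(2)[OF alg]] by (auto simp: summable_on_def)
  show ?thesis
  proof (rule that[of "ell2_flatten t"])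
    fix a assume a: "a \<in> M"
    have "(norm (amp a \<cdot> ell2_flatten t))\<^sup>2 = Re (\<phi> (op_adjoint a o\<^sub>L a))"
      unfolding norm_amp_flatten[OF summable]
      by (rule infsumI[OF has_sum[OF a]])
    then show "\<phi> (op_adjoint a o\<^sub>L a) = of_real ((norm (amp a \<cdot> ell2_flatten t))\<^sup>2)"
      using form_same(1)[OF a] by (simp add: complex_eq_iff form_def del: of_real_power)
  qed
qed

end

text \<open>The three naturals index, from the last to the first, the square-summable sequences of
  the ultraweak functionals, the finite list behind \<zeta>, and the stages of the iteration. The
  iteration describes \<tau> only at \<open>op_adjoint a o\<^sub>L a\<close>; polarisation gives the
  rest.\<close>

lemma faithful_normal_trace_vector:
  fixes M :: "'h::complex_hilbert operator set"
  assumes vN: "von_neumann_algebra M" and tr: "faithful_normal_trace M \<tau>"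
  obtains \<Omega> :: "(nat \<times> nat \<times> nat, 'h) ell2"
    where "trace_vector M \<Omega>"
      "\<And>a b. a \<in> M \<Longrightarrow> b \<in> M \<Longrightarrow> \<tau> (op_adjoint b o\<^sub>L a) = cinner (amp a \<cdot> \<Omega>) (amp b \<cdot> \<Omega>)"
proof -
  note alg = von_neumann_algebra_star_algebra(1)[OF vN]
  note MB = star_algebraD(1)[OF alg]
  have add: "\<And>a b. a \<in> M \<Longrightarrow> b \<in> M \<Longrightarrow> \<tau> (a + b) = \<tau> a + \<tau> b"
    and scale: "\<And>c a. a \<in> M \<Longrightarrow> \<tau> (op_scaleC c a) = c * \<tau> a"
    and pos: "\<And>a. a \<in> M \<Longrightarrow> \<tau> (op_adjoint a o\<^sub>L a) \<in> \<real>\<^sub>\<ge>\<^sub>0"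
    and comm: "\<And>a b. a \<in> M \<Longrightarrow> b \<in> M \<Longrightarrow> \<tau> (a o\<^sub>L b) = \<tau> (b o\<^sub>L a)"
    and faithful: "\<And>a. a \<in> M \<Longrightarrow> \<tau> (op_adjoint a o\<^sub>L a) = 0 \<Longrightarrow> a = 0"
    and cont: "continuous_map (subtopology ultraweak_topology M) euclidean \<tau>"
    using tr unfolding faithful_normal_trace_def by auto
  obtain \<zeta> :: "(nat \<times> nat, 'h) ell2"
    where \<zeta>: "\<And>a. a \<in> M \<Longrightarrow> cmod (\<tau> (op_adjoint a o\<^sub>L a)) \<le> (norm (amp a \<cdot> \<zeta>))\<^sup>2"
    using normal_functional_dominated[OF alg scale cont] by blast
  interpret dominated_functional M \<tau> \<zeta>
    by standard (use alg add scale pos in \<open>auto simp: star_algebraD intro: order_trans[OF complex_Re_le_cmod \<zeta>]\<close>)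
  obtain \<Omega> :: "(nat \<times> nat \<times> nat, 'h) ell2"
    where \<Omega>: "\<And>a. a \<in> M \<Longrightarrow> \<tau> (op_adjoint a o\<^sub>L a) = of_real ((norm (amp a \<cdot> \<Omega>))\<^sup>2)"
    using vector_representation by blast
  have eq: "form a b = cinner (amp a \<cdot> \<Omega>) (amp b \<cdot> \<Omega>)" if ab: "a \<in> M" "b \<in> M" for a b
  proof -
    define s where "s a b = form a b - cinner (amp a \<cdot> \<Omega>) (amp b \<cdot> \<Omega>)" for a b
    have diag: "s a a = 0" if "a \<in> M" for a
      using \<Omega>[OF that] by (simp add: s_def form_def cinner_same)
    have "cnj c * s a b + c * s b a = 0" for c
    proof -
      have "s (a + op_scaleC c b) (a + op_scaleC c b) = s a a + cnj c * s a b + c * s b a + c * cnj c * s b b"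
        unfolding s_def form_expand[OF ab]
        by (simp add: amp_add amp_scaleC blinfun.add_left cinner_add_left cinner_add_right
            cinner_scaleC_left cinner_scaleC_right algebra_simps)
      then show ?thesis using ab by (simp add: diag star_algebraD[OF alg])
    qed
    from this[of 1] this[of \<i>] have "s a b = 0" by (simp add: add_eq_0_iff)
    then show ?thesis by (simp add: s_def)
  qed
  show ?thesis
  proof (rule that)
    show "\<tau> (op_adjoint b o\<^sub>L a) = cinner (amp a \<cdot> \<Omega>) (amp b \<cdot> \<Omega>)" if "a \<in> M" "b \<in> M" for a b
      using eq[OF that] by (simp add: form_def)
    show "trace_vector M \<Omega>"
    proof
      show "x = 0" if "x \<in> M" "amp x \<cdot> \<Omega> = 0" for x
        by (rule faithful[OF that(1)]) (simp add: \<Omega> that)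
      fix x y assume xy: "x \<in> M" "y \<in> M"
      then have "cinner (amp x \<cdot> \<Omega>) (amp y \<cdot> \<Omega>) = \<tau> (op_adjoint y o\<^sub>L x)" by (simp add: eq[symmetric] form_def)
      also have "\<dots> = \<tau> (x o\<^sub>L op_adjoint y)" by (intro comm star_algebraD[OF alg] xy)
      also have "\<dots> = form (op_adjoint y) (op_adjoint x)" using xy by (simp add: form_def MB)
      also have "\<dots> = cinner (amp (op_adjoint y) \<cdot> \<Omega>) (amp (op_adjoint x) \<cdot> \<Omega>)"
        by (intro eq star_algebraD[OF alg] xy)
      finally show "cinner (amp x \<cdot> \<Omega>) (amp y \<cdot> \<Omega>) = cinner (amp (op_adjoint y) \<cdot> \<Omega>) (amp (op_adjoint x) \<cdot> \<Omega>)" .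
    qed (rule vN)
  qed
qed

section \<open>Trace-preserving actions\<close>

text \<open>Taking roots of order 2^n removes the constant \<open>B\<close> in the limit; these
  exponents are the ones reached by repeated squaring.\<close>

lemma power_two_power_bound:
  fixes x c B :: real
  assumes "c > 0" "\<And>n. x ^ (2 ^ n) \<le> B * c ^ (2 ^ n)"
  shows "x \<le> c"
proof (rule ccontr)
  assume "\<not> x \<le> c"
  then have q: "x / c > 1" using assms(1) by simp
  obtain n where n: "B < (x / c) ^ n" using real_arch_pow[OF q] by blast
  also have "\<dots> \<le> (x / c) ^ (2 ^ n)"
    using q by (intro power_increasing) (auto simp: less_imp_le[OF less_exp])
  also have "\<dots> \<le> B" using assms by (simp add: power_divide field_simps)
  finally show False by simp
qed

locale vector_action = trace_vector P \<Omega>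
  for P :: "'h::complex_hilbert operator set" and \<Omega> :: "('j, 'h) ell2" +
  fixes \<sigma> :: "'g::group_add \<Rightarrow> 'h operator \<Rightarrow> 'h operator"
  assumes automorphism: "star_automorphism P (\<sigma> g)"
    and act_zero: "a \<in> P \<Longrightarrow> \<sigma> 0 a = a"
    and act_plus: "a \<in> P \<Longrightarrow> \<sigma> (g + h) a = \<sigma> g (\<sigma> h a)"
    and act_trace: "a \<in> P \<Longrightarrow> cinner (amp (\<sigma> g a) \<cdot> \<Omega>) \<Omega> = cinner (amp a \<cdot> \<Omega>) \<Omega>"
begin

lemma
  shows act_mem: "a \<in> P \<Longrightarrow> \<sigma> g a \<in> P"
    and act_add: "a \<in> P \<Longrightarrow> b \<in> P \<Longrightarrow> \<sigma> g (a + b) = \<sigma> g a + \<sigma> g b"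
    and act_scaleC: "a \<in> P \<Longrightarrow> \<sigma> g (op_scaleC c a) = op_scaleC c (\<sigma> g a)"
    and act_compose: "a \<in> P \<Longrightarrow> b \<in> P \<Longrightarrow> \<sigma> g (a o\<^sub>L b) = \<sigma> g a o\<^sub>L \<sigma> g b"
    and act_adjoint: "a \<in> P \<Longrightarrow> \<sigma> g (op_adjoint a) = op_adjoint (\<sigma> g a)"
  using automorphism[of g] by (auto simp: star_automorphism_def bij_betw_def)

lemma mem_BH: "a \<in> P \<Longrightarrow> a \<in> BH"
  by (rule star_algebraD(1)[OF alg])

lemma act_inverse: "a \<in> P \<Longrightarrow> \<sigma> (- g) (\<sigma> g a) = a" "a \<in> P \<Longrightarrow> \<sigma> g (\<sigma> (- g) a) = a"
  using act_plus[of a "- g" g] act_plus[of a g "- g"] by (simp_all add: act_zero)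

text \<open>A surjective multiplicative map sends the unit to a left unit of the whole
  algebra.\<close>

lemma act_id: "\<sigma> g id_blinfun = id_blinfun"
proof -
  have id: "id_blinfun \<in> P" by (rule star_algebraD(2)[OF alg])
  have "id_blinfun = \<sigma> g (\<sigma> (- g) id_blinfun)" by (simp add: act_inverse id)
  also have "\<sigma> (- g) id_blinfun = id_blinfun o\<^sub>L \<sigma> (- g) id_blinfun" by (rule blinfun_eqI) simp
  also have "\<sigma> g \<dots> = \<sigma> g id_blinfun o\<^sub>L \<sigma> g (\<sigma> (- g) id_blinfun)"
    by (intro act_compose id act_mem)
  also have "\<dots> = \<sigma> g id_blinfun" by (rule blinfun_eqI) (simp add: act_inverse id)
  finally show ?thesis by simp
qed

lemma norm_amp_sq: "a \<in> P \<Longrightarrow> of_real ((norm (amp a \<cdot> \<Omega>))\<^sup>2) = cinner (amp (op_adjoint a o\<^sub>L a) \<cdot> \<Omega>) \<Omega>"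
  by (simp add: amp_compose mem_BH amp_BH cinner_op_adjoint_left cinner_same flip: op_adjoint_amp)

lemma act_norm2: "a \<in> P \<Longrightarrow> norm (amp (\<sigma> g a) \<cdot> \<Omega>) = norm (amp a \<cdot> \<Omega>)"
proof -
  assume a: "a \<in> P"
  have "of_real ((norm (amp (\<sigma> g a) \<cdot> \<Omega>))\<^sup>2) = cinner (amp (\<sigma> g (op_adjoint a o\<^sub>L a)) \<cdot> \<Omega>) \<Omega>"
    using a by (simp add: norm_amp_sq act_mem act_adjoint act_compose star_algebraD[OF alg] del: of_real_power)
  also have "\<dots> = of_real ((norm (amp a \<cdot> \<Omega>))\<^sup>2)"
    using a by (simp add: norm_amp_sq act_trace star_algebraD[OF alg] del: of_real_power)
  finally show ?thesis by (simp add: power2_eq_iff_nonneg del: of_real_power)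
qed

lemma trace_commute:
  assumes "a \<in> P" "b \<in> P"
  shows "cinner (amp (a o\<^sub>L b) \<cdot> \<Omega>) \<Omega> = cinner (amp (b o\<^sub>L a) \<cdot> \<Omega>) \<Omega>"
proof -
  have *: "cinner (amp (a o\<^sub>L b) \<cdot> \<Omega>) \<Omega> = cinner (amp b \<cdot> \<Omega>) (amp (op_adjoint a) \<cdot> \<Omega>)"
    if "a \<in> P" for a b
    by (simp add: that amp_compose mem_BH amp_BH cinner_op_adjoint_right flip: op_adjoint_amp)
  show ?thesis
    using trace[OF assms(2) star_algebraD(6)[OF alg assms(1)]] assms by (simp add: * mem_BH)
qed

text \<open>The spectral radius argument: for the dense set of vectors on which the 2-norm controls the
  vector norm, the powers of \<open>\<sigma>\<^sub>g(a\<^sup>* a)\<close> grow at most like those of \<open>\<parallel>a\<parallel>\<^sup>2\<close>.\<close>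

lemma act_bounded:
  assumes a: "a \<in> P" shows "norm (\<sigma> g a) \<le> norm a"
proof (cases "a = 0")
  case True
  have "\<sigma> g 0 = 0" using act_scaleC[of 0 g 0] star_algebraD(9)[OF alg] by simp
  then show ?thesis using True by simp
next
  case False
  \<comment> \<open>\<open>D\<close> contains the commutant applied to the coordinates of
    \<open>\<Omega>\<close>, hence is dense.\<close>
  define D where "D = {v. \<exists>C. \<forall>x\<in>P. norm (x \<cdot> v) \<le> C * norm (amp x \<cdot> \<Omega>)}"
  have "csubspace D" unfolding csubspace_def
  proof (intro conjI ballI allI)
    show "0 \<in> D" by (auto simp: D_def intro!: exI[of _ 0])
    fix v assume "v \<in> D"
    then obtain C where C: "\<And>x. x \<in> P \<Longrightarrow> norm (x \<cdot> v) \<le> C * norm (amp x \<cdot> \<Omega>)" by (auto simp: D_def)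
    { fix w assume "w \<in> D"
      then obtain C' where C': "\<And>x. x \<in> P \<Longrightarrow> norm (x \<cdot> w) \<le> C' * norm (amp x \<cdot> \<Omega>)" by (auto simp: D_def)
      have "norm (x \<cdot> (v + w)) \<le> (C + C') * norm (amp x \<cdot> \<Omega>)" if "x \<in> P" for x
        using norm_triangle_ineq[of "x \<cdot> v" "x \<cdot> w"] C[OF that] C'[OF that]
        by (simp add: blinfun.add_right distrib_right)
      then show "v + w \<in> D" by (auto simp: D_def) }
    fix c
    have "norm (x \<cdot> (c *\<^sub>C v)) \<le> (cmod c * C) * norm (amp x \<cdot> \<Omega>)" if "x \<in> P" for x
      using mult_left_mono[OF C[OF that], of "cmod c"] that
      by (simp add: BH_apply_scaleC mem_BH norm_scaleC mult.assoc)
    then show "c *\<^sub>C v \<in> D" by (auto simp: D_def)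
  qed
  moreover have "m \<cdot> ell2_nth \<Omega> j \<in> D" if m: "m \<in> commutant P" for m j
  proof -
    have "norm (x \<cdot> (m \<cdot> ell2_nth \<Omega> j)) \<le> norm m * norm (amp x \<cdot> \<Omega>)" if "x \<in> P" for x
    proof -
      have "norm (x \<cdot> (m \<cdot> ell2_nth \<Omega> j)) = norm (m \<cdot> (x \<cdot> ell2_nth \<Omega> j))"
        by (simp add: commutantD(2)[OF m that])
      also have "\<dots> \<le> norm m * norm (x \<cdot> ell2_nth \<Omega> j)" by (rule norm_blinfun)
      also have "\<dots> \<le> norm m * norm (amp x \<cdot> \<Omega>)"
        using norm_ell2_nth_le[of "amp x \<cdot> \<Omega>" j] by (intro mult_left_mono) auto
      finally show ?thesis .
    qed
    then show ?thesis by (auto simp: D_def)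
  qed
  ultimately have dense: "closure D = UNIV"
    by (intro closure_UNIV_if_orthogonal_trivial commutant_total) auto
  define K where "K = (norm a)\<^sup>2"
  have K: "K > 0" using False by (simp add: K_def)
  \<comment> \<open>Repeated squares of \<open>op_adjoint a o\<^sub>L a\<close>, all
    self-adjoint.\<close>
  define y where "y = rec_nat (op_adjoint a o\<^sub>L a) (\<lambda>_ b. b o\<^sub>L b)"
  have y0: "y 0 = op_adjoint a o\<^sub>L a" and ySuc: "y (Suc n) = y n o\<^sub>L y n" for n
    by (simp_all add: y_def)
  have yP: "y n \<in> P" for n
    by (induction n) (auto simp: y0 ySuc a star_algebraD[OF alg])
  have yadj: "op_adjoint (y n) = y n" for n
  proof (induction n)
    case 0 show ?case using a by (simp add: y0 op_adjoint_compose op_adjoint_BH mem_BH)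
  next
    case (Suc n) then show ?case using yP[of n] by (simp add: ySuc op_adjoint_compose mem_BH)
  qed
  have ynorm: "norm (y n) \<le> K ^ (2 ^ n)" for n
  proof (induction n)
    case 0
    have "norm (op_adjoint a) * norm a \<le> norm a * norm a"
      by (intro mult_right_mono norm_op_adjoint_le mem_BH a) auto
    then show ?case using norm_blinfun_compose[of "op_adjoint a" a] by (simp add: y0 K_def power2_eq_square)
  next
    case (Suc n)
    have "norm (y n) * norm (y n) \<le> K ^ (2 ^ n) * K ^ (2 ^ n)"
      using Suc K by (intro mult_mono) auto
    then show ?case using norm_blinfun_compose[of "y n" "y n"] by (simp add: ySuc power_add mult_2)
  qed
  have le: "norm (\<sigma> g a \<cdot> v) \<le> norm a * norm v" if v: "v \<in> D" for v
  proof (cases "v = 0")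
    case False
    define r where "r n = norm (\<sigma> g (y n) \<cdot> v) / norm v" for n
    have r0: "r n \<ge> 0" for n by (simp add: r_def)
    \<comment> \<open>Self-adjointness turns the squared norm of
      \<open>\<sigma> g (y n) \<cdot> v\<close> into a matrix coefficient of
      \<open>\<sigma> g (y (Suc n))\<close>.\<close>
    have "(r n)\<^sup>2 \<le> r (Suc n)" for n
    proof -
      have "(norm (\<sigma> g (y n) \<cdot> v))\<^sup>2 = cmod (cinner (\<sigma> g (y n) \<cdot> v) (\<sigma> g (y n) \<cdot> v))"
        by (simp add: cinner_same norm_power)
      also have "\<dots> = cmod (cinner (\<sigma> g (y (Suc n)) \<cdot> v) v)"
        using cinner_op_adjoint_left[OF mem_BH[OF act_mem[OF yP]], of g n "\<sigma> g (y n) \<cdot> v" v]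
        by (simp add: ySuc act_compose yP yadj flip: act_adjoint)
      also have "\<dots> \<le> norm (\<sigma> g (y (Suc n)) \<cdot> v) * norm v" by (rule cmod_cinner_le)
      finally show ?thesis using False by (simp add: r_def power_divide field_simps power2_eq_square)
    qed
    note step = this
    have rpow: "r 0 ^ (2 ^ n) \<le> r n" for n
    proof (induction n)
      case (Suc n)
      have "r 0 ^ (2 ^ Suc n) = (r 0 ^ (2 ^ n))\<^sup>2" by (simp add: power_mult[symmetric] mult.commute)
      also have "\<dots> \<le> (r n)\<^sup>2" using Suc r0 by (intro power_mono) auto
      finally show ?case using step order_trans by blast
    qed simp
    obtain C where C: "\<And>x. x \<in> P \<Longrightarrow> norm (x \<cdot> v) \<le> C * norm (amp x \<cdot> \<Omega>)"
      using v by (auto simp: D_def)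
    \<comment> \<open>Here \<open>\<sigma> g\<close> is removed: it preserves the 2-norm, which
      controls the vector norm on \<open>v\<close>. The constant depends on \<open>v\<close> but not
      on \<open>n\<close>.\<close>
    have rle: "r n \<le> (\<bar>C\<bar> * norm \<Omega> / norm v) * K ^ (2 ^ n)" for n
    proof -
      have "norm (\<sigma> g (y n) \<cdot> v) \<le> C * norm (amp (y n) \<cdot> \<Omega>)"
        using C[OF act_mem[OF yP]] by (simp add: act_norm2 yP)
      also have "\<dots> \<le> \<bar>C\<bar> * norm (amp (y n) \<cdot> \<Omega>)" by (intro mult_right_mono) auto
      also have "\<dots> \<le> \<bar>C\<bar> * (K ^ (2 ^ n) * norm \<Omega>)"
        by (intro mult_left_mono order_trans[OF norm_amp_apply_le] mult_right_mono ynorm) auto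
      finally show ?thesis using False by (simp add: r_def field_simps)
    qed
    have "r 0 \<le> K"
      by (rule power_two_power_bound[OF K]) (rule order_trans[OF rpow rle])
    then have *: "norm (\<sigma> g (y 0) \<cdot> v) \<le> K * norm v" using False by (simp add: r_def field_simps)
    have "(norm (\<sigma> g a \<cdot> v))\<^sup>2 = cmod (cinner (\<sigma> g a \<cdot> v) (\<sigma> g a \<cdot> v))"
      by (simp add: cinner_same norm_power)
    also have "\<dots> = cmod (cinner (\<sigma> g (y 0) \<cdot> v) v)"
      using cinner_op_adjoint_left[OF mem_BH[OF act_mem[OF a]], of g "\<sigma> g a \<cdot> v" v]
      by (simp add: y0 act_compose a act_adjoint star_algebraD[OF alg])
    also have "\<dots> \<le> K * norm v * norm v"
      by (rule order_trans[OF cmod_cinner_le]) (intro mult_right_mono * norm_ge_zero)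
    finally have "(norm (\<sigma> g a \<cdot> v))\<^sup>2 \<le> (norm a * norm v)\<^sup>2"
      by (simp add: K_def power2_eq_square ac_simps)
    then show ?thesis by (rule power2_le_imp_le) auto
  qed simp
  show ?thesis
  proof (rule norm_blinfun_bound)
    fix v
    obtain f where f: "\<And>n. f n \<in> D" "f \<longlonglongrightarrow> v" using dense closure_sequential UNIV_I by metis
    show "norm (\<sigma> g a \<cdot> v) \<le> norm a * norm v"
    proof (rule LIMSEQ_le)
      show "(\<lambda>n. norm (\<sigma> g a \<cdot> f n)) \<longlonglongrightarrow> norm (\<sigma> g a \<cdot> v)"
        by (intro tendsto_norm bounded_linear.tendsto[OF blinfun.bounded_linear_right] f)
      show "(\<lambda>n. norm a * norm (f n)) \<longlonglongrightarrow> norm a * norm v" by (intro tendsto_intros f)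
    qed (use le f in auto)
  qed simp
qed

end

section \<open>Crossed products\<close>

lemma crossed_unitary_nth:
  fixes g :: "'a::group_add" and \<xi> :: "('a, 'b::complex_hilbert) ell2"
  shows "ell2_nth (crossed_unitary g \<cdot> \<xi>) h = ell2_nth \<xi> (- g + h)"
proof -
  define f where "f \<xi> = Abs_ell2 (\<lambda>h. ell2_nth \<xi> (- g + h))" for \<xi> :: "('a, 'b) ell2"
  have bij: "bij (\<lambda>h. - g + h)"
    by (rule bij_betw_byWitness[where f' = "\<lambda>h. g + h"]) (auto simp flip: add.assoc)
  have nth: "ell2_nth (f \<xi>) h = ell2_nth \<xi> (- g + h)" for \<xi> h
  proof -
    have "(\<lambda>h. (norm (ell2_nth \<xi> (- g + h)))\<^sup>2) summable_on UNIV"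
      using summable_on_reindex_bij_betw[OF bij, of "\<lambda>h. (norm (ell2_nth \<xi> h))\<^sup>2"] summable_ell2 by blast
    then show ?thesis unfolding f_def by (subst Abs_ell2_inverse) auto
  qed
  have norm_f: "norm (f \<xi>) = norm \<xi>" for \<xi>
  proof -
    have "(norm (f \<xi>))\<^sup>2 = (norm \<xi>)\<^sup>2"
      unfolding norm_ell2_sq nth using infsum_reindex_bij_betw[OF bij, of "\<lambda>h. (norm (ell2_nth \<xi> h))\<^sup>2"] .
    then show ?thesis by (simp add: power2_eq_iff_nonneg)
  qed
  have "bounded_linear f"
    by (rule bounded_linear_intro[where K = 1]) (auto intro!: ell2_eqI simp: nth norm_f)
  then have "crossed_unitary g \<cdot> \<xi> = f \<xi>" for \<xi>
    unfolding crossed_unitary_def f_def by (simp add: bounded_linear_Blinfun_apply)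
  then show ?thesis by (simp add: nth)
qed

lemma crossed_unitary_BH: "crossed_unitary g \<in> BH"
  unfolding BH_def by (auto intro!: ell2_eqI simp: crossed_unitary_nth)

lemma crossed_unitary_zero [simp]: "crossed_unitary 0 = id_blinfun"
  by (rule blinfun_eqI, rule ell2_eqI) (simp add: crossed_unitary_nth)

lemma crossed_unitary_plus: "crossed_unitary (g + h) = crossed_unitary g o\<^sub>L crossed_unitary h"
  by (rule blinfun_eqI, rule ell2_eqI) (simp add: crossed_unitary_nth minus_add add.assoc del: add_uminus_conv_diff)

lemma crossed_unitary_single: "crossed_unitary g \<cdot> ell2_single h v = ell2_single (g + h) v"
  by (rule ell2_eqI) (auto simp: crossed_unitary_nth ell2_nth_single minus_add_cancel add_minus_cancel)

lemma op_adjoint_crossed_unitary: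
  "op_adjoint (crossed_unitary g) = (crossed_unitary (- g) :: ('g::group_add, 'h::complex_hilbert) ell2 operator)"
proof (rule op_adjoint_eqI)
  fix x y :: "('g, 'h) ell2"
  have bij: "bij (\<lambda>h. - g + h)"
    by (rule bij_betw_byWitness[where f' = "\<lambda>h. g + h"]) (auto simp flip: add.assoc)
  show "cinner (crossed_unitary (- g) \<cdot> x) y = cinner x (crossed_unitary g \<cdot> y)"
    unfolding cinner_ell2_def
    using infsum_reindex_bij_betw[OF bij, of "\<lambda>h. cinner (ell2_nth x (g + h)) (ell2_nth y h)"]
    by (simp add: crossed_unitary_nth flip: add.assoc)
qed

text \<open>The vector \<open>x\<close> placed at the group element \<open>g\<close>. The
  amplification index stays outermost, so that \<open>amp\<close> applies to operators on the
  crossed product space.\<close>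

definition ell2_lift :: "'g \<Rightarrow> ('j, 'h::complex_hilbert) ell2 \<Rightarrow> ('j, ('g, 'h) ell2) ell2" where
  "ell2_lift g x = Abs_ell2 (\<lambda>j. ell2_single g (ell2_nth x j))"

lemma ell2_lift_nth [simp]: "ell2_nth (ell2_lift g x) j = ell2_single g (ell2_nth x j)"
  unfolding ell2_lift_def by (subst Abs_ell2_inverse) (auto simp: summable_ell2)

lemma cinner_lift: "cinner (ell2_lift g x) (ell2_lift h y) = (if g = h then cinner x y else 0)"
  by (simp add: cinner_ell2_def[of "ell2_lift g x"] cinner_ell2_def[of x] cinner_single_left ell2_nth_single)

lemma norm_lift [simp]: "norm (ell2_lift g x) = norm x"
  using cinner_lift[of g x g x] by (simp add: cinner_same power2_eq_iff_nonneg flip: of_real_power)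

lemma ell2_lift_add: "ell2_lift g (x + y) = ell2_lift g x + ell2_lift g y"
  by (rule ell2_eqI) (simp add: ell2_single_add)

lemma ell2_lift_scaleC: "ell2_lift g (c *\<^sub>C x) = c *\<^sub>C ell2_lift g x"
  by (rule ell2_eqI) (simp add: ell2_single_scaleC)

lemma bounded_linear_lift: "bounded_linear (ell2_lift g)"
  by (rule bounded_linear_intro[where K = 1]) (auto simp: ell2_lift_add scaleR_eq_scaleC ell2_lift_scaleC)

lemma amp_restrict_lift:
  "amp (ell2_restrict S) \<cdot> ell2_lift g x = (if g \<in> S then ell2_lift g x else 0)"
  by (rule ell2_eqI, rule ell2_eqI) (auto simp: ell2_restrict_nth ell2_nth_single)

lemma amp_unitary_lift: "amp (crossed_unitary g) \<cdot> ell2_lift h x = ell2_lift (g + h) x"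
  by (rule ell2_eqI) (simp add: crossed_unitary_single)

text \<open>Both sides must be evaluated at the same approximant, so \<open>a\<close> has to
  approximate \<open>x\<close> on \<open>u\<close> and on \<open>v\<close> at once.\<close>

lemma bicommutant_identity:
  fixes u v w w' :: "('j, 'h::complex_hilbert) ell2"
  assumes A: "star_algebra A" and x: "x \<in> commutant (commutant A)"
    and eq: "\<And>a. a \<in> A \<Longrightarrow> cinner w (amp a \<cdot> u) = cinner w' (amp a \<cdot> v)"
  shows "cinner w (amp x \<cdot> u) = cinner w' (amp x \<cdot> v)"
proof -
  have "cmod (cinner w (amp x \<cdot> u) - cinner w' (amp x \<cdot> v)) \<le> 0 + e" if e: "e > 0" for e
  proof -
    define K where "K = norm w + norm w' + 1"
    have K: "K > 0" by (simp add: K_def add_nonneg_pos)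
    obtain a where a: "a \<in> A" "norm (amp (a - x) \<cdot> u) < e / K" "norm (amp (a - x) \<cdot> v) < e / K"
      using bicommutant_approx2[OF A x divide_pos_pos[OF e K]] .
    have "cinner w (amp x \<cdot> u) - cinner w' (amp x \<cdot> v) =
        cinner w' (amp (a - x) \<cdot> v) - cinner w (amp (a - x) \<cdot> u)"
      using eq[OF a(1)] by (simp add: amp_diff blinfun.diff_left cinner_diff_right)
    also have "cmod \<dots> \<le> norm w' * (e / K) + norm w * (e / K)"
      by (intro order_trans[OF norm_triangle_ineq4] add_mono order_trans[OF cmod_cinner_le] mult_left_mono)
         (use a in auto)
    also have "\<dots> = (norm w' + norm w) * (e / K)" by (rule distrib_right[symmetric])
    also have "\<dots> \<le> K * (e / K)" using K e by (intro mult_right_mono) (auto simp: K_def)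
    also have "\<dots> = e" using K by simp
    finally show ?thesis by simp
  qed
  then have "cmod (cinner w (amp x \<cdot> u) - cinner w' (amp x \<cdot> v)) \<le> 0" by (rule field_le_epsilon)
  then show ?thesis by simp
qed

context vector_action
begin

section \<open>The covariant representation of \<open>P\<close> and of the group\<close>

abbreviation emb :: "'h operator \<Rightarrow> ('g, 'h) ell2 operator" where "emb \<equiv> crossed_embed \<sigma>"
abbreviation unitary :: "'g \<Rightarrow> ('g, 'h) ell2 operator" where "unitary \<equiv> crossed_unitary"

lemma emb_diag: "emb a = diag_op (\<lambda>h. \<sigma> (- h) a)"
  by (simp add: crossed_embed_def diag_op_def)

lemma emb_nth: "a \<in> P \<Longrightarrow> ell2_nth (emb a \<cdot> \<xi>) h = \<sigma> (- h) a \<cdot> ell2_nth \<xi> h"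
  unfolding emb_diag by (rule diag_op_nth) (rule act_bounded)

lemma norm_emb_le: "a \<in> P \<Longrightarrow> norm (emb a) \<le> norm a"
  unfolding emb_diag by (rule norm_blinfun_bound) (auto intro!: norm_diag_op act_bounded)

lemma emb_BH: "a \<in> P \<Longrightarrow> emb a \<in> BH"
  unfolding emb_diag by (rule diag_op_BH) (auto intro: act_bounded mem_BH act_mem)

lemma emb_add: "a \<in> P \<Longrightarrow> b \<in> P \<Longrightarrow> emb (a + b) = emb a + emb b"
  by (rule blinfun_eqI, rule ell2_eqI)
     (simp add: emb_nth blinfun.add_left act_add star_algebraD[OF alg])

lemma emb_scaleC: "a \<in> P \<Longrightarrow> emb (op_scaleC c a) = op_scaleC c (emb a)"
  by (rule blinfun_eqI, rule ell2_eqI) (simp add: emb_nth act_scaleC star_algebraD[OF alg])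

lemma emb_compose: "a \<in> P \<Longrightarrow> b \<in> P \<Longrightarrow> emb (a o\<^sub>L b) = emb a o\<^sub>L emb b"
  by (rule blinfun_eqI, rule ell2_eqI) (simp add: emb_nth act_compose star_algebraD[OF alg])

lemma emb_id: "emb id_blinfun = id_blinfun"
  by (rule blinfun_eqI, rule ell2_eqI) (simp add: emb_nth act_id star_algebraD[OF alg])

lemma emb_adjoint: "a \<in> P \<Longrightarrow> emb (op_adjoint a) = op_adjoint (emb a)"
  unfolding emb_diag
  by (subst op_adjoint_diag_op) (auto simp: act_adjoint intro: act_bounded mem_BH act_mem)

lemma emb_single: "a \<in> P \<Longrightarrow> emb a \<cdot> ell2_single h v = ell2_single h (\<sigma> (- h) a \<cdot> v)"
  by (rule ell2_eqI) (simp add: emb_nth ell2_nth_single)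

lemma amp_emb_lift: "a \<in> P \<Longrightarrow> amp (emb a) \<cdot> ell2_lift h x = ell2_lift h (amp (\<sigma> (- h) a) \<cdot> x)"
  by (rule ell2_eqI) (simp add: emb_single)

lemma covariance: "a \<in> P \<Longrightarrow> unitary g o\<^sub>L emb a = emb (\<sigma> g a) o\<^sub>L unitary g"
  by (rule blinfun_eqI, rule ell2_eqI)
     (simp add: emb_nth crossed_unitary_nth act_mem minus_add flip: act_plus)

lemma covariance': "a \<in> P \<Longrightarrow> emb a o\<^sub>L unitary g = unitary g o\<^sub>L emb (\<sigma> (- g) a)"
  by (simp add: covariance act_mem act_inverse)

lemma conjugation: "a \<in> P \<Longrightarrow> unitary g o\<^sub>L emb a o\<^sub>L unitary (- g) = emb (\<sigma> g a)"
proof (rule blinfun_eqI)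
  fix x assume a: "a \<in> P"
  have "unitary g \<cdot> (emb a \<cdot> y) = emb (\<sigma> g a) \<cdot> (unitary g \<cdot> y)" for y
    using covariance[OF a, of g] by (metis blinfun_apply_blinfun_compose)
  moreover have "unitary g \<cdot> (unitary (- g) \<cdot> x) = x"
    using crossed_unitary_plus[of g "- g"] by (metis add.right_inverse blinfun_apply_blinfun_compose blinfun_apply_id_blinfun crossed_unitary_zero)
  ultimately show "(unitary g o\<^sub>L emb a o\<^sub>L unitary (- g)) \<cdot> x = emb (\<sigma> g a) \<cdot> x" by simp
qed

text \<open>The algebraic crossed product. Scalars are absorbed into the coefficient
  \<open>a\<close>, so sums are the only closure rule.\<close>

inductive_set span_alg :: "('g, 'h) ell2 operator set" where
  monomial: "a \<in> P \<Longrightarrow> unitary g o\<^sub>L emb a \<in> span_alg"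
| plus: "x \<in> span_alg \<Longrightarrow> y \<in> span_alg \<Longrightarrow> x + y \<in> span_alg"

lemma monomial_compose:
  assumes "a \<in> P" "b \<in> P"
  shows "(unitary g o\<^sub>L emb a) o\<^sub>L (unitary h o\<^sub>L emb b) = unitary (g + h) o\<^sub>L emb (\<sigma> (- h) a o\<^sub>L b)"
proof (rule blinfun_eqI)
  fix x
  have "emb a \<cdot> (unitary h \<cdot> y) = unitary h \<cdot> (emb (\<sigma> (- h) a) \<cdot> y)" for y
    using covariance'[OF assms(1), of h] by (metis blinfun_apply_blinfun_compose)
  then show "((unitary g o\<^sub>L emb a) o\<^sub>L (unitary h o\<^sub>L emb b)) \<cdot> x = (unitary (g + h) o\<^sub>L emb (\<sigma> (- h) a o\<^sub>L b)) \<cdot> x"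
    using assms by (simp add: crossed_unitary_plus emb_compose act_mem)
qed

lemma star_algebra_span_alg: "star_algebra span_alg"
  unfolding star_algebra_def
proof (intro conjI ballI allI subsetI)
  show BH: "x \<in> BH" if "x \<in> span_alg" for x
    using that by induction (auto intro: BH_add BH_compose crossed_unitary_BH emb_BH)
  have "unitary 0 o\<^sub>L emb id_blinfun \<in> span_alg" by (rule monomial) (rule star_algebraD(2)[OF alg])
  moreover have "unitary 0 o\<^sub>L emb id_blinfun = id_blinfun" by (rule blinfun_eqI) (simp add: emb_id)
  ultimately show "id_blinfun \<in> span_alg" by simp
  fix x assume x: "x \<in> span_alg"
  show "x + y \<in> span_alg" if "y \<in> span_alg" for y using x that by (rule plus)
  show "op_scaleC c x \<in> span_alg" for c
    using x
  proof induction
    case (monomial a g)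
    have "op_scaleC c (unitary g o\<^sub>L emb a) = unitary g o\<^sub>L emb (op_scaleC c a)"
      by (rule blinfun_eqI) (simp add: emb_scaleC monomial BH_apply_scaleC crossed_unitary_BH)
    then show ?case using monomial by (simp add: span_alg.monomial star_algebraD[OF alg])
  next
    case (plus x y)
    have "op_scaleC c (x + y) = op_scaleC c x + op_scaleC c y"
      by (rule blinfun_eqI) (simp add: blinfun.add_left scaleC_add_right)
    then show ?case using plus by (simp add: span_alg.plus)
  qed
  show "op_adjoint x \<in> span_alg"
    using x
  proof induction
    case (monomial a g)
    then have "op_adjoint (unitary g o\<^sub>L emb a) = emb (op_adjoint a) o\<^sub>L unitary (- g)"
      by (simp add: op_adjoint_compose crossed_unitary_BH emb_BH op_adjoint_crossed_unitary emb_adjoint)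
    also have "\<dots> = unitary (- g) o\<^sub>L emb (\<sigma> g (op_adjoint a))"
      using covariance'[of "op_adjoint a" "- g"] monomial by (simp add: star_algebraD[OF alg])
    finally show ?case using monomial by (simp add: span_alg.monomial act_mem star_algebraD[OF alg])
  next
    case (plus x y)
    then show ?case by (simp add: op_adjoint_add BH span_alg.plus)
  qed
  fix y assume y: "y \<in> span_alg"
  show "x o\<^sub>L y \<in> span_alg"
    using x
  proof induction
    case (monomial a g)
    show ?case using y
    proof induction
      case (monomial b h)
      then show ?case
        using \<open>a \<in> P\<close> by (simp add: monomial_compose span_alg.monomial act_mem star_algebraD[OF alg])
    next
      case (plus z w)
      have "(unitary g o\<^sub>L emb a) o\<^sub>L (z + w) = ((unitary g o\<^sub>L emb a) o\<^sub>L z) + ((unitary g o\<^sub>L emb a) o\<^sub>L w)"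
        by (rule blinfun_eqI) (simp add: blinfun.add_left blinfun.add_right)
      then show ?case using plus by (simp add: span_alg.plus)
    qed
  next
    case (plus z w)
    have "(z + w) o\<^sub>L y = (z o\<^sub>L y) + (w o\<^sub>L y)"
      by (rule blinfun_eqI) (simp add: blinfun.add_left)
    then show ?case using plus by (simp add: span_alg.plus)
  qed
qed

text \<open>A bicommutant form of the crossed product by \<open>P\<close>, to which the density
  results for \<open>span_alg\<close> apply directly.\<close>

definition full :: "('g, 'h) ell2 operator set" where
  "full = commutant (commutant span_alg)"

lemma span_alg_BH: "span_alg \<subseteq> BH"
  by (auto simp: star_algebraD[OF star_algebra_span_alg])

lemma vN_full: "von_neumann_algebra full"
  unfolding full_def
  by (rule von_neumann_algebra_bicommutant) (auto simp: star_algebraD[OF star_algebra_span_alg])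

lemma span_alg_full: "span_alg \<subseteq> full"
  unfolding full_def by (rule commutant_commutant_supset[OF span_alg_BH])

lemma emb_span_alg: "a \<in> P \<Longrightarrow> emb a \<in> span_alg"
proof -
  assume "a \<in> P"
  then have "unitary 0 o\<^sub>L emb a \<in> span_alg" by (rule monomial)
  moreover have "unitary 0 o\<^sub>L emb a = emb a" by (rule blinfun_eqI) simp
  ultimately show ?thesis by simp
qed

lemma unitary_span_alg: "unitary g \<in> span_alg"
proof -
  have "unitary g o\<^sub>L emb id_blinfun \<in> span_alg" by (rule monomial) (rule star_algebraD(2)[OF alg])
  moreover have "unitary g o\<^sub>L emb id_blinfun = unitary g" by (rule blinfun_eqI) (simp add: emb_id)
  ultimately show ?thesis by simp
qed

lemma crossed_product_subset_full: "crossed_product \<sigma> P \<subseteq> full"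
  unfolding crossed_product_def
  by (rule vN_generated_least[OF vN_full])
     (use span_alg_full emb_span_alg unitary_span_alg in auto)

section \<open>The trace vector of the crossed product\<close>

definition \<Omega>' :: "('j, ('g, 'h) ell2) ell2" where
  "\<Omega>' = ell2_lift 0 \<Omega>"

lemma amp_emb_\<Omega>: "a \<in> P \<Longrightarrow> amp (emb a) \<cdot> \<Omega>' = ell2_lift 0 (amp a \<cdot> \<Omega>)"
  by (simp add: \<Omega>'_def amp_emb_lift act_zero)

lemma amp_monomial_\<Omega>: "a \<in> P \<Longrightarrow> amp (unitary g o\<^sub>L emb a) \<cdot> \<Omega>' = ell2_lift g (amp a \<cdot> \<Omega>)"
  by (simp add: amp_compose amp_emb_\<Omega> amp_unitary_lift)

text \<open>Products of monomials contribute only when their group elements are inverse to each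
  other; then invariance under the action combines with the trace property on
  \<open>P\<close>.\<close>

lemma trace_span_alg_commute:
  assumes "x \<in> span_alg" "y \<in> span_alg"
  shows "cinner (amp (x o\<^sub>L y) \<cdot> \<Omega>') \<Omega>' = cinner (amp (y o\<^sub>L x) \<cdot> \<Omega>') \<Omega>'"
  using assms(1)
proof induction
  case (monomial a g)
  show ?case using assms(2)
  proof induction
    case (monomial b h)
    have tr: "cinner (amp (unitary k o\<^sub>L emb c) \<cdot> \<Omega>') \<Omega>' = (if k = 0 then cinner (amp c \<cdot> \<Omega>) \<Omega> else 0)"
      if "c \<in> P" for k c
      using that by (simp add: amp_monomial_\<Omega>) (simp add: \<Omega>'_def cinner_lift)
    have "cinner (amp (\<sigma> (- h) a o\<^sub>L b) \<cdot> \<Omega>) \<Omega> = cinner (amp (\<sigma> (- g) b o\<^sub>L a) \<cdot> \<Omega>) \<Omega>" if "g + h = 0"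
    proof -
      have h: "h = - g" using that by (metis minus_unique)
      have "\<sigma> (- g) (\<sigma> g a o\<^sub>L b) = a o\<^sub>L \<sigma> (- g) b"
        using \<open>a \<in> P\<close> \<open>b \<in> P\<close> by (simp add: act_compose act_mem act_inverse)
      then have "cinner (amp (\<sigma> g a o\<^sub>L b) \<cdot> \<Omega>) \<Omega> = cinner (amp (a o\<^sub>L \<sigma> (- g) b) \<cdot> \<Omega>) \<Omega>"
        using act_trace[of "\<sigma> g a o\<^sub>L b" "- g"] \<open>a \<in> P\<close> \<open>b \<in> P\<close>
        by (simp add: act_mem star_algebraD[OF alg])
      then show ?thesis using \<open>a \<in> P\<close> \<open>b \<in> P\<close> by (simp add: h trace_commute act_mem)
    qed
    moreover have "g + h = 0 \<longleftrightarrow> h + g = 0" by (metis add_eq_0_iff2 minus_unique neg_eq_iff_add_eq_0)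
    ultimately show ?case
      using \<open>a \<in> P\<close> \<open>b \<in> P\<close> by (simp add: monomial_compose tr act_mem star_algebraD[OF alg])
  next
    case (plus z w)
    have "(unitary g o\<^sub>L emb a) o\<^sub>L (z + w) = ((unitary g o\<^sub>L emb a) o\<^sub>L z) + ((unitary g o\<^sub>L emb a) o\<^sub>L w)"
      and "(z + w) o\<^sub>L (unitary g o\<^sub>L emb a) = (z o\<^sub>L (unitary g o\<^sub>L emb a)) + (w o\<^sub>L (unitary g o\<^sub>L emb a))"
      by (rule blinfun_eqI; simp add: blinfun.add_left blinfun.add_right)+
    then show ?case using plus by (simp add: amp_add blinfun.add_left cinner_add_left)
  qed
next
  case (plus z w)
  have "(z + w) o\<^sub>L y = (z o\<^sub>L y) + (w o\<^sub>L y)" and "y o\<^sub>L (z + w) = (y o\<^sub>L z) + (y o\<^sub>L w)"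
    by (rule blinfun_eqI; simp add: blinfun.add_left blinfun.add_right)+
  then show ?case using plus by (simp add: amp_add blinfun.add_left cinner_add_left)
qed

lemma amp_adjoint_move:
  fixes u v :: "('i, ('g, 'h) ell2) ell2"
  assumes "x \<in> BH"
  shows "cinner (amp (op_adjoint x) \<cdot> u) v = cinner u (amp x \<cdot> v)"
    and "cinner u (amp (op_adjoint x) \<cdot> v) = cinner (amp x \<cdot> u) v"
  using assms by (simp_all add: cinner_op_adjoint_left cinner_op_adjoint_right amp_BH flip: op_adjoint_amp)

lemma trace_span_alg:
  assumes "x \<in> span_alg" "y \<in> span_alg"
  shows "cinner (amp x \<cdot> \<Omega>') (amp y \<cdot> \<Omega>') = cinner (amp (op_adjoint y) \<cdot> \<Omega>') (amp (op_adjoint x) \<cdot> \<Omega>')"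
proof -
  note BH = star_algebraD(1)[OF star_algebra_span_alg]
  have "cinner (amp x \<cdot> \<Omega>') (amp y \<cdot> \<Omega>') = cinner (amp (op_adjoint y o\<^sub>L x) \<cdot> \<Omega>') \<Omega>'"
    using assms by (simp add: amp_compose amp_adjoint_move BH)
  also have "\<dots> = cinner (amp (x o\<^sub>L op_adjoint y) \<cdot> \<Omega>') \<Omega>'"
    by (intro trace_span_alg_commute star_algebraD[OF star_algebra_span_alg] assms)
  also have "\<dots> = cinner (amp (op_adjoint y) \<cdot> \<Omega>') (amp (op_adjoint x) \<cdot> \<Omega>')"
    using assms by (simp add: amp_compose amp_adjoint_move BH)
  finally show ?thesis .
qed

text \<open>The identity is extended in one argument at a time, so that each approximation concerns
  one operator applied to fixed vectors, as in \<open>bicommutant_identity\<close>.\<close>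

lemma trace_full:
  assumes x: "x \<in> full" and y: "y \<in> full"
  shows "cinner (amp x \<cdot> \<Omega>') (amp y \<cdot> \<Omega>') = cinner (amp (op_adjoint y) \<cdot> \<Omega>') (amp (op_adjoint x) \<cdot> \<Omega>')"
proof -
  note BHs = star_algebraD(1)[OF star_algebra_span_alg]
  note alg_full = von_neumann_algebra_star_algebra(1)[OF vN_full]
  note BHf = star_algebraD(1)[OF alg_full]
  have 1: "cinner (amp (op_adjoint z) \<cdot> \<Omega>') (amp b \<cdot> \<Omega>') = cinner (amp (op_adjoint b) \<cdot> \<Omega>') (amp z \<cdot> \<Omega>')"
    if z: "z \<in> full" and b: "b \<in> span_alg" for z b
  proof -
    have "cinner \<Omega>' (amp z \<cdot> (amp b \<cdot> \<Omega>')) = cinner (amp (op_adjoint b) \<cdot> \<Omega>') (amp z \<cdot> \<Omega>')"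
    proof (rule bicommutant_identity[OF star_algebra_span_alg z[unfolded full_def]])
      fix a assume a: "a \<in> span_alg"
      show "cinner \<Omega>' (amp a \<cdot> (amp b \<cdot> \<Omega>')) = cinner (amp (op_adjoint b) \<cdot> \<Omega>') (amp a \<cdot> \<Omega>')"
        using trace_span_alg[of "op_adjoint a" b] a b
        by (simp add: amp_adjoint_move(1) BHs star_algebraD[OF star_algebra_span_alg])
    qed
    then show ?thesis using z by (simp add: amp_adjoint_move(1) BHf)
  qed
  have x': "op_adjoint x \<in> full" by (rule star_algebraD(6)[OF alg_full x])
  have "cinner \<Omega>' (amp y \<cdot> (amp (op_adjoint x) \<cdot> \<Omega>')) = cinner (amp x \<cdot> \<Omega>') (amp y \<cdot> \<Omega>')"
  proof (rule bicommutant_identity[OF star_algebra_span_alg y[unfolded full_def]])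
    fix a assume a: "a \<in> span_alg"
    show "cinner \<Omega>' (amp a \<cdot> (amp (op_adjoint x) \<cdot> \<Omega>')) = cinner (amp x \<cdot> \<Omega>') (amp a \<cdot> \<Omega>')"
      using 1[OF x' a] a x by (simp add: amp_adjoint_move(1) BHs BHf)
  qed
  then show ?thesis using y by (simp add: amp_adjoint_move(1) BHf)
qed

text \<open>The diagonal entries \<open>\<sigma> (- h) a\<close> all lie in \<open>P\<close>, so
  they commute with \<open>m\<close>; the unitaries only permute coordinates, on which
  \<open>amp m\<close> is constant.\<close>

lemma amp_commutant:
  assumes m: "m \<in> commutant P" shows "amp m \<in> commutant span_alg"
  unfolding commutant_def
proof (intro CollectI conjI ballI)
  show "amp m \<in> BH" by (intro amp_BH commutantD[OF m])
  fix x assume "x \<in> span_alg"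
  then show "amp m o\<^sub>L x = x o\<^sub>L amp m"
  proof induction
    case (monomial a g)
    show ?case
      by (rule blinfun_eqI, rule ell2_eqI)
         (simp add: crossed_unitary_nth emb_nth monomial commutantD(2)[OF m act_mem])
  next
    case (plus x y)
    have "amp m o\<^sub>L (x + y) = (amp m o\<^sub>L x) + (amp m o\<^sub>L y)" and "(x + y) o\<^sub>L amp m = (x o\<^sub>L amp m) + (y o\<^sub>L amp m)"
      by (rule blinfun_eqI; simp add: blinfun.add_left blinfun.add_right)+
    then show ?case using plus by simp
  qed
qed

lemma full_amp_commute:
  assumes "x \<in> full" "m \<in> commutant P" shows "x \<cdot> (amp m \<cdot> v) = amp m \<cdot> (x \<cdot> v)"
  using assms(1)[unfolded full_def] amp_commutant[OF assms(2)] by (rule commutantD(2))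

sublocale crossed: trace_vector full \<Omega>'
proof
  show "von_neumann_algebra full" by (rule vN_full)
  show "cinner (amp x \<cdot> \<Omega>') (amp y \<cdot> \<Omega>') = cinner (amp (op_adjoint y) \<cdot> \<Omega>') (amp (op_adjoint x) \<cdot> \<Omega>')"
    if "x \<in> full" "y \<in> full" for x y using that by (rule trace_full)
  note alg_full = von_neumann_algebra_star_algebra(1)[OF vN_full]
  note BHf = star_algebraD(1)[OF alg_full]
  have norm_adj: "norm (amp (op_adjoint x) \<cdot> \<Omega>') = norm (amp x \<cdot> \<Omega>')" if "x \<in> full" for x
    using trace_full[OF that that] by (simp add: cinner_same power2_eq_iff_nonneg flip: of_real_power)
  fix x assume x: "x \<in> full" and zero: "amp x \<cdot> \<Omega>' = 0"
  have ug: "unitary g \<in> full" for g using unitary_span_alg span_alg_full by blast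
  \<comment> \<open>Traciality moves the vanishing to the adjoint, where the unitary acts from the
    left; moving back, \<open>x\<close> also annihilates the coordinates of \<open>\<Omega>\<close>
    placed at any \<open>g\<close>.\<close>
  have single: "x \<cdot> ell2_single g (ell2_nth \<Omega> j) = 0" for g j
  proof -
    have xu: "x o\<^sub>L unitary g \<in> full" by (intro star_algebraD[OF alg_full] x ug)
    have "norm (amp (x o\<^sub>L unitary g) \<cdot> \<Omega>') = norm (amp (unitary (- g)) \<cdot> (amp (op_adjoint x) \<cdot> \<Omega>'))"
      using norm_adj[OF xu] x
      by (simp add: op_adjoint_compose BHf crossed_unitary_BH op_adjoint_crossed_unitary amp_compose)
    also have "amp (op_adjoint x) \<cdot> \<Omega>' = 0" using norm_adj[OF x] zero by simp
    finally have "amp (x o\<^sub>L unitary g) \<cdot> \<Omega>' = 0" by simp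
    then have "ell2_nth (amp (x o\<^sub>L unitary g) \<cdot> \<Omega>') j = 0" by simp
    then show ?thesis by (simp add: \<Omega>'_def crossed_unitary_single)
  qed
  \<comment> \<open>The commutant of \<open>P\<close> spreads the vanishing of \<open>x\<close> to a
    total set at each group element, so the range of the adjoint is zero.\<close>
  have "op_adjoint x = 0"
  proof (rule blinfun_eqI, rule ell2_eqI)
    fix z g
    have "ell2_nth (op_adjoint x \<cdot> z) g = 0"
    proof (rule commutant_total)
      fix m j assume m: "m \<in> commutant P"
      have "x \<cdot> ell2_single g (m \<cdot> ell2_nth \<Omega> j) = 0"
        using full_amp_commute[OF x m, of "ell2_single g (ell2_nth \<Omega> j)"] by (simp add: amp_single single)
      then have "cinner (ell2_single g (m \<cdot> ell2_nth \<Omega> j)) (op_adjoint x \<cdot> z) = 0"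
        using x by (simp add: cinner_op_adjoint_right BHf)
      then show "cinner (m \<cdot> ell2_nth \<Omega> j) (ell2_nth (op_adjoint x \<cdot> z) g) = 0"
        by (simp add: cinner_single_left)
    qed
    then show "ell2_nth (op_adjoint x \<cdot> z) g = ell2_nth (0 \<cdot> z) g" by simp
  qed
  then show "x = 0" using op_adjoint_adjoint[OF BHf[OF x]] by simp
qed

text \<open>The Fourier coefficient belonging to the term
  \<open>unitary h o\<^sub>L emb (coeff h x)\<close> of the expansion of \<open>x\<close>. Reading
  it off the column at the unit involves no twist, since \<open>\<sigma> 0\<close> is trivial on
  \<open>P\<close>.\<close>

definition coeff :: "'g \<Rightarrow> ('g, 'h) ell2 operator \<Rightarrow> 'h operator" where
  "coeff h x = Blinfun (\<lambda>v. ell2_nth (x \<cdot> ell2_single 0 v) h)"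

lemma coeff_apply: "coeff h x \<cdot> v = ell2_nth (x \<cdot> ell2_single 0 v) h"
proof -
  have "bounded_linear (\<lambda>v. ell2_nth (x \<cdot> ell2_single 0 v) h)"
    by (rule bounded_linear_compose[OF bounded_linear_ell2_nth
          bounded_linear_compose[OF blinfun.bounded_linear_right bounded_linear_ell2_single]])
  then show ?thesis unfolding coeff_def by (simp add: bounded_linear_Blinfun_apply)
qed

text \<open>Amplified elements of the commutant of \<open>P\<close> commute with \<open>x\<close>
  and do not mix coordinates, so the coefficient lies in the bicommutant of
  \<open>P\<close>.\<close>

lemma coeff_mem:
  assumes x: "x \<in> full" shows "coeff h x \<in> P"
proof -
  have "coeff h x \<in> commutant (commutant P)"
  proof (rule commutantI)
    show "coeff h x \<in> BH"
      using x by (subst BH_def)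
        (simp add: coeff_apply ell2_single_scaleC BH_apply_scaleC star_algebraD(1)[OF crossed.alg])
    fix m v assume m: "m \<in> commutant P"
    show "coeff h x \<cdot> (m \<cdot> v) = m \<cdot> (coeff h x \<cdot> v)"
      using full_amp_commute[OF x m, of "ell2_single 0 v"] by (simp add: coeff_apply amp_single)
  qed
  then show ?thesis by (simp add: bicommutant)
qed

lemma restrict_\<Omega>: "amp (ell2_restrict {h}) \<cdot> (amp x \<cdot> \<Omega>') = ell2_lift h (amp (coeff h x) \<cdot> \<Omega>)"
  by (rule ell2_eqI, rule ell2_eqI)
     (auto simp: ell2_restrict_nth ell2_nth_single coeff_apply \<Omega>'_def)

end

section \<open>Cut-offs over the group in amplifications\<close>

lemma ell2_restrict_Compl: "x - ell2_restrict S \<cdot> x = ell2_restrict (- S) \<cdot> x"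
  by (rule ell2_eqI) (simp add: ell2_restrict_nth)

lemma amp_restrict_Compl: "x - amp (ell2_restrict S) \<cdot> x = amp (ell2_restrict (- S)) \<cdot> x"
  by (rule ell2_eqI) (simp add: ell2_restrict_Compl)

lemma norm_amp_restrict_le: "norm (amp (ell2_restrict S) \<cdot> x) \<le> norm x"
  by (rule norm_ell2_mono[where C = 1, simplified]) (simp add: norm_ell2_restrict_le)

lemma norm_amp_restrict_mono:
  "S \<subseteq> R \<Longrightarrow> norm (amp (ell2_restrict S) \<cdot> x) \<le> norm (amp (ell2_restrict R) \<cdot> x)"
  by (rule norm_ell2_mono[where C = 1, simplified])
     (auto intro!: norm_ell2_mono[where C = 1, simplified] simp: ell2_restrict_nth)

lemma amp_restrict_approx:
  fixes v :: "('j, ('g, 'h::complex_hilbert) ell2) ell2"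
  assumes "\<epsilon> > 0"
  obtains S where "finite S" "norm (amp (ell2_restrict (- S)) \<cdot> v) < \<epsilon>"
proof -
  have e2: "\<epsilon> / 2 > 0" using assms by simp
  obtain F where F: "finite F" "norm (v - ell2_restrict F \<cdot> v) < \<epsilon> / 2"
    by (rule ell2_restrict_approx[OF e2])
  \<comment> \<open>Half of \<epsilon> is spent on the amplification coordinates outside
    \<open>F\<close>, the other half is shared by those in \<open>F\<close>; the added 1 covers an
    empty \<open>F\<close>.\<close>
  define \<delta> where "\<delta> = \<epsilon> / (2 * (real (card F) + 1))"
  have "\<delta> > 0" using assms by (simp add: \<delta>_def)
  then have "\<exists>S. finite S \<and> norm (ell2_nth v j - ell2_restrict S \<cdot> ell2_nth v j) < \<delta>" for j
    using ell2_restrict_approx[of \<delta> "ell2_nth v j"] by metis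
  then have "\<exists>s. \<forall>j. finite (s j) \<and> norm (ell2_restrict (- s j) \<cdot> ell2_nth v j) < \<delta>"
    unfolding ell2_restrict_Compl by (intro choice allI)
  then obtain s where s: "\<And>j. finite (s j)" "\<And>j. norm (ell2_restrict (- s j) \<cdot> ell2_nth v j) < \<delta>"
    by blast
  define S where "S = (\<Union>j\<in>F. s j)"
  let ?R = "amp (ell2_restrict (- S))"
  have "?R \<cdot> v = ?R \<cdot> (v - ell2_restrict F \<cdot> v) + ?R \<cdot> (ell2_restrict F \<cdot> v)"
    by (simp flip: blinfun.add_right)
  also have "?R \<cdot> (ell2_restrict F \<cdot> v) = (\<Sum>j\<in>F. ell2_single j (ell2_restrict (- S) \<cdot> ell2_nth v j))"
    by (simp add: ell2_restrict_finite[OF F(1)] blinfun.sum_right amp_single)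
  finally have "norm (?R \<cdot> v) \<le> norm (?R \<cdot> (v - ell2_restrict F \<cdot> v)) +
      norm (\<Sum>j\<in>F. ell2_single j (ell2_restrict (- S) \<cdot> ell2_nth v j))"
    by (simp only: norm_triangle_ineq)
  also have "norm (?R \<cdot> (v - ell2_restrict F \<cdot> v)) < \<epsilon> / 2"
    using norm_amp_restrict_le F(2) by (rule order_le_less_trans)
  also have "norm (\<Sum>j\<in>F. ell2_single j (ell2_restrict (- S) \<cdot> ell2_nth v j)) \<le> (\<Sum>j\<in>F. \<delta>)"
  proof (rule order_trans[OF norm_sum sum_mono])
    fix j assume "j \<in> F"
    then have "norm (ell2_restrict (- S) \<cdot> ell2_nth v j) \<le> norm (ell2_restrict (- s j) \<cdot> ell2_nth v j)"
      unfolding ell2_restrict_Compl[symmetric] by (intro norm_ell2_restrict_antimono) (auto simp: S_def)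
    then show "norm (ell2_single j (ell2_restrict (- S) \<cdot> ell2_nth v j)) \<le> \<delta>"
      using s(2)[of j] by simp
  qed
  also have "(\<Sum>j\<in>F. \<delta>) \<le> \<epsilon> / 2"
    using assms by (simp add: \<delta>_def field_simps)
  finally have "norm (?R \<cdot> v) < \<epsilon>" by simp
  moreover have "finite S" using F(1) s(1) by (simp add: S_def)
  ultimately show ?thesis using that by blast
qed

section \<open>Intermediate algebras\<close>

locale intermediate_algebra = vector_action P \<Omega> \<sigma>
  for P :: "'h::complex_hilbert operator set" and \<Omega> :: "('j, 'h) ell2"
    and \<sigma> :: "'g::group_add \<Rightarrow> 'h operator \<Rightarrow> 'h operator" +
  fixes P0 :: "'h operator set" and N :: "('g, 'h) ell2 operator set"
  assumes N_vN: "von_neumann_algebra N"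
    and N_full: "N \<subseteq> full"
    and P0_subset: "P0 \<subseteq> P"
    and emb_P0: "a \<in> P0 \<Longrightarrow> emb a \<in> N"
    and unitary_N: "unitary g \<in> N"
begin

lemmas N_alg = von_neumann_algebra_star_algebra(1)[OF N_vN]

lemma full_BH: "x \<in> full \<Longrightarrow> x \<in> BH"
  by (rule star_algebraD(1)[OF crossed.alg])

lemma emb_full: "a \<in> P \<Longrightarrow> emb a \<in> full"
  using emb_span_alg span_alg_full by blast

lemma unitary_full: "unitary g \<in> full"
  using unitary_span_alg span_alg_full by blast

section \<open>The projection onto the closed orbit of \<open>N\<close>\<close>

definition L2N :: "('j, ('g, 'h) ell2) ell2 set" where
  "L2N = closure ((\<lambda>n. amp n \<cdot> \<Omega>') ` N)"

lemma L2N: "csubspace L2N" "closed L2N"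
  using csubspace_closure[OF csubspace_orbit[OF star_algebra_amp[OF N_alg], of "\<Omega>'"]]
  by (simp_all add: L2N_def image_image)

lemma amp_L2N: "n \<in> N \<Longrightarrow> amp n \<cdot> \<Omega>' \<in> L2N"
  unfolding L2N_def by (intro subsetD[OF closure_subset] imageI)

text \<open>The Jones projection of \<open>N\<close>, extended by zero to the whole amplified
  space.\<close>

definition e_N where "e_N = oproj L2N"

lemma e_N_L2N: "e_N \<cdot> x \<in> L2N"
  unfolding e_N_def by (rule oproj_works[OF L2N])

lemma e_N_orth: "w \<in> L2N \<Longrightarrow> cinner w (x - e_N \<cdot> x) = 0"
  unfolding e_N_def by (rule oproj_works[OF L2N])

lemma norm_e_N_le: "norm (e_N \<cdot> x) \<le> norm x"
  unfolding e_N_def by (rule oproj_norm_le[OF L2N])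

lemma e_N_commute: "n \<in> N \<Longrightarrow> e_N \<cdot> (amp n \<cdot> x) = amp n \<cdot> (e_N \<cdot> x)"
proof -
  assume n: "n \<in> N"
  have "e_N \<in> commutant (amp ` N)"
    unfolding e_N_def
  proof (rule oproj_commutant[OF L2N])
    show "amp ` N \<subseteq> BH" "\<And>a. a \<in> amp ` N \<Longrightarrow> op_adjoint a \<in> amp ` N"
      using star_algebraD(1,6)[OF star_algebra_amp[OF N_alg]] by (blast, blast)
    show "a \<cdot> w \<in> L2N" if "a \<in> amp ` N" "w \<in> L2N" for a w
      using closure_orbit_invariant[OF star_algebra_amp[OF N_alg] that(1), of w "\<Omega>'"] that(2)
      by (simp add: L2N_def image_image)
  qed
  then show ?thesis by (rule commutantD(2)) (use n in simp)
qed

section \<open>Conjugation by the group unitaries\<close>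

definition conj_by :: "'g \<Rightarrow> ('g, 'h) ell2 operator \<Rightarrow> ('g, 'h) ell2 operator" where
  "conj_by g x = unitary g o\<^sub>L x o\<^sub>L unitary (- g)"

lemma conj_by_N: "x \<in> N \<Longrightarrow> conj_by g x \<in> N"
  unfolding conj_by_def by (intro star_algebraD[OF N_alg] unitary_N)

lemma unitary_cancel: "unitary g \<cdot> (unitary (- g) \<cdot> x) = x" "unitary (- g) \<cdot> (unitary g \<cdot> x) = x"
  using crossed_unitary_plus[of g "- g"] crossed_unitary_plus[of "- g" g]
  by (metis add.right_inverse add.left_inverse blinfun_apply_blinfun_compose blinfun_apply_id_blinfun crossed_unitary_zero)+

lemma conj_by_inverse: "conj_by (- g) (conj_by g x) = x"
  unfolding conj_by_def by (rule blinfun_eqI) (simp add: unitary_cancel)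

lemma conj_by_diff: "conj_by g (x - y) = conj_by g x - conj_by g y"
  unfolding conj_by_def by (rule blinfun_eqI) (simp add: blinfun.diff_left blinfun.diff_right)

lemma conj_by_emb: "a \<in> P \<Longrightarrow> conj_by g (emb a) = emb (\<sigma> g a)"
  unfolding conj_by_def by (rule conjugation)

text \<open>The left unitary is isometric on all vectors. The right one becomes a left one after
  taking adjoints under the trace; once it is cancelled, the adjoints are undone.\<close>

lemma cinner_conj_by:
  assumes x: "x \<in> full" and y: "y \<in> full"
  shows "cinner (amp (conj_by g x) \<cdot> \<Omega>') (amp (conj_by g y) \<cdot> \<Omega>') = cinner (amp x \<cdot> \<Omega>') (amp y \<cdot> \<Omega>')"
proof -
  have isometry: "cinner (amp (unitary g) \<cdot> u) (amp (unitary g) \<cdot> v) = cinner u v"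
    for u v :: "('j, ('g, 'h) ell2) ell2" and g
  proof -
    have "amp (unitary (- g)) \<cdot> (amp (unitary g) \<cdot> u) = u"
      by (rule ell2_eqI) (simp add: unitary_cancel)
    then show ?thesis
      using amp_adjoint_move(1)[OF crossed_unitary_BH, of g "amp (unitary g) \<cdot> u" v]
      by (simp add: op_adjoint_crossed_unitary)
  qed
  have xu: "x o\<^sub>L unitary (- g) \<in> full" and yu: "y o\<^sub>L unitary (- g) \<in> full"
    by (intro star_algebraD[OF crossed.alg] unitary_full x y)+
  have "cinner (amp (conj_by g x) \<cdot> \<Omega>') (amp (conj_by g y) \<cdot> \<Omega>') =
      cinner (amp (x o\<^sub>L unitary (- g)) \<cdot> \<Omega>') (amp (y o\<^sub>L unitary (- g)) \<cdot> \<Omega>')"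
    by (simp add: conj_by_def amp_compose isometry)
  also have "\<dots> = cinner (amp (unitary g o\<^sub>L op_adjoint y) \<cdot> \<Omega>') (amp (unitary g o\<^sub>L op_adjoint x) \<cdot> \<Omega>')"
    using crossed.trace[OF xu yu] x y
    by (simp add: op_adjoint_compose full_BH crossed_unitary_BH op_adjoint_crossed_unitary)
  also have "\<dots> = cinner (amp (op_adjoint y) \<cdot> \<Omega>') (amp (op_adjoint x) \<cdot> \<Omega>')"
    by (simp add: amp_compose isometry)
  also have "\<dots> = cinner (amp x \<cdot> \<Omega>') (amp y \<cdot> \<Omega>')" by (rule crossed.trace[OF x y, symmetric])
  finally show ?thesis .
qed

lemma norm_conj_by: "x \<in> full \<Longrightarrow> norm (amp (conj_by g x) \<cdot> \<Omega>') = norm (amp x \<cdot> \<Omega>')"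
  using cinner_conj_by[of x x g] by (simp add: cinner_same power2_eq_iff_nonneg flip: of_real_power)

text \<open>Morally, conjugation by \<open>g\<close> is a unitary commuting with \<open>e_N\<close>.\<close>

lemma e_N_conj_by:
  assumes x: "x \<in> full" and n: "n \<in> N"
  shows "norm (e_N \<cdot> (amp (conj_by g x) \<cdot> \<Omega>') - amp (conj_by g n) \<cdot> \<Omega>') \<le>
    norm (e_N \<cdot> (amp x \<cdot> \<Omega>') - amp n \<cdot> \<Omega>')"
proof -
  define v where "v = amp (conj_by g x) \<cdot> \<Omega>'"
  define y where "y = amp (conj_by g n) \<cdot> \<Omega>'"
  define K where "K = norm (e_N \<cdot> (amp x \<cdot> \<Omega>') - amp n \<cdot> \<Omega>')"
  have yL: "y \<in> L2N" unfolding y_def by (intro amp_L2N conj_by_N n)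
  have nf: "n \<in> full" using n N_full by blast
  \<comment> \<open>To be used with \<open>t = e_N \<cdot> v\<close>. By continuity it suffices to
    test orbit vectors, which can be conjugated back.\<close>
  have le: "cmod (cinner (t - y) (v - y)) \<le> norm (t - y) * K" if t: "t \<in> L2N" for t
  proof -
    obtain f where f: "\<And>k. f k \<in> (\<lambda>n. amp n \<cdot> \<Omega>') ` N" "f \<longlonglongrightarrow> t"
      using t closure_sequential unfolding L2N_def by metis
    have "cmod (cinner (f k - y) (v - y)) \<le> norm (f k - y) * K" for k
    proof -
      obtain m where m: "m \<in> N" "f k = amp m \<cdot> \<Omega>'" using f(1)[of k] by auto
      define m' where "m' = conj_by (- g) m - n"
      have m'N: "m' \<in> N" unfolding m'_def by (intro star_algebraD[OF N_alg] conj_by_N m n)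
      then have m'f: "m' \<in> full" using N_full by blast
      have fk: "f k - y = amp (conj_by g m') \<cdot> \<Omega>'"
        using conj_by_inverse[of "- g" m]
        by (simp add: m(2) y_def m'_def conj_by_diff amp_diff blinfun.diff_left)
      have vy: "v - y = amp (conj_by g (x - n)) \<cdot> \<Omega>'"
        by (simp add: v_def y_def conj_by_diff amp_diff blinfun.diff_left)
      have xn: "x - n \<in> full" by (intro star_algebraD[OF crossed.alg] x nf)
      have "cinner (f k - y) (v - y) = cinner (amp m' \<cdot> \<Omega>') (amp (x - n) \<cdot> \<Omega>')"
        unfolding fk vy by (rule cinner_conj_by[OF m'f xn])
      \<comment> \<open>Since \<open>m'\<close> lies in \<open>N\<close>, projecting the second
        argument does not change the inner product.\<close>
      also have "\<dots> = cinner (amp m' \<cdot> \<Omega>') (e_N \<cdot> (amp x \<cdot> \<Omega>') - amp n \<cdot> \<Omega>')"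
        using e_N_orth[OF amp_L2N[OF m'N], of "amp x \<cdot> \<Omega>'"]
        by (simp add: amp_diff blinfun.diff_left cinner_diff_right)
      also have "cmod \<dots> \<le> norm (f k - y) * K"
        unfolding fk norm_conj_by[OF m'f] K_def by (rule cmod_cinner_le)
      finally show ?thesis .
    qed
    moreover have "(\<lambda>k. cmod (cinner (f k - y) (v - y))) \<longlonglongrightarrow> cmod (cinner (t - y) (v - y))"
      by (intro tendsto_norm bounded_linear.tendsto[OF bounded_linear_cinner_left] tendsto_diff f tendsto_const)
    moreover have "(\<lambda>k. norm (f k - y) * K) \<longlonglongrightarrow> norm (t - y) * K"
      by (intro tendsto_intros f)
    ultimately show ?thesis by (intro LIMSEQ_le) auto
  qed
  let ?w = "e_N \<cdot> v"
  have "?w - y \<in> L2N" by (intro csubspaceD[OF L2N(1)] e_N_L2N yL)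
  then have "cinner (?w - y) (v - ?w) = 0" by (rule e_N_orth)
  then have "cinner (?w - y) (v - y) = cinner (?w - y) (?w - y)" by (simp add: cinner_diff_right)
  then have "norm (?w - y) * norm (?w - y) = cmod (cinner (?w - y) (v - y))"
    by (simp add: cinner_same power2_eq_square norm_mult)
  also have "\<dots> \<le> K * norm (?w - y)" using le[OF e_N_L2N] by (simp add: mult.commute)
  finally have "norm (?w - y) \<le> K" by (rule norm_le_if_sq_le[rotated]) (simp add: K_def)
  then show ?thesis by (simp add: v_def y_def K_def)
qed

text \<open>Almost periodicity relative to \<open>P0\<close>, stated with vectors of the
  amplification in place of Cauchy sequences, so that \<open>e_N\<close> can be applied to the \<xi>
  once they are placed at the unit.\<close>

definition compact_vector :: "'h operator \<Rightarrow> bool" where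
  "compact_vector f \<longleftrightarrow> (\<forall>\<epsilon>>0. \<exists>(n::nat) (\<xi> :: nat \<Rightarrow> ('j, 'h) ell2) \<kappa> C.
     (\<forall>i\<in>{1..n}. \<forall>g. \<kappa> i g \<in> P0 \<and> norm (\<kappa> i g) \<le> C) \<and>
     (\<forall>g. norm (amp (\<sigma> g f) \<cdot> \<Omega> - (\<Sum>i\<in>{1..n}. amp (\<kappa> i g) \<cdot> \<xi> i)) \<le> \<epsilon>))"

text \<open>The translates \<open>\<sigma>\<^sub>g(f)\<close>, hence their projections \<open>u\<^sub>g e_N(f) u\<^sub>g\<^sup>*\<close>, are uniformly close to
  vectors supported in one finite set, while \<open>g h g\<^sup>-\<^sup>1\<close> leaves every finite set.\<close>

lemma e_N_compact_vector:
  assumes icc: "icc TYPE('g)" and f: "f \<in> P" "compact_vector f" and h: "h \<noteq> 0" and a: "a \<in> P"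
  shows "cinner (ell2_lift h (amp a \<cdot> \<Omega>)) (e_N \<cdot> ell2_lift 0 (amp f \<cdot> \<Omega>)) = 0"
proof -
  define q where "q = ell2_lift h (amp a \<cdot> \<Omega>)"
  define \<zeta> where "\<zeta> = e_N \<cdot> (amp (emb f) \<cdot> \<Omega>')"
  define b where "b = unitary h o\<^sub>L emb a"
  have q: "q = amp b \<cdot> \<Omega>'" by (simp add: q_def b_def amp_monomial_\<Omega> a)
  have bf: "b \<in> full" unfolding b_def by (intro star_algebraD[OF crossed.alg] unitary_full emb_full a)
  have "cmod (cinner q \<zeta>) \<le> norm q * (4 * \<epsilon>)" if \<epsilon>: "\<epsilon> > 0" for \<epsilon>
  proof -
    have "\<zeta> \<in> closure ((\<lambda>n. amp n \<cdot> \<Omega>') ` N)"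
      using e_N_L2N unfolding \<zeta>_def L2N_def .
    \<comment> \<open>Conjugation is defined on operators, so \<zeta> is replaced by the orbit
      vector of some \<open>n\<close> in \<open>N\<close>, at the cost of one \<epsilon>.\<close>
    then obtain n where n: "n \<in> N" "norm (\<zeta> - amp n \<cdot> \<Omega>') < \<epsilon>"
      unfolding closure_approachable dist_norm using \<epsilon> by (auto simp: norm_minus_commute)
    have nf: "n \<in> full" using n N_full by blast
    obtain m :: nat and \<xi> :: "nat \<Rightarrow> ('j, 'h) ell2" and \<kappa> C
      where *: "(\<forall>i\<in>{1..m}. \<forall>g. \<kappa> i g \<in> P0 \<and> norm (\<kappa> i g) \<le> C) \<and>
        (\<forall>g. norm (amp (\<sigma> g f) \<cdot> \<Omega> - (\<Sum>i\<in>{1..m}. amp (\<kappa> i g) \<cdot> \<xi> i)) \<le> \<epsilon>)"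
      using f(2)[unfolded compact_vector_def, rule_format, OF \<epsilon>] by (elim exE) (rule that)
    have \<kappa>: "\<kappa> i g \<in> P0" "norm (\<kappa> i g) \<le> C" if "i \<in> {1..m}" for i g
      using * that by auto
    have approx: "norm (amp (\<sigma> g f) \<cdot> \<Omega> - (\<Sum>i\<in>{1..m}. amp (\<kappa> i g) \<cdot> \<xi> i)) \<le> \<epsilon>" for g
      using * by blast
    define \<eta> where "\<eta> i = e_N \<cdot> ell2_lift 0 (\<xi> i)" for i
    \<comment> \<open>Chosen so that \<open>m\<close> terms, each enlarged by at most
      \<open>\<bar>C\<bar> + 1\<close>, add up to at most \<epsilon>; the added ones prevent
      division by zero.\<close>
    define \<delta> where "\<delta> = \<epsilon> / ((\<bar>C\<bar> + 1) * (real m + 1))"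
    have "\<delta> > 0" unfolding \<delta>_def using \<epsilon> by (intro divide_pos_pos mult_pos_pos) auto
    then have "\<exists>S. finite S \<and> norm (amp (ell2_restrict (- S)) \<cdot> \<eta> i) < \<delta>" for i
      using amp_restrict_approx[of \<delta> "\<eta> i"] by metis
    then obtain s where s: "\<And>i. finite (s i)" "\<And>i. norm (amp (ell2_restrict (- s i)) \<cdot> \<eta> i) < \<delta>" by metis
    define S where "S = (\<Union>i\<in>{1..m}. s i)"
    have "finite S" using s(1) by (simp add: S_def)
    moreover have "infinite (conjugacy_class h)" using icc h by (simp add: icc_def)
    \<comment> \<open>The finite set \<open>S\<close> was fixed before \<open>g\<close>, so
      \<open>g\<close> may be chosen to move \<open>h\<close> out of it.\<close>
    ultimately obtain k where k: "k \<in> conjugacy_class h" "k \<notin> S" by (meson finite_subset subsetI)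
    then obtain g where g: "k = g + h + - g" by (auto simp: conjugacy_class_def)
    let ?R = "amp (ell2_restrict (- S)) :: ('j, ('g, 'h) ell2) ell2 operator"
    define y where "y = amp (conj_by g n) \<cdot> \<Omega>'"
    define x where "x = amp (emb (\<sigma> g f)) \<cdot> \<Omega>'"
    define z where "z = (\<Sum>i\<in>{1..m}. amp (emb (\<kappa> i g)) \<cdot> ell2_lift 0 (\<xi> i))"
    have \<kappa>P: "\<kappa> i g \<in> P" if "i \<in> {1..m}" for i using \<kappa>(1)[OF that] P0_subset by blast
    \<comment> \<open>\<open>y\<close> is compared with \<open>e_N \<cdot> x\<close> and then with
      \<open>e_N \<cdot> z\<close>; outside \<open>S\<close> each of the three contributions is at
      most \<epsilon>.\<close>
    have 1: "norm (?R \<cdot> (y - e_N \<cdot> x)) \<le> \<epsilon>"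
    proof -
      have "norm (y - e_N \<cdot> x) \<le> norm (\<zeta> - amp n \<cdot> \<Omega>')"
        using e_N_conj_by[OF emb_full[OF f(1)] n(1), of g] f(1)
        by (simp add: \<zeta>_def y_def x_def conj_by_emb norm_minus_commute)
      then show ?thesis using n(2) norm_amp_restrict_le[of "- S" "y - e_N \<cdot> x"] by linarith
    qed
    have 2: "norm (?R \<cdot> (e_N \<cdot> (x - z))) \<le> \<epsilon>"
    proof -
      have "x - z = ell2_lift 0 (amp (\<sigma> g f) \<cdot> \<Omega> - (\<Sum>i\<in>{1..m}. amp (\<kappa> i g) \<cdot> \<xi> i))"
      proof -
        have "z = (\<Sum>i\<in>{1..m}. ell2_lift 0 (amp (\<kappa> i g) \<cdot> \<xi> i))"
          unfolding z_def by (intro sum.cong refl) (use \<kappa>P in \<open>simp add: amp_emb_lift act_zero\<close>)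
        then show ?thesis
          unfolding x_def using f(1)
          by (simp add: amp_emb_\<Omega> act_mem linear_diff[OF bounded_linear.linear[OF bounded_linear_lift]]
              linear_sum[OF bounded_linear.linear[OF bounded_linear_lift]])
      qed
      then have "norm (x - z) \<le> \<epsilon>" using approx[of g] by simp
      then show ?thesis
        using norm_amp_restrict_le[of "- S" "e_N \<cdot> (x - z)"] norm_e_N_le[of "x - z"] by linarith
    qed
    have 3: "norm (?R \<cdot> (e_N \<cdot> z)) \<le> \<epsilon>"
    proof -
      \<comment> \<open>The embedded coefficients belong to \<open>N\<close>, hence commute with
        \<open>e_N\<close>; they are diagonal over the group, hence commute with
        \<open>?R\<close>.\<close>
      have "?R \<cdot> (e_N \<cdot> z) = (\<Sum>i\<in>{1..m}. amp (emb (\<kappa> i g)) \<cdot> (?R \<cdot> \<eta> i))"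
      proof -
        have "?R \<cdot> (amp (emb c) \<cdot> v) = amp (emb c) \<cdot> (?R \<cdot> v)" if "c \<in> P" for c v
          by (rule ell2_eqI, rule ell2_eqI) (simp add: ell2_restrict_nth emb_nth that)
        then show ?thesis
          unfolding z_def blinfun.sum_right \<eta>_def
          by (intro sum.cong refl) (use \<kappa>P emb_P0[OF \<kappa>(1)] in \<open>simp add: e_N_commute\<close>)
      qed
      also have "norm \<dots> \<le> (\<Sum>i\<in>{1..m}. (\<bar>C\<bar> + 1) * \<delta>)"
      proof (rule order_trans[OF norm_sum sum_mono])
        fix i assume i: "i \<in> {1..m}"
        have "norm (?R \<cdot> \<eta> i) \<le> norm (amp (ell2_restrict (- s i)) \<cdot> \<eta> i)"
          by (intro norm_amp_restrict_mono) (use i in \<open>auto simp: S_def\<close>)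
        then have "norm (?R \<cdot> \<eta> i) \<le> \<delta>" using s(2)[of i] by linarith
        moreover have "norm (emb (\<kappa> i g)) \<le> \<bar>C\<bar> + 1"
          using norm_emb_le[OF \<kappa>P[OF i]] \<kappa>(2)[OF i, of g] by linarith
        ultimately have "norm (emb (\<kappa> i g)) * norm (?R \<cdot> \<eta> i) \<le> (\<bar>C\<bar> + 1) * \<delta>"
          by (intro mult_mono) auto
        then show "norm (amp (emb (\<kappa> i g)) \<cdot> (?R \<cdot> \<eta> i)) \<le> (\<bar>C\<bar> + 1) * \<delta>"
          using norm_amp_apply_le order_trans by blast
      qed
      also have "\<dots> = real m * (\<epsilon> / (real m + 1))"
        by (simp add: \<delta>_def)
      also have "\<dots> \<le> \<epsilon>" using \<epsilon> by (simp add: field_simps)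
      finally show ?thesis .
    qed
    have "?R \<cdot> y = ?R \<cdot> (y - e_N \<cdot> x) + ?R \<cdot> (e_N \<cdot> (x - z)) + ?R \<cdot> (e_N \<cdot> z)"
      by (simp add: blinfun.diff_right)
    also have "norm \<dots> \<le> \<epsilon> + \<epsilon> + \<epsilon>"
      by (intro order_trans[OF norm_triangle_ineq] add_mono 1 2 3)
    finally have Ry: "norm (?R \<cdot> y) \<le> 3 * \<epsilon>" by simp
    define q' where "q' = amp (conj_by g b) \<cdot> \<Omega>'"
    have "conj_by g b = unitary k o\<^sub>L emb (\<sigma> g a)"
    proof (rule blinfun_eqI)
      fix v
      have "emb a \<cdot> (unitary (- g) \<cdot> v) = unitary (- g) \<cdot> (emb (\<sigma> g a) \<cdot> v)"
        using arg_cong[OF covariance'[OF a, of "- g"], of "\<lambda>T. T \<cdot> v"] by simp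
      then show "conj_by g b \<cdot> v = (unitary k o\<^sub>L emb (\<sigma> g a)) \<cdot> v"
        by (simp add: conj_by_def b_def g crossed_unitary_plus del: add_uminus_conv_diff)
    qed
    then have q': "q' = ell2_lift k (amp (\<sigma> g a) \<cdot> \<Omega>)"
      unfolding q'_def using a by (simp add: amp_monomial_\<Omega> act_mem)
    \<comment> \<open>Conjugation preserves the inner product and moves \<open>q\<close> from
      \<open>h\<close> to \<open>k\<close>, outside \<open>S\<close>, where \<open>y\<close> is
      small.\<close>
    have "cinner q (amp n \<cdot> \<Omega>') = cinner q' y"
      unfolding q q'_def y_def by (rule cinner_conj_by[OF bf nf, symmetric])
    also have "\<dots> = cinner (?R \<cdot> q') y" unfolding q' using k(2) by (simp add: amp_restrict_lift)
    also have "\<dots> = cinner q' (?R \<cdot> y)"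
      using amp_adjoint_move(1)[OF ell2_restrict_BH, of "- S" q' y] by (simp add: op_adjoint_ell2_restrict)
    finally have "cmod (cinner q (amp n \<cdot> \<Omega>')) \<le> norm q' * norm (?R \<cdot> y)" by (simp add: cmod_cinner_le)
    also have "norm q' = norm q" unfolding q' q_def using a by (simp add: act_norm2)
    also have "norm q * norm (?R \<cdot> y) \<le> norm q * (3 * \<epsilon>)" by (intro mult_left_mono Ry norm_ge_zero)
    finally have "cmod (cinner q (amp n \<cdot> \<Omega>')) \<le> norm q * (3 * \<epsilon>)" .
    moreover have "cmod (cinner q (\<zeta> - amp n \<cdot> \<Omega>')) \<le> norm q * \<epsilon>"
      by (rule order_trans[OF cmod_cinner_le]) (use n(2) in \<open>intro mult_left_mono, auto\<close>)
    moreover have "cinner q \<zeta> = cinner q (amp n \<cdot> \<Omega>') + cinner q (\<zeta> - amp n \<cdot> \<Omega>')"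
      by (simp add: cinner_diff_right)
    then have "cmod (cinner q \<zeta>) \<le> cmod (cinner q (amp n \<cdot> \<Omega>')) + cmod (cinner q (\<zeta> - amp n \<cdot> \<Omega>'))"
      by (simp add: norm_triangle_ineq)
    ultimately show ?thesis by linarith
  qed
  note le = this
  have "cmod (cinner q \<zeta>) \<le> 0 + e" if "e > 0" for e
  proof -
    define K where "K = norm q + 1"
    have K: "K > 0" "norm q \<le> K" using norm_ge_zero[of q] by (simp_all add: K_def add_nonneg_pos)
    have "cmod (cinner q \<zeta>) \<le> norm q * (4 * (e / (4 * K)))"
      by (rule le) (use K that in simp)
    also have "\<dots> = norm q * (e / K)" by simp
    also have "\<dots> \<le> K * (e / K)" using K that by (intro mult_right_mono) auto
    also have "\<dots> = e" using K by simp
    finally show ?thesis by simp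
  qed
  then have "cmod (cinner q \<zeta>) \<le> 0" by (rule field_le_epsilon)
  then show ?thesis using f(1) by (simp add: q_def \<zeta>_def amp_emb_\<Omega>)
qed

end

text \<open>\<open>e_N_diagonal\<close> says that \<open>e_N\<close> maps the copy of L2(P) at the
  unit to vectors orthogonal to its copies at the other group elements. It is what the
  identification of \<open>N\<close> takes from compactness and icc.\<close>

locale compact_intermediate_algebra = intermediate_algebra P \<Omega> \<sigma> P0 N
  for P :: "'h::complex_hilbert operator set" and \<Omega> :: "('j, 'h) ell2"
    and \<sigma> :: "'g::group_add \<Rightarrow> 'h operator \<Rightarrow> 'h operator" and P0 N +
  assumes e_N_diagonal: "h \<noteq> 0 \<Longrightarrow> a \<in> P \<Longrightarrow> f \<in> P \<Longrightarrow>
    cinner (ell2_lift h (amp a \<cdot> \<Omega>)) (e_N \<cdot> ell2_lift 0 (amp f \<cdot> \<Omega>)) = 0"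
begin

text \<open>With \<open>E\<close> the restriction to the unit, \<open>e_N E = E e_N E\<close> says that \<open>e_N\<close> and \<open>E\<close>
  commute, so that \<open>E\<close> maps \<open>N\<close> to \<open>N\<close>.\<close>

lemma emb_coeff_zero_mem:
  assumes x: "x \<in> N" shows "emb (coeff 0 x) \<in> N"
proof -
  have xf: "x \<in> full" using x N_full by blast
  define c where "c = coeff 0 x"
  have c: "c \<in> P" unfolding c_def by (rule coeff_mem[OF xf])
  define v where "v = amp x \<cdot> \<Omega>'"
  define w where "w = ell2_lift (0::'g) (amp c \<cdot> \<Omega>)"
  \<comment> \<open>The aim is \<open>d = 0\<close>, that is, \<open>w\<close> in
    \<open>L2N\<close>. As \<open>d\<close> is orthogonal to \<open>L2N\<close>, which contains
    \<open>v\<close>, it suffices that \<open>d\<close> is orthogonal to \<open>v - w\<close>, the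
    part of \<open>v\<close> away from the unit.\<close>
  define d where "d = w - e_N \<cdot> w"
  let ?T = "amp (ell2_restrict (- {0})) :: ('j, ('g, 'h) ell2) ell2 operator"
  have w: "w = amp (ell2_restrict {0}) \<cdot> v" by (simp add: w_def v_def c_def restrict_\<Omega>)
  have vw: "v - w = ?T \<cdot> v" unfolding w by (rule amp_restrict_Compl)
  have zero: "cinner (?T \<cdot> (amp b \<cdot> \<Omega>')) d = 0" if "b \<in> span_alg" for b
    using that
  proof induction
    case (monomial a g)
    then show ?case
      using e_N_diagonal[OF _ monomial c, of g]
      by (simp add: amp_monomial_\<Omega> amp_restrict_lift d_def w_def cinner_diff_right cinner_lift)
  next
    case (plus y z)
    then show ?case by (simp add: amp_add blinfun.add_left blinfun.add_right cinner_add_left)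
  qed
  have "cinner (?T \<cdot> v) d = 0"
  proof -
    have "v \<in> closure ((\<lambda>b. amp b \<cdot> \<Omega>') ` span_alg)"
      unfolding v_def by (rule bicommutant_amp_orbit[OF star_algebra_span_alg xf[unfolded full_def]])
    then obtain f where f: "\<And>n. f n \<in> (\<lambda>b. amp b \<cdot> \<Omega>') ` span_alg" "f \<longlonglongrightarrow> v"
      using closure_sequential by metis
    have "(\<lambda>n. cinner (?T \<cdot> f n) d) \<longlonglongrightarrow> cinner (?T \<cdot> v) d"
      by (intro bounded_linear.tendsto[OF bounded_linear_cinner_left]
          bounded_linear.tendsto[OF blinfun.bounded_linear_right] f)
    moreover have "cinner (?T \<cdot> f n) d = 0" for n using f(1)[of n] zero by auto
    ultimately show ?thesis by (simp add: LIMSEQ_const_iff)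
  qed
  moreover have "cinner v d = 0" unfolding d_def v_def by (intro e_N_orth amp_L2N x)
  ultimately have "cinner w d = 0" unfolding vw[symmetric] by (simp add: cinner_diff_left)
  moreover have "cinner (e_N \<cdot> w) d = 0" unfolding d_def by (intro e_N_orth e_N_L2N)
  ultimately have "cinner d d = 0" unfolding d_def by (simp add: cinner_diff_left)
  then have "w \<in> L2N" using e_N_L2N[of w] by (simp add: cinner_same d_def)
  then have "amp (emb c) \<cdot> \<Omega>' \<in> closure ((\<lambda>n. amp n \<cdot> \<Omega>') ` N)"
    by (simp add: w_def amp_emb_\<Omega> c L2N_def)
  then show ?thesis
    unfolding c_def[symmetric] by (rule crossed.mem_subalgebra[OF N_vN N_full emb_full[OF c]])
qed

text \<open>Left multiplication by \<open>unitary (- h)\<close> stays in \<open>N\<close> and shifts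
  the coefficient at \<open>h\<close> to the unit.\<close>

lemma emb_coeff_mem:
  assumes x: "x \<in> N" shows "emb (coeff h x) \<in> N"
proof -
  have "coeff 0 (unitary (- h) o\<^sub>L x) = coeff h x"
    by (rule blinfun_eqI) (simp add: coeff_apply crossed_unitary_nth)
  moreover have "unitary (- h) o\<^sub>L x \<in> N" by (intro star_algebraD[OF N_alg] unitary_N x)
  ultimately show ?thesis using emb_coeff_zero_mem by metis
qed

section \<open>The intermediate algebra cut out by \<open>N\<close>\<close>

definition Q where "Q = {a \<in> P. emb a \<in> N}"

lemma star_algebra_Q: "star_algebra Q"
  unfolding star_algebra_def Q_def
  using star_algebraD[OF alg] star_algebraD[OF N_alg]
  by (auto simp: emb_add emb_compose emb_scaleC emb_adjoint emb_id)

text \<open>An element of the bicommutant is approximated by \<open>Q\<close> on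
  \<open>\<Omega>\<close>. Placed at the unit, this is an approximation by \<open>N\<close> on the
  trace vector, and \<open>mem_subalgebra\<close> yields membership in \<open>N\<close>.\<close>

lemma von_neumann_algebra_Q: "von_neumann_algebra Q"
  unfolding von_neumann_algebra_def
proof (intro conjI ballI equalityI)
  show QB: "Q \<subseteq> BH" by (auto simp: star_algebraD[OF star_algebra_Q])
  show "op_adjoint a \<in> Q" if "a \<in> Q" for a using that by (rule star_algebraD(6)[OF star_algebra_Q])
  show "Q \<subseteq> commutant (commutant Q)" by (rule commutant_commutant_supset[OF QB])
  show "commutant (commutant Q) \<subseteq> Q"
  proof
    fix a assume a: "a \<in> commutant (commutant Q)"
    have "commutant (commutant Q) \<subseteq> commutant (commutant P)"
      by (intro commutant_antimono) (auto simp: Q_def)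
    then have aP: "a \<in> P" using a bicommutant by auto
    have "amp a \<cdot> \<Omega> \<in> closure ((\<lambda>b. amp b \<cdot> \<Omega>) ` Q)"
      by (rule bicommutant_amp_orbit[OF star_algebra_Q a])
    then obtain f where f: "\<And>n. f n \<in> (\<lambda>b. amp b \<cdot> \<Omega>) ` Q" "f \<longlonglongrightarrow> amp a \<cdot> \<Omega>"
      using closure_sequential by metis
    have "(\<lambda>n. ell2_lift 0 (f n)) \<longlonglongrightarrow> ell2_lift (0::'g) (amp a \<cdot> \<Omega>)"
      by (rule bounded_linear.tendsto[OF bounded_linear_lift f(2)])
    then have "ell2_lift 0 (amp a \<cdot> \<Omega>) \<in> closure ((\<lambda>n. amp n \<cdot> \<Omega>') ` N)"
    proof (rule closure_sequentialI[rotated])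
      fix n
      obtain b where b: "b \<in> Q" "f n = amp b \<cdot> \<Omega>" using f(1)[of n] by auto
      then show "ell2_lift 0 (f n) \<in> (\<lambda>n. amp n \<cdot> \<Omega>') ` N"
        by (intro image_eqI[where x = "emb b"]) (auto simp: Q_def amp_emb_\<Omega>)
    qed
    then have "emb a \<in> N"
      by (intro crossed.mem_subalgebra[OF N_vN N_full emb_full[OF aP]]) (simp add: amp_emb_\<Omega> aP)
    then show "a \<in> Q" using aP by (simp add: Q_def)
  qed
qed

text \<open>The action is implemented by unitaries of \<open>N\<close>, so conjugation by them
  preserves \<open>N\<close>; the inverse group element gives surjectivity.\<close>

lemma act_Q: "\<sigma> g ` Q = Q"
proof -
  have sub: "\<sigma> g a \<in> Q" if "a \<in> Q" for a g
    using that conj_by_N[of "emb a" g] by (auto simp: Q_def act_mem conj_by_emb)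
  have "a \<in> \<sigma> g ` Q" if "a \<in> Q" for a
    using sub[OF that, of "- g"] that by (intro image_eqI[where x = "\<sigma> (- g) a"]) (auto simp: Q_def act_inverse)
  then show ?thesis using sub by auto
qed

lemma N_eq_crossed_product: "N = crossed_product \<sigma> Q"
proof
  have gen: "emb ` Q \<union> range unitary \<subseteq> N" using unitary_N by (auto simp: Q_def)
  show sub: "crossed_product \<sigma> Q \<subseteq> N"
    unfolding crossed_product_def by (rule vN_generated_least[OF N_vN gen])
  have vN': "von_neumann_algebra (crossed_product \<sigma> Q)"
    unfolding crossed_product_def by (rule von_neumann_algebra_vN_generated[OF N_vN gen])
  note alg' = von_neumann_algebra_star_algebra(1)[OF vN']
  have gen': "emb ` Q \<union> range unitary \<subseteq> crossed_product \<sigma> Q"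
    unfolding crossed_product_def by (rule vN_generated_supset)
  show "N \<subseteq> crossed_product \<sigma> Q"
  proof
    fix x assume x: "x \<in> N"
    then have xf: "x \<in> full" using N_full by blast
    define v where "v = amp x \<cdot> \<Omega>'"
    have "v \<in> closure ((\<lambda>n. amp n \<cdot> \<Omega>') ` crossed_product \<sigma> Q)"
      unfolding closure_approachable
    proof (intro allI impI)
      fix e :: real assume "e > 0"
      then obtain S where S: "finite S" "norm (amp (ell2_restrict (- S)) \<cdot> v) < e"
        by (rule amp_restrict_approx)
      \<comment> \<open>A partial sum of the Fourier series of \<open>x\<close>. Such sums converge
        in the 2-norm, which is enough to test membership, while their operator norms need not stay
        bounded.\<close>
      define y where "y = (\<Sum>h\<in>S. unitary h o\<^sub>L emb (coeff h x))"
      have "emb (coeff h x) \<in> crossed_product \<sigma> Q" for h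
        using gen' emb_coeff_mem[OF x, of h] coeff_mem[OF xf, of h] by (auto simp: Q_def)
      then have "y \<in> crossed_product \<sigma> Q"
        unfolding y_def using gen' by (intro star_algebra_sum[OF alg'] star_algebraD(4)[OF alg']) auto
      then have "amp y \<cdot> \<Omega>' \<in> (\<lambda>n. amp n \<cdot> \<Omega>') ` crossed_product \<sigma> Q" by (rule imageI)
      moreover have "amp y \<cdot> \<Omega>' = (\<Sum>h\<in>S. amp (ell2_restrict {h}) \<cdot> v)"
        by (simp add: y_def v_def amp_sum blinfun.sum_left amp_monomial_\<Omega> coeff_mem[OF xf] restrict_\<Omega>)
      moreover have "(\<Sum>h\<in>S. amp (ell2_restrict {h}) \<cdot> v) = amp (ell2_restrict S) \<cdot> v"
        using S(1) by (intro ell2_eqI) (simp add: ell2_nth_sum ell2_restrict_nth if_distrib cong: if_cong)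
      moreover have "dist (amp (ell2_restrict S) \<cdot> v) v < e"
        using S(2) by (simp add: dist_norm norm_minus_commute flip: amp_restrict_Compl)
      ultimately show "\<exists>y\<in>(\<lambda>n. amp n \<cdot> \<Omega>') ` crossed_product \<sigma> Q. dist y v < e"
        by (intro bexI[of _ "amp y \<cdot> \<Omega>'"]) simp_all
    qed
    then show "x \<in> crossed_product \<sigma> Q"
      unfolding v_def
      by (rule crossed.mem_subalgebra[OF vN' order_trans[OF sub N_full] xf])
  qed
qed

end

section \<open>Compact extensions\<close>

context vector_action
begin

context
  fixes \<tau> :: "'h operator \<Rightarrow> complex"
  assumes norm2: "\<And>a. a \<in> P \<Longrightarrow> norm2 \<tau> a = norm (amp a \<cdot> \<Omega>)"
begin

lemma L2_limit:
  assumes "\<xi> \<in> L2 P \<tau>"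
  shows "\<exists>x. (\<lambda>k. amp (\<xi> k) \<cdot> \<Omega>) \<longlonglongrightarrow> x"
proof -
  have \<xi>: "\<xi> k \<in> P" for k using assms by (auto simp: L2_def)
  have "Cauchy (\<lambda>k. amp (\<xi> k) \<cdot> \<Omega>)"
  proof (rule CauchyI)
    fix e :: real assume "e > 0"
    moreover have "\<forall>e>0. \<exists>N. \<forall>m\<ge>N. \<forall>n\<ge>N. norm2 \<tau> (\<xi> m - \<xi> n) < e"
      using assms by (simp add: L2_def)
    ultimately have "\<exists>N. \<forall>m\<ge>N. \<forall>n\<ge>N. norm2 \<tau> (\<xi> m - \<xi> n) < e" by simp
    then obtain K where K: "\<forall>m\<ge>K. \<forall>n\<ge>K. norm2 \<tau> (\<xi> m - \<xi> n) < e" ..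
    have "norm (amp (\<xi> m) \<cdot> \<Omega> - amp (\<xi> n) \<cdot> \<Omega>) < e" if "m \<ge> K" "n \<ge> K" for m n
      using K[rule_format, OF that] \<xi> by (simp add: norm2 star_algebraD(8)[OF alg] amp_diff blinfun.diff_left)
    then show "\<exists>M. \<forall>m\<ge>M. \<forall>n\<ge>M. norm (amp (\<xi> m) \<cdot> \<Omega> - amp (\<xi> n) \<cdot> \<Omega>) < e" by blast
  qed
  then show ?thesis by (simp add: Cauchy_convergent_iff convergent_def)
qed

text \<open>The 2-norm is that of orbit vectors and left multiplication by \<kappa> is continuous on
  the amplification, so the limit in \<open>L2_norm\<close> is the norm of an actual vector.\<close>

lemma L2_norm_eq:
  assumes c: "c \<in> P" and \<kappa>: "\<And>i. i \<in> I \<Longrightarrow> \<kappa> i \<in> P" and \<xi>: "\<And>i k. i \<in> I \<Longrightarrow> \<xi> i k \<in> P"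
    and lim: "\<And>i. i \<in> I \<Longrightarrow> (\<lambda>k. amp (\<xi> i k) \<cdot> \<Omega>) \<longlonglongrightarrow> x i"
  shows "L2_norm \<tau> (\<lambda>k. c - (\<Sum>i\<in>I. \<kappa> i o\<^sub>L \<xi> i k)) = norm (amp c \<cdot> \<Omega> - (\<Sum>i\<in>I. amp (\<kappa> i) \<cdot> x i))"
  unfolding L2_norm_def
proof (rule limI)
  have "norm2 \<tau> (c - (\<Sum>i\<in>I. \<kappa> i o\<^sub>L \<xi> i k)) =
      norm (amp c \<cdot> \<Omega> - (\<Sum>i\<in>I. amp (\<kappa> i) \<cdot> (amp (\<xi> i k) \<cdot> \<Omega>)))" for k
  proof -
    have "c - (\<Sum>i\<in>I. \<kappa> i o\<^sub>L \<xi> i k) \<in> P"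
      by (intro star_algebraD(8)[OF alg] star_algebra_sum[OF alg] star_algebraD(4)[OF alg] c \<kappa> \<xi>)
    then show ?thesis
      by (simp add: norm2 amp_diff amp_sum amp_compose blinfun.diff_left blinfun.sum_left)
  qed
  moreover have "(\<lambda>k. norm (amp c \<cdot> \<Omega> - (\<Sum>i\<in>I. amp (\<kappa> i) \<cdot> (amp (\<xi> i k) \<cdot> \<Omega>)))) \<longlonglongrightarrow>
      norm (amp c \<cdot> \<Omega> - (\<Sum>i\<in>I. amp (\<kappa> i) \<cdot> x i))"
    by (intro tendsto_norm tendsto_diff tendsto_const tendsto_sum
        bounded_linear.tendsto[OF blinfun.bounded_linear_right] lim)
  ultimately show "(\<lambda>k. norm2 \<tau> (c - (\<Sum>i\<in>I. \<kappa> i o\<^sub>L \<xi> i k))) \<longlonglongrightarrow>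
      norm (amp c \<cdot> \<Omega> - (\<Sum>i\<in>I. amp (\<kappa> i) \<cdot> x i))" by simp
qed

lemma L2_dense:
  assumes F: "F \<subseteq> P"
    and dense: "\<And>\<xi> \<epsilon>. \<xi> \<in> L2 P \<tau> \<Longrightarrow> \<epsilon> > 0 \<Longrightarrow> \<exists>a\<in>op_cspan F. L2_norm \<tau> (\<lambda>k. \<xi> k - a) < \<epsilon>"
    and f: "f \<in> P" and "\<epsilon> > 0"
  obtains A c where "finite A" "A \<subseteq> F" "norm (amp f \<cdot> \<Omega> - (\<Sum>a\<in>A. c a *\<^sub>C (amp a \<cdot> \<Omega>))) < \<epsilon>"
proof -
  have "norm2 \<tau> 0 = 0" using norm2[OF star_algebraD(9)[OF alg]] by simp
  then have "(\<lambda>_. f) \<in> L2 P \<tau>" using f by (auto simp: L2_def)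
  then obtain b where b: "b \<in> op_cspan F" "L2_norm \<tau> (\<lambda>_. f - b) < \<epsilon>"
    using dense[of "\<lambda>_. f"] \<open>\<epsilon> > 0\<close> by blast
  then obtain A c where A: "finite A" "A \<subseteq> F" "b = (\<Sum>a\<in>A. op_scaleC (c a) a)"
    by (auto simp: op_cspan_def)
  have "b \<in> P" unfolding A(3) using A(2) F by (intro star_algebra_sum[OF alg] star_algebraD(5)[OF alg]) auto
  then have "f - b \<in> P" by (rule star_algebraD(8)[OF alg f])
  then have "L2_norm \<tau> (\<lambda>_. f - b) = norm (amp (f - b) \<cdot> \<Omega>)"
    by (simp add: L2_norm_def norm2)
  also have "amp (f - b) \<cdot> \<Omega> = amp f \<cdot> \<Omega> - (\<Sum>a\<in>A. c a *\<^sub>C (amp a \<cdot> \<Omega>))"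
    by (simp add: A(3) amp_diff amp_sum amp_scaleC blinfun.diff_left blinfun.sum_left)
  finally show ?thesis using that[OF A(1,2)] b(2) by simp
qed

end

end

text \<open>The sequences \<xi> are replaced by the limits of their orbit vectors, which do not
  depend on \<open>g\<close>, so the estimate stays uniform.\<close>

lemma (in intermediate_algebra) compact_vectorI:
  assumes norm2: "\<And>a. a \<in> P \<Longrightarrow> norm2 \<tau> a = norm (amp a \<cdot> \<Omega>)" and f: "f \<in> P"
    and approx: "\<And>\<epsilon>. \<epsilon> > 0 \<Longrightarrow> \<exists>(n::nat) \<xi>. (\<forall>i\<in>{1..n}. \<xi> i \<in> L2 P \<tau>) \<and>
      (\<exists>\<kappa>. (\<forall>i\<in>{1..n}. \<forall>g. \<kappa> i g \<in> P0) \<and> (\<exists>C. \<forall>i\<in>{1..n}. \<forall>g. norm (\<kappa> i g) \<le> C) \<and>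
        (\<forall>g. L2_norm \<tau> (\<lambda>k. \<sigma> g f - (\<Sum>i\<in>{1..n}. \<kappa> i g o\<^sub>L \<xi> i k)) \<le> \<epsilon>))"
  shows "compact_vector f"
  unfolding compact_vector_def
proof (intro allI impI)
  fix \<epsilon> :: real assume \<epsilon>: "\<epsilon> > 0"
  obtain n :: nat and \<xi> \<kappa> C where \<xi>: "\<forall>i\<in>{1..n}. \<xi> i \<in> L2 P \<tau>"
    and \<kappa>: "\<forall>i\<in>{1..n}. \<forall>g. \<kappa> i g \<in> P0" and C: "\<forall>i\<in>{1..n}. \<forall>g. norm (\<kappa> i g) \<le> C"
    and le: "\<forall>g. L2_norm \<tau> (\<lambda>k. \<sigma> g f - (\<Sum>i\<in>{1..n}. \<kappa> i g o\<^sub>L \<xi> i k)) \<le> \<epsilon>"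
    using approx[OF \<epsilon>] by (elim exE conjE) (rule that)
  have "\<forall>i\<in>{1..n}. \<exists>x. (\<lambda>k. amp (\<xi> i k) \<cdot> \<Omega>) \<longlonglongrightarrow> x"
    using \<xi> L2_limit[OF norm2] by blast
  then obtain x where x: "\<forall>i\<in>{1..n}. (\<lambda>k. amp (\<xi> i k) \<cdot> \<Omega>) \<longlonglongrightarrow> x i"
    unfolding bchoice_iff by blast
  have "norm (amp (\<sigma> g f) \<cdot> \<Omega> - (\<Sum>i\<in>{1..n}. amp (\<kappa> i g) \<cdot> x i)) \<le> \<epsilon>" for g
  proof -
    have "L2_norm \<tau> (\<lambda>k. \<sigma> g f - (\<Sum>i\<in>{1..n}. \<kappa> i g o\<^sub>L \<xi> i k)) =
        norm (amp (\<sigma> g f) \<cdot> \<Omega> - (\<Sum>i\<in>{1..n}. amp (\<kappa> i g) \<cdot> x i))"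
      by (rule L2_norm_eq[OF norm2]) (use act_mem[OF f] \<kappa> P0_subset \<xi> x in \<open>auto simp: L2_def image_subset_iff\<close>)
    then show ?thesis using spec[OF le, of g] by simp
  qed
  then show "\<exists>(n::nat) \<xi> \<kappa> C. (\<forall>i\<in>{1..n}. \<forall>g. \<kappa> i g \<in> P0 \<and> norm (\<kappa> i g) \<le> C) \<and>
      (\<forall>g. norm (amp (\<sigma> g f) \<cdot> \<Omega> - (\<Sum>i\<in>{1..n}. amp (\<kappa> i g) \<cdot> \<xi> i)) \<le> \<epsilon>)"
    using \<kappa> C by (intro exI[of _ n] exI[of _ x] exI[of _ \<kappa>] exI[of _ C]) simp
qed

text \<open>For fixed \<open>h\<close> and \<open>a\<close> the expression is a bounded
  conjugate-linear functional of the vector placed at the unit. It vanishes on the orbit vectors of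
  \<open>F\<close>, whose complex combinations approximate that of \<open>f\<close>.\<close>

lemma (in intermediate_algebra) e_N_diagonal_if_dense:
  assumes icc: "icc TYPE('g)" and norm2: "\<And>a. a \<in> P \<Longrightarrow> norm2 \<tau> a = norm (amp a \<cdot> \<Omega>)"
    and F: "F \<subseteq> P" "\<And>f. f \<in> F \<Longrightarrow> compact_vector f"
    and dense: "\<And>\<xi> \<epsilon>. \<xi> \<in> L2 P \<tau> \<Longrightarrow> \<epsilon> > 0 \<Longrightarrow> \<exists>a\<in>op_cspan F. L2_norm \<tau> (\<lambda>k. \<xi> k - a) < \<epsilon>"
    and h: "h \<noteq> 0" and a: "a \<in> P" and f: "f \<in> P"
  shows "cinner (ell2_lift h (amp a \<cdot> \<Omega>)) (e_N \<cdot> ell2_lift 0 (amp f \<cdot> \<Omega>)) = 0"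
proof -
  define q where "q = ell2_lift h (amp a \<cdot> \<Omega>)"
  define \<phi> where "\<phi> y = cinner q (e_N \<cdot> ell2_lift 0 y)" for y
  have e_N_BH: "e_N \<in> BH" unfolding e_N_def by (rule oproj_BH[OF L2N])
  have \<phi>_linear: "bounded_linear \<phi>"
    unfolding \<phi>_def
    by (rule bounded_linear_compose[OF bounded_linear_cinner_right
          bounded_linear_compose[OF blinfun.bounded_linear_right bounded_linear_lift]])
  have \<phi>_scaleC: "\<phi> (c *\<^sub>C y) = cnj c * \<phi> y" for c y
    by (simp add: \<phi>_def ell2_lift_scaleC BH_apply_scaleC[OF e_N_BH] cinner_scaleC_right)
  have \<phi>_F: "\<phi> (amp b \<cdot> \<Omega>) = 0" if "b \<in> F" for b
    unfolding \<phi>_def q_def by (rule e_N_compact_vector[OF icc _ F(2)[OF that] h a]) (use that F in blast)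
  have \<phi>_le: "cmod (\<phi> y) \<le> norm q * norm y" for y
    unfolding \<phi>_def
    by (rule order_trans[OF cmod_cinner_le]) (intro mult_left_mono order_trans[OF norm_e_N_le], simp_all)
  have "cmod (\<phi> (amp f \<cdot> \<Omega>)) \<le> 0 + e" if e: "e > 0" for e
  proof -
    define K where "K = norm q + 1"
    have K: "K > 0" "norm q \<le> K" using norm_ge_zero[of q] by (simp_all add: K_def add_nonneg_pos)
    obtain A c where A: "finite A" "A \<subseteq> F" "norm (amp f \<cdot> \<Omega> - (\<Sum>b\<in>A. c b *\<^sub>C (amp b \<cdot> \<Omega>))) < e / K"
      by (rule L2_dense[OF norm2 F(1) dense f divide_pos_pos[OF e K(1)]])
    have "\<phi> (\<Sum>b\<in>A. c b *\<^sub>C (amp b \<cdot> \<Omega>)) = 0"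
      using A(2) by (simp add: linear_sum[OF bounded_linear.linear[OF \<phi>_linear]] \<phi>_scaleC \<phi>_F subset_iff)
    then have "cmod (\<phi> (amp f \<cdot> \<Omega>)) = cmod (\<phi> (amp f \<cdot> \<Omega> - (\<Sum>b\<in>A. c b *\<^sub>C (amp b \<cdot> \<Omega>))))"
      by (simp add: linear_diff[OF bounded_linear.linear[OF \<phi>_linear]])
    also have "\<dots> \<le> norm q * norm (amp f \<cdot> \<Omega> - (\<Sum>b\<in>A. c b *\<^sub>C (amp b \<cdot> \<Omega>)))" by (rule \<phi>_le)
    also have "\<dots> \<le> K * (e / K)" using A(3) K by (intro mult_mono) auto
    also have "\<dots> = e" using K by simp
    finally show ?thesis by simp
  qed
  then have "cmod (\<phi> (amp f \<cdot> \<Omega>)) \<le> 0" by (rule field_le_epsilon)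
  then show ?thesis by (simp add: \<phi>_def q_def)
qed

theorem theorem3p10:
  fixes \<sigma> :: "'g::group_add \<Rightarrow> 'h::complex_hilbert operator \<Rightarrow> 'h operator"
    and \<tau> :: "'h operator \<Rightarrow> complex"
    and P0 P :: "'h operator set"
    and N :: "('g, 'h) ell2 operator set"
  assumes "countable (UNIV :: 'g set)"
    and "icc TYPE('g)"
    and "compact_extension \<sigma> P0 P \<tau>"
    and "von_neumann_algebra N"
    and "crossed_product \<sigma> P0 \<subseteq> N"
    and "N \<subseteq> crossed_product \<sigma> P"
  shows "\<exists>Q. von_neumann_algebra Q \<and> P0 \<subseteq> Q \<and> Q \<subseteq> P \<and> (\<forall>g. \<sigma> g ` Q = Q) \<and>
             N = crossed_product \<sigma> Q"
proof -
  obtain F where ext: "tracial_extension \<sigma> P0 P \<tau>" and F: "F \<subseteq> P"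
    and dense: "\<And>\<xi> \<epsilon>. \<xi> \<in> L2 P \<tau> \<Longrightarrow> \<epsilon> > 0 \<Longrightarrow> \<exists>a\<in>op_cspan F. L2_norm \<tau> (\<lambda>k. \<xi> k - a) < \<epsilon>"
    and approx: "\<And>f \<epsilon>. f \<in> F \<Longrightarrow> \<epsilon> > 0 \<Longrightarrow> \<exists>(n::nat) \<xi>. (\<forall>i\<in>{1..n}. \<xi> i \<in> L2 P \<tau>) \<and>
      (\<exists>\<kappa>. (\<forall>i\<in>{1..n}. \<forall>g. \<kappa> i g \<in> P0) \<and> (\<exists>C. \<forall>i\<in>{1..n}. \<forall>g. norm (\<kappa> i g) \<le> C) \<and>
        (\<forall>g. L2_norm \<tau> (\<lambda>k. \<sigma> g f - (\<Sum>i\<in>{1..n}. \<kappa> i g o\<^sub>L \<xi> i k)) \<le> \<epsilon>))"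
    using assms(3) unfolding compact_extension_def by (elim exE conjE) (rule that, blast+)
  have vP: "von_neumann_algebra P" and P0: "P0 \<subseteq> P" and ft: "faithful_normal_trace P \<tau>"
    and act: "trace_preserving_action \<sigma> P \<tau>"
    using ext by (auto simp: tracial_extension_def)
  obtain \<Omega> :: "(nat \<times> nat \<times> nat, 'h) ell2" where tv: "trace_vector P \<Omega>"
    and \<tau>: "\<And>a b. a \<in> P \<Longrightarrow> b \<in> P \<Longrightarrow> \<tau> (op_adjoint b o\<^sub>L a) = cinner (amp a \<cdot> \<Omega>) (amp b \<cdot> \<Omega>)"
    using faithful_normal_trace_vector[OF vP ft] by blast
  interpret trace_vector P \<Omega> by (rule tv)
  have \<tau>_vector: "\<tau> a = cinner (amp a \<cdot> \<Omega>) \<Omega>" if "a \<in> P" for a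
  proof -
    have "op_adjoint id_blinfun o\<^sub>L a = a" by (rule blinfun_eqI) simp
    then show ?thesis using \<tau>[OF that star_algebraD(2)[OF alg]] by simp
  qed
  interpret vector_action P \<Omega> \<sigma>
  proof
    fix a g assume a: "a \<in> P"
    have "bij_betw (\<sigma> g) P P" "\<tau> (\<sigma> g a) = \<tau> a"
      using act a by (simp_all add: trace_preserving_action_def star_automorphism_def)
    moreover from this have "\<sigma> g a \<in> P" using a bij_betwE by blast
    ultimately show "cinner (amp (\<sigma> g a) \<cdot> \<Omega>) \<Omega> = cinner (amp a \<cdot> \<Omega>) \<Omega>" using a by (simp add: \<tau>_vector)
  qed (use act in \<open>auto simp: trace_preserving_action_def\<close>)
  have gen: "emb ` P0 \<union> range unitary \<subseteq> N"
    by (rule order_trans[OF _ assms(5)]) (unfold crossed_product_def, rule vN_generated_supset)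
  interpret intermediate_algebra P \<Omega> \<sigma> P0 N
    by standard (use assms(4,6) crossed_product_subset_full P0 gen in auto)
  have norm2: "norm2 \<tau> a = norm (amp a \<cdot> \<Omega>)" if "a \<in> P" for a
    using \<tau>[OF that that] by (simp add: norm2_def cinner_same)
  have "compact_vector f" if "f \<in> F" for f
    by (rule compact_vectorI[OF norm2 _ approx[OF that]]) (use that F in auto)
  then interpret compact_intermediate_algebra P \<Omega> \<sigma> P0 N
    by unfold_locales (rule e_N_diagonal_if_dense[OF assms(2) norm2 F _ dense])
  have "P0 \<subseteq> Q" "Q \<subseteq> P" using P0 emb_P0 by (auto simp: Q_def)
  then show ?thesis using von_neumann_algebra_Q act_Q N_eq_crossed_product by blast
qed

end
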